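(* Let $A=A_M=\begin{pmatrix}I&M+\frac12I \\ I&M-\frac12I\end{pmatrix}\in\mathrm{GL}(2d,\mathbb{R})$ be the Cohen-type matrix associated with $M$, where $M\in\mathrm{GL}(d,\mathbb{R})$. Then the Cohen's kernel $\theta_M=\mathcal{F}_\sigma\chi_M\in\mathcal{S}'(\mathbb{R}^{2d})$, where $\chi_M(\xi,\eta)=e^{2\pi i\eta\cdot M\xi}$, is given by $$\theta_M(x,\omega)=\frac{1}{|\det M|}\,e^{2\pi i\,x\cdot M^{-1}\omega},\qquad (x,\omega)\in\mathbb{R}^d\times\mathbb{R}^d.$$
   Context: $I$ is the $d\times d$ identity matrix. The symplectic Fourier transform on $\mathbb{R}^{2d}$ is $\mathcal{F}_\sigma F(x,\omega)=\mathcal{F}F(\omega,-x)$, extended to $\mathcal{S}'(\mathbb{R}^{2d})$, where $\mathcal{F}F(z)=\int_{\mathbb{R}^{2d}}e^{-2\pi iz\cdot w}F(w)\,dw$. The distribution of Wigner type associated with $A_M$ is $\mathcal{B}_{A_M}(f,g)(x,\omega)=\int_{\mathbb{R}^d}e^{-2\pi i\omega\cdot y}f(x+(M+\frac12I)y)\overline{g(x+(M-\frac12I)y)}\,dy$, and $\theta_M$ is its Cohen's kernel, i.e. $\mathcal{B}_{A_M}(f,g)=W(f,g)*\theta_M$ for all $f,g\in\mathcal{S}(\mathbb{R}^d)$, where $W(f,g)(x,\omega)=\int_{\mathbb{R}^d}e^{-2\pi i\omega\cdot y}f(x+\frac y2)\overline{g(x-\frac y2)}\,dy$ is the Wigner 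distribution.
   Formalization: The phase x·M^{-1}ω is corrected to x·(M^{-1})^Tω: with the stated conventions the printed formula fails for non-symmetric M (e.g. d=2, M=[[0,1],[-1,0]], where the sign of the phase is wrong) and agrees with the corrected one when M is symmetric. *)

theory Defs
  imports "HOL-Analysis.Analysis"
begin

section \<open>Schwartz functions and tempered distributions\<close>

definition partial_deriv :: "'a::euclidean_space \<Rightarrow> ('a \<Rightarrow> complex) \<Rightarrow> 'a \<Rightarrow> complex" where
  "partial_deriv v f x = frechet_derivative f (at x) v"

fun iter_partial :: "'a::euclidean_space list \<Rightarrow> ('a \<Rightarrow> complex) \<Rightarrow> 'a \<Rightarrow> complex" where
  "iter_partial [] f = f"
| "iter_partial (v # vs) f = partial_deriv v (iter_partial vs f)"

definition schwartz :: "('a::euclidean_space \<Rightarrow> complex) set" where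
  "schwartz = {f. \<forall>vs. set vs \<subseteq> Basis \<longrightarrow>
     (\<forall>x. iter_partial vs f differentiable (at x)) \<and>
     (\<forall>k::nat. bounded (range (\<lambda>x. norm x ^ k * norm (iter_partial vs f x))))}"

definition schwartz_norm :: "nat \<Rightarrow> ('a::euclidean_space \<Rightarrow> complex) \<Rightarrow> real" where
  "schwartz_norm N f =
     (\<Sum>vs | set vs \<subseteq> Basis \<and> length vs \<le> N.
        SUP x. (1 + norm x) ^ N * norm (iter_partial vs f x))"

text \<open>Continuous linear functionals on the Schwartz space. They are taken extensional
  (\<open>undefined\<close> off the Schwartz space), so that equality of functionals is equality of tempered
  distributions. The norms above are increasing in \<open>N\<close> and generate the Schwartz topology, hence
  continuity is a bound by one of them. The pairing is bilinear, not sesquilinear.\<close>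

definition tempered :: "(('a::euclidean_space \<Rightarrow> complex) \<Rightarrow> complex) set" where
  "tempered = {T \<in> extensional schwartz.
     (\<forall>\<phi>\<in>schwartz. \<forall>\<psi>\<in>schwartz. T (\<lambda>x. \<phi> x + \<psi> x) = T \<phi> + T \<psi>) \<and>
     (\<forall>c. \<forall>\<phi>\<in>schwartz. T (\<lambda>x. c * \<phi> x) = c * T \<phi>) \<and>
     (\<exists>C N. \<forall>\<phi>\<in>schwartz. norm (T \<phi>) \<le> C * schwartz_norm N \<phi>)}"

definition dist_of_fun :: "('a::euclidean_space \<Rightarrow> complex) \<Rightarrow> ('a \<Rightarrow> complex) \<Rightarrow> complex" where
  "dist_of_fun F = (\<lambda>\<phi>\<in>schwartz. LINT x|lborel. F x * \<phi> x)"

definition convolution_dist ::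
  "('a::euclidean_space \<Rightarrow> complex) \<Rightarrow> (('a \<Rightarrow> complex) \<Rightarrow> complex) \<Rightarrow> 'a \<Rightarrow> complex" where
  "convolution_dist \<Phi> T z = T (\<lambda>u. \<Phi> (z - u))"

section \<open>Fourier and symplectic Fourier transform\<close>

definition fourier :: "('a::euclidean_space \<Rightarrow> complex) \<Rightarrow> 'a \<Rightarrow> complex" where
  "fourier F z = (LINT w|lborel. cis (- 2 * pi * (z \<bullet> w)) * F w)"

definition fourier_dist ::
  "(('a::euclidean_space \<Rightarrow> complex) \<Rightarrow> complex) \<Rightarrow> ('a \<Rightarrow> complex) \<Rightarrow> complex" where
  "fourier_dist T = (\<lambda>\<phi>\<in>schwartz. T (fourier \<phi>))"

definition symplectic_fourier ::
  "((real^'n) \<times> (real^'n) \<Rightarrow> complex) \<Rightarrow> (real^'n) \<times> (real^'n) \<Rightarrow> complex" where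
  "symplectic_fourier F = (\<lambda>(x, \<omega>). fourier F (\<omega>, - x))"

text \<open>The extension of the symplectic transform is the distributional Fourier transform pulled
  back along \<open>J (x, \<omega>) = (\<omega>, - x)\<close>. As \<open>\<bar>det J\<bar> = 1\<close>, pulling back a distribution along \<open>J\<close>
  means composing test functions with the inverse \<open>(x, \<omega>) \<mapsto> (- \<omega>, x)\<close>.\<close>

definition symplectic_fourier_dist ::
  "(((real^'n) \<times> (real^'n) \<Rightarrow> complex) \<Rightarrow> complex) \<Rightarrow>
   ((real^'n) \<times> (real^'n) \<Rightarrow> complex) \<Rightarrow> complex" where
  "symplectic_fourier_dist T =
     (\<lambda>\<phi>\<in>schwartz. fourier_dist T (\<lambda>(x, \<omega>). \<phi> (- \<omega>, x)))"

section \<open>Distributions of Wigner type and Cohen's kernels\<close>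

definition wigner ::
  "(real^'n \<Rightarrow> complex) \<Rightarrow> (real^'n \<Rightarrow> complex) \<Rightarrow> (real^'n) \<times> (real^'n) \<Rightarrow> complex" where
  "wigner f g = (\<lambda>(x, \<omega>). LINT y|lborel.
     cis (- 2 * pi * (\<omega> \<bullet> y)) * f (x + (1/2) *\<^sub>R y) * cnj (g (x - (1/2) *\<^sub>R y)))"

text \<open>A \<open>2d \<times> 2d\<close> matrix is indexed by the sum type \<open>'n + 'n\<close>; \<open>Inl\<close> and \<open>Inr\<close> select the first
  and second block of rows or columns.\<close>

definition block :: "real^('n + 'n)^('n + 'n) \<Rightarrow> ('n \<Rightarrow> 'n + 'n) \<Rightarrow> ('n \<Rightarrow> 'n + 'n) \<Rightarrow> real^'n^'n"
  where "block A r c = (\<chi> i j. A $ r i $ c j)"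

definition wigner_type :: "real^('n + 'n)^('n + 'n) \<Rightarrow>
  (real^'n \<Rightarrow> complex) \<Rightarrow> (real^'n \<Rightarrow> complex) \<Rightarrow> (real^'n) \<times> (real^'n) \<Rightarrow> complex" where
  "wigner_type A f g = (\<lambda>(x, \<omega>). LINT y|lborel.
     cis (- 2 * pi * (\<omega> \<bullet> y)) * f (block A Inl Inl *v x + block A Inl Inr *v y)
       * cnj (g (block A Inr Inl *v x + block A Inr Inr *v y)))"

definition cohen_matrix :: "real^'n^'n \<Rightarrow> real^('n + 'n)^('n + 'n)" where
  "cohen_matrix M = (\<chi> r c. case r of
     Inl i \<Rightarrow> (case c of Inl j \<Rightarrow> mat 1 $ i $ j | Inr j \<Rightarrow> (M + (1/2) *\<^sub>R mat 1) $ i $ j)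
   | Inr i \<Rightarrow> (case c of Inl j \<Rightarrow> mat 1 $ i $ j | Inr j \<Rightarrow> (M - (1/2) *\<^sub>R mat 1) $ i $ j))"

lemma block_cohen_matrix:
  "block (cohen_matrix M) Inl Inl = mat 1"
  "block (cohen_matrix M) Inl Inr = M + (1/2) *\<^sub>R mat 1"
  "block (cohen_matrix M) Inr Inl = mat 1"
  "block (cohen_matrix M) Inr Inr = M - (1/2) *\<^sub>R mat 1"
  by (simp_all add: block_def cohen_matrix_def vec_eq_iff)

lemma wigner_type_cohen_matrix:
  "wigner_type (cohen_matrix M) f g (x, \<omega>) = (LINT y|lborel.
     cis (- 2 * pi * (\<omega> \<bullet> y)) * f (x + (M + (1/2) *\<^sub>R mat 1) *v y)
       * cnj (g (x + (M - (1/2) *\<^sub>R mat 1) *v y)))"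
  by (simp add: wigner_type_def block_cohen_matrix)

definition is_cohen_kernel :: "real^('n + 'n)^('n + 'n) \<Rightarrow>
  (((real^'n) \<times> (real^'n) \<Rightarrow> complex) \<Rightarrow> complex) \<Rightarrow> bool" where
  "is_cohen_kernel A \<theta> \<longleftrightarrow> \<theta> \<in> tempered \<and>
     (\<forall>f\<in>schwartz. \<forall>g\<in>schwartz. \<forall>z. wigner_type A f g z = convolution_dist (wigner f g) \<theta> z)"

text \<open>Pitfall: the matrix of the bilinear form in the symplectic Fourier transform of this chirp is
  the transpose of \<open>M\<^sup>-\<^sup>1\<close>. Formally, integrating the transform over \<open>\<eta>\<close> gives \<open>\<delta> (x + M \<xi>)\<close>,
  so \<open>\<xi> = - M\<^sup>-\<^sup>1 x\<close> and the phase is \<open>\<omega> \<bullet> (M\<^sup>-\<^sup>1 x)\<close>, that is \<open>x \<bullet> ((M\<^sup>-\<^sup>1)\<^sup>T \<omega>)\<close>.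
  It agrees with \<open>x \<bullet> (M\<^sup>-\<^sup>1 \<omega>)\<close> exactly when \<open>M\<close> is symmetric.\<close>

definition cohen_chirp :: "real^'n^'n \<Rightarrow> (real^'n) \<times> (real^'n) \<Rightarrow> complex" where
  "cohen_chirp M = (\<lambda>(\<xi>, \<eta>). cis (2 * pi * (\<eta> \<bullet> (M *v \<xi>))))"

end

theory Submission
  imports Defs "HOL-Probability.Characteristic_Functions" "HOL-Probability.Sinc_Integral"
begin

text \<open>
  Write \<open>K\<close> for the function on the right of the last equation of the theorem, \<open>\<Phi> \<mapsto> \<F>\<^sub>2 \<Phi>\<close> for the
  Fourier transform in the second variable of a Schwartz function on a product space, and
  \<open>L (x, y) = (x + y/2, x - y/2)\<close>. Then \<open>W(f, g) = \<F>\<^sub>2 ((f \<otimes> cnj g) \<circ> L)\<close>, and by Fourier inversion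
  \<open>\<F>\<^sub>2 (\<F>\<^sub>2 \<Phi>) (x, y) = \<Phi> (x, - y)\<close>. The second identity makes every oscillatory integral that occurs
  collapse: integrating \<open>\<F>\<^sub>2 \<Phi>\<close> against a character in its second variable is evaluation of \<open>\<Phi>\<close>.

  For fixed \<open>\<xi>\<close> the chirp is a character in \<open>\<eta>\<close>, and for fixed \<open>x\<close> so is \<open>K\<close> in \<open>\<omega>\<close>. Therefore the pairing of
  the chirp with the Fourier transform of a test function, and the convolution of \<open>W(f, g)\<close> with \<open>K\<close>,
  each reduce to one absolutely convergent integral, and the substitution \<open>x = - M y\<close> with its
  Jacobian \<open>\<bar>det M\<bar>\<close> gives \<open>symplectic_fourier_chirp\<close> (the symplectic transform of the chirp is \<open>K\<close>) and
  \<open>cohen_kernel_convolution\<close> (\<open>K\<close> is a Cohen kernel).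

  For uniqueness, the map \<open>\<Phi> \<mapsto> \<F>\<^sub>2 (\<Phi> \<circ> L)\<close> is a continuous bijection of the Schwartz space taking
  \<open>f \<otimes> cnj g\<close> to \<open>W(f, g)\<close>, and the convolution at the origin pairs the kernel with the
  reflection of \<open>W(f, g)\<close>. The difference of two Cohen kernels hence pulls back to a continuous
  functional that vanishes on all tensor products, and such a functional is zero
  (\<open>functional_eq_0_if_vanishes_on_tensors\<close>). The reason for this density: a Schwartz
  function is the limit of its Gaussian mollifications, these are integrals of translated Gaussians,
  which are tensor products, and the integrals are limits of Riemann sums in each Schwartz norm
  (\<open>functional_marginal_eq_0\<close>).

  The estimates in the Schwartz norms rest on one principle, \<open>schwartz_family\<close>: for a family of functions
  closed under partial derivatives and multiplication by coordinates, uniform bounds on the functions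
  already bound all Schwartz norms.
\<close>

section \<open>Schwartz norms and families closed under derivatives and coordinates\<close>

definition coord_mult :: "'a::euclidean_space \<Rightarrow> ('a \<Rightarrow> complex) \<Rightarrow> 'a \<Rightarrow> complex" where
  "coord_mult b f = (\<lambda>x. complex_of_real (x \<bullet> b) * f x)"

lemma iter_partial_append: "iter_partial (us @ vs) f = iter_partial us (iter_partial vs f)"
  by (induction us) auto

lemma partial_derivI: "(f has_derivative f') (at x) \<Longrightarrow> partial_deriv b f x = f' b"
  unfolding partial_deriv_def by (metis frechet_derivative_at)

lemma differentiable_expand:
  fixes f :: "'a::euclidean_space \<Rightarrow> complex"
  assumes "f differentiable (at x)"
  shows "(f has_derivative (\<lambda>h. \<Sum>b\<in>Basis. (h \<bullet> b) *\<^sub>R partial_deriv b f x)) (at x)"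
proof -
  have D: "(f has_derivative frechet_derivative f (at x)) (at x)"
    using assms by (simp add: frechet_derivative_works)
  then have L: "linear (frechet_derivative f (at x))"
    by (rule has_derivative_linear)
  have "frechet_derivative f (at x) h = (\<Sum>b\<in>Basis. (h \<bullet> b) *\<^sub>R partial_deriv b f x)" for h
  proof -
    have "frechet_derivative f (at x) h = frechet_derivative f (at x) (\<Sum>b\<in>Basis. (h \<bullet> b) *\<^sub>R b)"
      by (simp add: euclidean_representation)
    also have "\<dots> = (\<Sum>b\<in>Basis. (h \<bullet> b) *\<^sub>R partial_deriv b f x)"
      using L by (simp add: linear_sum linear_scale partial_deriv_def)
    finally show ?thesis .
  qed
  then have "frechet_derivative f (at x) = (\<lambda>h. \<Sum>b\<in>Basis. (h \<bullet> b) *\<^sub>R partial_deriv b f x)"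
    by (rule ext)
  then show ?thesis using D by simp
qed

text \<open>The bound is uniform in the parameter \<open>p\<close>. With a one-point \<open>P\<close> it says that a function is bounded; with
\<open>P\<close> the Schwartz space and \<open>q\<close> its norms it says that an operator satisfies a continuity estimate.
The same arguments thus give membership in the Schwartz space and continuity.\<close>

definition tame :: "'p set \<Rightarrow> (nat \<Rightarrow> 'p \<Rightarrow> real) \<Rightarrow> ('p \<Rightarrow> 'a \<Rightarrow> real) \<Rightarrow> bool" where
  "tame P q F \<longleftrightarrow> (\<exists>C N. \<forall>p\<in>P. \<forall>x. F p x \<le> C * q N p)"

text \<open>Monotonicity in the index lets finitely many estimates share a single norm.\<close>

definition graded_norm :: "'p set \<Rightarrow> (nat \<Rightarrow> 'p \<Rightarrow> real) \<Rightarrow> bool" where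
  "graded_norm P q \<longleftrightarrow> (\<forall>p\<in>P. mono (\<lambda>n. q n p) \<and> 0 \<le> q 0 p)"

lemma graded_norm_nonneg: "graded_norm P q \<Longrightarrow> p \<in> P \<Longrightarrow> 0 \<le> q n p"
  unfolding graded_norm_def mono_def by (meson le0 order_trans)

lemma tameE:
  assumes "tame P q F" "graded_norm P q"
  obtains C N where "0 \<le> C" "\<And>p x n. p \<in> P \<Longrightarrow> N \<le> n \<Longrightarrow> F p x \<le> C * q n p"
proof -
  obtain C N where CN: "\<And>p x. p \<in> P \<Longrightarrow> F p x \<le> C * q N p"
    using assms(1) unfolding tame_def by blast
  have "F p x \<le> max C 0 * q n p" if "p \<in> P" "N \<le> n" for p x n
  proof -
    have "F p x \<le> C * q N p" using CN that by auto
    also have "\<dots> \<le> max C 0 * q n p"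
      using that assms(2) graded_norm_nonneg[OF assms(2) that(1)]
      by (intro mult_mono) (auto simp: graded_norm_def mono_def)
    finally show ?thesis .
  qed
  then show thesis by (intro that[of "max C 0"]) auto
qed

lemma tame_mono:
  "tame P q G \<Longrightarrow> (\<And>p x. p \<in> P \<Longrightarrow> F p x \<le> G p x) \<Longrightarrow> tame P q F"
  unfolding tame_def by (meson order_trans)

lemma tame_scale:
  assumes "tame P q F" "graded_norm P q" "0 \<le> c"
  shows "tame P q (\<lambda>p x. c * F p x)"
proof -
  obtain C N where CN: "0 \<le> C" "\<And>p x n. p \<in> P \<Longrightarrow> N \<le> n \<Longrightarrow> F p x \<le> C * q n p"
    using tameE[OF assms(1,2)] by metis
  show ?thesis unfolding tame_def
    using CN assms(3) by (intro exI[of _ "c * C"] exI[of _ N]) (auto simp: mult.assoc intro!: mult_left_mono)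
qed

lemma tame_add:
  assumes "tame P q F" "tame P q G" "graded_norm P q"
  shows "tame P q (\<lambda>p x. F p x + G p x)"
proof -
  obtain C N where CN: "0 \<le> C" "\<And>p x n. p \<in> P \<Longrightarrow> N \<le> n \<Longrightarrow> F p x \<le> C * q n p"
    using tameE[OF assms(1,3)] by metis
  obtain D M where DM: "0 \<le> D" "\<And>p x n. p \<in> P \<Longrightarrow> M \<le> n \<Longrightarrow> G p x \<le> D * q n p"
    using tameE[OF assms(2,3)] by metis
  show ?thesis unfolding tame_def
    using CN(2)[of _ "max N M"] DM(2)[of _ "max N M"]
    by (intro exI[of _ "C + D"] exI[of _ "max N M"]) (auto simp: algebra_simps intro!: add_mono)
qed

lemma tame_sum:
  assumes "finite S" "\<And>i. i \<in> S \<Longrightarrow> tame P q (F i)" "graded_norm P q"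
  shows "tame P q (\<lambda>p x. \<Sum>i\<in>S. F i p x)"
  using assms(1,2)
proof (induction S rule: finite_induct)
  case empty
  show ?case unfolding tame_def by (auto intro: exI[of _ 0])
next
  case (insert i S)
  then show ?case using tame_add[OF _ _ assms(3), of "F i"] by auto
qed

text \<open>Schwartz seminorms involve every derivative and every weight at once. If a family is closed
under the operators \<open>\<partial>\<^sub>b\<close> and \<open>x\<^sub>b\<close>, each derivative of a member is again a member, and a power of
\<open>1 + norm x\<close> is absorbed one factor at a time through \<open>norm x \<le> (\<Sum>b\<in>Basis. \<bar>x \<bullet> b\<bar>)\<close>. Hence plain
uniform bounds on the members control all seminorms.\<close>

theorem schwartz_family:
  fixes \<A> :: "('p \<Rightarrow> 'a::euclidean_space \<Rightarrow> complex) set"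
  assumes q: "graded_norm P q"
    and diff: "\<And>A p x. A \<in> \<A> \<Longrightarrow> p \<in> P \<Longrightarrow> A p differentiable (at x)"
    and bnd: "\<And>A. A \<in> \<A> \<Longrightarrow> tame P q (\<lambda>p x. norm (A p x))"
    and der: "\<And>A b. A \<in> \<A> \<Longrightarrow> b \<in> Basis \<Longrightarrow> \<exists>B\<in>\<A>. \<forall>p\<in>P. partial_deriv b (A p) = B p"
    and crd: "\<And>A b. A \<in> \<A> \<Longrightarrow> b \<in> Basis \<Longrightarrow> \<exists>B\<in>\<A>. \<forall>p\<in>P. coord_mult b (A p) = B p"
    and A: "A \<in> \<A>"
  shows "\<And>p. p \<in> P \<Longrightarrow> A p \<in> schwartz"
    and "\<And>k vs. set vs \<subseteq> Basis \<Longrightarrow>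
      tame P q (\<lambda>p x. (1 + norm x) ^ k * norm (iter_partial vs (A p) x))"
proof -
  have closed: "\<exists>B\<in>\<A>. \<forall>p\<in>P. iter_partial vs (A p) = B p" if "set vs \<subseteq> Basis" for vs
    using that
  proof (induction vs)
    case Nil
    then show ?case using A by auto
  next
    case (Cons v vs)
    then obtain B where B: "B \<in> \<A>" "\<And>p. p \<in> P \<Longrightarrow> iter_partial vs (A p) = B p" by auto
    obtain B' where "B' \<in> \<A>" "\<And>p. p \<in> P \<Longrightarrow> partial_deriv v (B p) = B' p"
      using der[OF B(1), of v] Cons.prems by auto
    then show ?case using B by auto
  qed
  have decay: "\<forall>A\<in>\<A>. tame P q (\<lambda>p x. (1 + norm x) ^ k * norm (A p x))" for k
  proof (induction k)
    case 0
    then show ?case using bnd by simp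
  next
    case (Suc k)
    show ?case
    proof
      fix A assume A: "A \<in> \<A>"
      have "\<forall>b\<in>Basis. \<exists>B\<in>\<A>. \<forall>p\<in>P. coord_mult b (A p) = B p" using crd[OF A] by auto
      then obtain B where B: "\<And>b. b \<in> Basis \<Longrightarrow> B b \<in> \<A>"
        "\<And>b p. b \<in> Basis \<Longrightarrow> p \<in> P \<Longrightarrow> coord_mult b (A p) = B b p" by metis
      let ?G = "\<lambda>p x. (1 + norm x) ^ k * norm (A p x) +
        (\<Sum>b\<in>Basis. (1 + norm x) ^ k * norm (B b p x))"
      have "tame P q ?G"
        using Suc A B q by (intro tame_add tame_sum) auto
      then show "tame P q (\<lambda>p x. (1 + norm x) ^ Suc k * norm (A p x))"
      proof (rule tame_mono)
        fix p x assume p: "p \<in> P"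
        have "norm (B b p x) = \<bar>x \<bullet> b\<bar> * norm (A p x)" if "b \<in> Basis" for b
          using fun_cong[OF B(2)[OF that p, symmetric], of x] by (simp add: coord_mult_def norm_mult)
        then have "?G p x = (1 + norm x) ^ k * norm (A p x) * (1 + (\<Sum>b\<in>Basis. \<bar>x \<bullet> b\<bar>))"
          by (simp add: algebra_simps sum_distrib_left)
        moreover have "(1 + norm x) ^ Suc k * norm (A p x)
            \<le> (1 + norm x) ^ k * norm (A p x) * (1 + (\<Sum>b\<in>Basis. \<bar>x \<bullet> b\<bar>))"
          using mult_left_mono[of "1 + norm x" "1 + (\<Sum>b\<in>Basis. \<bar>x \<bullet> b\<bar>)" "(1 + norm x) ^ k * norm (A p x)"]
            norm_le_l1[of x] by (simp add: mult_ac)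
        ultimately show "(1 + norm x) ^ Suc k * norm (A p x) \<le> ?G p x" by simp
      qed
    qed
  qed
  show T: "tame P q (\<lambda>p x. (1 + norm x) ^ k * norm (iter_partial vs (A p) x))"
    if vs: "set vs \<subseteq> Basis" for k vs
  proof -
    obtain B where "B \<in> \<A>" "\<And>p. p \<in> P \<Longrightarrow> iter_partial vs (A p) = B p"
      using closed[OF vs] by auto
    then show ?thesis using decay[of k] by (auto elim!: tame_mono)
  qed
  show "A p \<in> schwartz" if p: "p \<in> P" for p
    unfolding schwartz_def
  proof (intro CollectI allI impI conjI)
    fix vs x assume vs: "set vs \<subseteq> (Basis :: 'a set)"
    show "iter_partial vs (A p) differentiable at x"
      using closed[OF vs] p diff by metis
  next
    fix vs k assume vs: "set vs \<subseteq> (Basis :: 'a set)"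
    obtain C N where C: "\<And>x. (1 + norm x) ^ k * norm (iter_partial vs (A p) x) \<le> C * q N p"
      using T[OF vs, of k] p unfolding tame_def by blast
    show "bounded (range (\<lambda>x. norm x ^ k * norm (iter_partial vs (A p) x)))"
      unfolding bounded_iff
    proof (intro exI[of _ "C * q N p"] ballI, clarify)
      fix x
      have "norm x ^ k * norm (iter_partial vs (A p) x) \<le> (1 + norm x) ^ k * norm (iter_partial vs (A p) x)"
        by (intro mult_right_mono power_mono) auto
      also note C
      finally show "norm (norm x ^ k * norm (iter_partial vs (A p) x)) \<le> C * q N p" by simp
    qed
  qed
qed

corollary schwartz_coinduct:
  fixes X :: "('a::euclidean_space \<Rightarrow> complex) set"
  assumes "\<And>f x. f \<in> X \<Longrightarrow> f differentiable (at x)"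
    and "\<And>f. f \<in> X \<Longrightarrow> \<exists>C. \<forall>x. norm (f x) \<le> C"
    and "\<And>f b. f \<in> X \<Longrightarrow> b \<in> Basis \<Longrightarrow> partial_deriv b f \<in> X"
    and "\<And>f b. f \<in> X \<Longrightarrow> b \<in> Basis \<Longrightarrow> coord_mult b f \<in> X"
    and "f \<in> X"
  shows "f \<in> schwartz"
proof -
  have der: "\<exists>B\<in>(\<lambda>f _. f) ` X. \<forall>p\<in>UNIV. partial_deriv b (A p) = B p"
    if "A \<in> (\<lambda>f (_::unit). f) ` X" "b \<in> Basis" for A b
    using that assms(3) by force
  have crd: "\<exists>B\<in>(\<lambda>f _. f) ` X. \<forall>p\<in>UNIV. coord_mult b (A p) = B p"
    if "A \<in> (\<lambda>f (_::unit). f) ` X" "b \<in> Basis" for A b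
    using that assms(4) by force
  have bnd: "tame UNIV (\<lambda>_ _. 1) (\<lambda>p x. norm (A p x))" if A: "A \<in> (\<lambda>f (_::unit). f) ` X" for A
  proof -
    obtain g where "g \<in> X" "A = (\<lambda>_. g)" using A by auto
    then show ?thesis using assms(2)[of g] unfolding tame_def by auto
  qed
  have "(\<lambda>_::unit. f) () \<in> schwartz"
    by (rule schwartz_family(1)[OF _ _ bnd der crd])
      (use assms(1,5) in \<open>auto simp: graded_norm_def mono_def\<close>)
  then show ?thesis by simp
qed

lemma schwartz_iter_differentiable:
  "f \<in> schwartz \<Longrightarrow> set vs \<subseteq> Basis \<Longrightarrow> iter_partial vs f differentiable (at x)"
  unfolding schwartz_def by blast

lemma schwartz_differentiable: "f \<in> schwartz \<Longrightarrow> f differentiable (at x)"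
  using schwartz_iter_differentiable[of f "[]"] by simp

lemma schwartz_continuous: "f \<in> schwartz \<Longrightarrow> continuous_on A f"
  by (meson schwartz_differentiable continuous_at_imp_continuous_on differentiable_imp_continuous_within)

lemma schwartz_measurable [measurable]: "f \<in> schwartz \<Longrightarrow> f \<in> borel_measurable borel"
  by (simp add: borel_measurable_continuous_onI schwartz_continuous)

text \<open>The definition weights by powers of \<open>norm x\<close>, which vanish at the origin; the binomial theorem
passes to the weights \<open>(1 + norm x) ^ k\<close> of the norms.\<close>

lemma schwartz_iter_decay:
  assumes "f \<in> schwartz" "set vs \<subseteq> Basis"
  shows "\<exists>C. \<forall>x. (1 + norm x) ^ k * norm (iter_partial vs f x) \<le> C"
proof -
  have "\<forall>j. \<exists>C. \<forall>x. norm x ^ j * norm (iter_partial vs f x) \<le> C"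
    using assms unfolding schwartz_def bounded_iff by fastforce
  then obtain C where C: "\<And>j x. norm x ^ j * norm (iter_partial vs f x) \<le> C j" by metis
  have "(1 + norm x) ^ k * norm (iter_partial vs f x) \<le> (\<Sum>j\<le>k. real (k choose j) * C j)" for x
  proof -
    have "(1 + norm x) ^ k = (\<Sum>j\<le>k. real (k choose j) * norm x ^ j)"
      by (subst add.commute, subst binomial_ring) simp
    then have "(1 + norm x) ^ k * norm (iter_partial vs f x)
      = (\<Sum>j\<le>k. real (k choose j) * (norm x ^ j * norm (iter_partial vs f x)))"
      by (simp add: sum_distrib_right mult.assoc)
    also have "\<dots> \<le> (\<Sum>j\<le>k. real (k choose j) * C j)"
      using C by (intro sum_mono mult_left_mono) auto
    finally show ?thesis .
  qed
  then show ?thesis by blast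
qed

lemma finite_index_lists: "finite {vs :: 'a::euclidean_space list. set vs \<subseteq> Basis \<and> length vs \<le> N}"
  by (rule finite_lists_length_le) simp

lemma bdd_above_weighted:
  fixes f :: "'a::euclidean_space \<Rightarrow> complex"
  assumes "f \<in> schwartz" "set vs \<subseteq> Basis"
  shows "bdd_above (range (\<lambda>x. (1 + norm x) ^ k * norm (iter_partial vs f x)))"
  using schwartz_iter_decay[OF assms, of k] unfolding bdd_above_def by auto

lemma sup_weighted_nonneg:
  fixes f :: "'a::euclidean_space \<Rightarrow> complex"
  assumes "f \<in> schwartz" "set vs \<subseteq> Basis"
  shows "0 \<le> (SUP x. (1 + norm x) ^ k * norm (iter_partial vs f x))"
proof -
  have "0 \<le> (1 + norm (0::'a)) ^ k * norm (iter_partial vs f 0)" by simp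
  also have "\<dots> \<le> (SUP x. (1 + norm x) ^ k * norm (iter_partial vs f x))"
    by (rule cSUP_upper[OF UNIV_I bdd_above_weighted[OF assms]])
  finally show ?thesis .
qed

lemma schwartz_norm_ge:
  assumes f: "f \<in> schwartz" and vs: "set vs \<subseteq> Basis" "length vs \<le> N" and k: "k \<le> N"
  shows "(1 + norm x) ^ k * norm (iter_partial vs f x) \<le> schwartz_norm N f"
proof -
  have "(1 + norm x) ^ k * norm (iter_partial vs f x) \<le> (1 + norm x) ^ N * norm (iter_partial vs f x)"
    using k by (intro mult_right_mono power_increasing) auto
  also have "\<dots> \<le> (SUP x. (1 + norm x) ^ N * norm (iter_partial vs f x))"
    by (rule cSUP_upper[OF UNIV_I bdd_above_weighted[OF f vs(1)]])
  also have "\<dots> \<le> schwartz_norm N f"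
    unfolding schwartz_norm_def
  proof (rule member_le_sum)
    show "vs \<in> {vs. set vs \<subseteq> Basis \<and> length vs \<le> N}" using vs by simp
    fix ws assume "ws \<in> {vs. set vs \<subseteq> Basis \<and> length vs \<le> N} - {vs}"
    then have "set ws \<subseteq> Basis" by simp
    from sup_weighted_nonneg[OF f this]
    show "0 \<le> (SUP x. (1 + norm x) ^ N * norm (iter_partial ws f x))" .
  qed (rule finite_index_lists)
  finally show ?thesis .
qed

lemma schwartz_norm_le:
  assumes "\<And>vs x. set vs \<subseteq> Basis \<Longrightarrow> length vs \<le> N \<Longrightarrow>
      (1 + norm x) ^ N * norm (iter_partial vs f x) \<le> C vs"
  shows "schwartz_norm N f \<le> (\<Sum>vs | set vs \<subseteq> Basis \<and> length vs \<le> N. C vs)"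
  unfolding schwartz_norm_def using assms by (intro sum_mono cSUP_least) auto

lemma graded_norm_schwartz: "graded_norm schwartz (schwartz_norm :: nat \<Rightarrow> ('a::euclidean_space \<Rightarrow> complex) \<Rightarrow> real)"
  unfolding graded_norm_def mono_def
proof (intro ballI conjI allI impI)
  fix f :: "'a \<Rightarrow> complex" and m n :: nat assume f: "f \<in> schwartz" and mn: "m \<le> n"
  note nn = sup_weighted_nonneg[OF f]
  have "schwartz_norm m f \<le> (\<Sum>vs | set vs \<subseteq> Basis \<and> length vs \<le> m.
      SUP x. (1 + norm x) ^ n * norm (iter_partial vs f x))"
  proof (rule schwartz_norm_le)
    fix vs :: "'a list" and x assume vs: "set vs \<subseteq> Basis"
    have "(1 + norm x) ^ m * norm (iter_partial vs f x) \<le> (1 + norm x) ^ n * norm (iter_partial vs f x)"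
      using mn by (intro mult_right_mono power_increasing) auto
    also have "\<dots> \<le> (SUP x. (1 + norm x) ^ n * norm (iter_partial vs f x))"
      by (rule cSUP_upper[OF UNIV_I bdd_above_weighted[OF f vs(1)]])
    finally show "(1 + norm x) ^ m * norm (iter_partial vs f x) \<le> \<dots>" .
  qed
  also have "\<dots> \<le> schwartz_norm n f"
    unfolding schwartz_norm_def using mn nn
    by (intro sum_mono2) (auto simp: finite_index_lists)
  finally show "schwartz_norm m f \<le> schwartz_norm n f" .
next
  fix f :: "'a \<Rightarrow> complex" assume f: "f \<in> schwartz"
  have "0 \<le> (1 + norm (0::'a)) ^ 0 * norm (iter_partial [] f 0)" by simp
  also have "\<dots> \<le> schwartz_norm 0 f" by (rule schwartz_norm_ge[OF f]) auto
  finally show "0 \<le> schwartz_norm 0 f" .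
qed

lemmas schwartz_norm_nonneg = graded_norm_nonneg[OF graded_norm_schwartz]

lemma schwartz_partial:
  fixes f :: "'a::euclidean_space \<Rightarrow> complex"
  shows "f \<in> schwartz \<Longrightarrow> b \<in> Basis \<Longrightarrow> partial_deriv b f \<in> schwartz"
  unfolding schwartz_def
proof (intro CollectI allI impI)
  fix vs :: "'a list" assume *: "f \<in> {f. \<forall>vs. set vs \<subseteq> Basis \<longrightarrow>
     (\<forall>x. iter_partial vs f differentiable (at x)) \<and>
     (\<forall>k::nat. bounded (range (\<lambda>x. norm x ^ k * norm (iter_partial vs f x))))}" "b \<in> Basis" "set vs \<subseteq> Basis"
  then have "set (vs @ [b]) \<subseteq> Basis" by auto
  with * have "(\<forall>x. iter_partial (vs @ [b]) f differentiable (at x)) \<and>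
     (\<forall>k::nat. bounded (range (\<lambda>x. norm x ^ k * norm (iter_partial (vs @ [b]) f x))))" by blast
  then show "(\<forall>x. iter_partial vs (partial_deriv b f) differentiable (at x)) \<and>
     (\<forall>k::nat. bounded (range (\<lambda>x. norm x ^ k * norm (iter_partial vs (partial_deriv b f) x))))"
    by (simp add: iter_partial_append)
qed

section \<open>Differential operators with polynomial coefficients\<close>

text \<open>The generators are families of functions indexed by a parameter. Indexed by Schwartz functions,
the families \<open>f \<mapsto> \<partial>\<^sup>v f\<close> generate the differential operators with polynomial coefficients; from the
single function \<open>gauss\<close> one obtains the Hermite functions. Both are closed under \<open>\<partial>\<^sub>b\<close> and \<open>x\<^sub>b\<close> by the
product rule, which is what \<open>schwartz_family\<close> asks for.\<close>

inductive_set poly_span :: "('p \<Rightarrow> 'a::euclidean_space \<Rightarrow> complex) set \<Rightarrow> ('p \<Rightarrow> 'a \<Rightarrow> complex) set"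
  for \<G> where
  base: "A \<in> \<G> \<Longrightarrow> A \<in> poly_span \<G>"
| coord: "A \<in> poly_span \<G> \<Longrightarrow> b \<in> Basis \<Longrightarrow> (\<lambda>p. coord_mult b (A p)) \<in> poly_span \<G>"
| add: "A \<in> poly_span \<G> \<Longrightarrow> B \<in> poly_span \<G> \<Longrightarrow> (\<lambda>p x. A p x + B p x) \<in> poly_span \<G>"
| scale: "A \<in> poly_span \<G> \<Longrightarrow> (\<lambda>p x. c * A p x) \<in> poly_span \<G>"

lemma coord_mult_has_derivative:
  assumes "f differentiable (at x)"
  shows "(coord_mult b f has_derivative
    (\<lambda>h. complex_of_real (x \<bullet> b) * frechet_derivative f (at x) h + complex_of_real (h \<bullet> b) * f x)) (at x)"
  unfolding coord_mult_def
  by (rule derivative_eq_intros refl assms[unfolded frechet_derivative_works])+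

lemma poly_span_differentiable:
  assumes "A \<in> poly_span \<G>" and "\<And>B. B \<in> \<G> \<Longrightarrow> B p differentiable (at x)"
  shows "A p differentiable (at x)"
  using assms(1)
proof induction
  case (coord A b)
  then show ?case using coord_mult_has_derivative differentiableI by blast
qed (auto simp: assms(2))

lemma poly_span_partial:
  assumes "A \<in> poly_span \<G>" "b \<in> Basis"
    and diff: "\<And>B p x. B \<in> \<G> \<Longrightarrow> p \<in> P \<Longrightarrow> B p differentiable (at x)"
    and der: "\<And>B. B \<in> \<G> \<Longrightarrow> \<exists>C\<in>poly_span \<G>. \<forall>p\<in>P. partial_deriv b (B p) = C p"
  shows "\<exists>B\<in>poly_span \<G>. \<forall>p\<in>P. partial_deriv b (A p) = B p"
  using assms(1)
proof induction
  case (base A)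
  then show ?case by (rule der)
next
  case (coord A c)
  have D: "A p differentiable (at x)" if "p \<in> P" for p x
    by (rule poly_span_differentiable[OF coord.hyps(1)]) (rule diff[OF _ that])
  obtain B where B: "B \<in> poly_span \<G>" "\<And>p. p \<in> P \<Longrightarrow> partial_deriv b (A p) = B p"
    using coord.IH by auto
  have "partial_deriv b (coord_mult c (A p)) = (\<lambda>x. coord_mult c (B p) x + complex_of_real (b \<bullet> c) * A p x)"
    if p: "p \<in> P" for p
    using partial_derivI[OF coord_mult_has_derivative[OF D[OF p]]]
    by (simp add: fun_eq_iff B(2)[OF p, symmetric] partial_deriv_def coord_mult_def)
  then show ?case
    by (intro bexI[OF _ poly_span.add[OF poly_span.coord[OF B(1) coord.hyps(2)]
      poly_span.scale[OF coord.hyps(1), of "complex_of_real (b \<bullet> c)"]]] ballI) blast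
next
  case (add A1 A2)
  have D1: "A1 p differentiable (at x)" if "p \<in> P" for p x
    by (rule poly_span_differentiable[OF add.hyps(1)]) (rule diff[OF _ that])
  have D2: "A2 p differentiable (at x)" if "p \<in> P" for p x
    by (rule poly_span_differentiable[OF add.hyps(2)]) (rule diff[OF _ that])
  obtain B1 B2 where B: "B1 \<in> poly_span \<G>" "\<And>p. p \<in> P \<Longrightarrow> partial_deriv b (A1 p) = B1 p"
    "B2 \<in> poly_span \<G>" "\<And>p. p \<in> P \<Longrightarrow> partial_deriv b (A2 p) = B2 p"
    using add.IH by auto
  have "partial_deriv b (\<lambda>x. A1 p x + A2 p x) = (\<lambda>x. B1 p x + B2 p x)" if p: "p \<in> P" for p
    using partial_derivI[OF has_derivative_add[OF
      D1[OF p, unfolded frechet_derivative_works] D2[OF p, unfolded frechet_derivative_works]], of b]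
    by (simp add: fun_eq_iff B(2,4)[OF p, symmetric] partial_deriv_def)
  then show ?case by (intro bexI[OF _ poly_span.add[OF B(1,3)]] ballI) blast
next
  case (scale A c)
  have D: "A p differentiable (at x)" if "p \<in> P" for p x
    by (rule poly_span_differentiable[OF scale.hyps(1)]) (rule diff[OF _ that])
  obtain B where B: "B \<in> poly_span \<G>" "\<And>p. p \<in> P \<Longrightarrow> partial_deriv b (A p) = B p"
    using scale.IH by auto
  have "partial_deriv b (\<lambda>x. c * A p x) = (\<lambda>x. c * B p x)" if p: "p \<in> P" for p
    using partial_derivI[OF has_derivative_mult_right[OF
      D[OF p, unfolded frechet_derivative_works]], of b c]
    by (simp add: fun_eq_iff B(2)[OF p, symmetric] partial_deriv_def)
  then show ?case by (intro bexI[OF _ poly_span.scale[OF B(1), of c]] ballI) blast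
qed

lemma poly_span_tame:
  assumes "A \<in> poly_span \<G>" and q: "graded_norm P q"
    and base: "\<And>B k. B \<in> \<G> \<Longrightarrow> tame P q (\<lambda>p x. (1 + norm x) ^ k * norm (B p x))"
  shows "tame P q (\<lambda>p x. (1 + norm x) ^ k * norm (A p x))"
  using assms(1)
proof (induction arbitrary: k)
  case (base A)
  then show ?case by (rule assms(3))
next
  case (coord A b)
  show ?case
  proof (rule tame_mono[OF coord.IH[of "Suc k"]])
    fix p x
    have "\<bar>x \<bullet> b\<bar> \<le> 1 + norm x"
      using Basis_le_norm[OF coord.hyps(2), of x] by linarith
    then have "((1 + norm x) ^ k * norm (A p x)) * \<bar>x \<bullet> b\<bar> \<le> ((1 + norm x) ^ k * norm (A p x)) * (1 + norm x)"
      by (intro mult_left_mono) auto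
    then show "(1 + norm x) ^ k * norm (coord_mult b (A p) x) \<le> (1 + norm x) ^ Suc k * norm (A p x)"
      by (simp add: coord_mult_def norm_mult mult_ac)
  qed
next
  case (add A B)
  show ?case
  proof (rule tame_mono[OF tame_add[OF add.IH(1)[of k] add.IH(2)[of k] q]])
    fix p x
    show "(1 + norm x) ^ k * norm (A p x + B p x)
        \<le> (1 + norm x) ^ k * norm (A p x) + (1 + norm x) ^ k * norm (B p x)"
      using mult_left_mono[OF norm_triangle_ineq[of "A p x" "B p x"], of "(1 + norm x) ^ k"]
      by (simp add: algebra_simps)
  qed
next
  case (scale A c)
  show ?case
    using tame_scale[OF scale.IH[of k] q, of "norm c"] by (simp add: norm_mult mult_ac)
qed

text \<open>The Weyl algebra, as operators on functions. Every operator in it preserves the Schwartz space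
continuously, and composing a fixed transform with all of its elements produces a family closed
under \<open>\<partial>\<^sub>b\<close> and \<open>x\<^sub>b\<close> as soon as the transform intertwines these with elements of the algebra.\<close>

definition weyl :: "(('a::euclidean_space \<Rightarrow> complex) \<Rightarrow> 'a \<Rightarrow> complex) set" where
  "weyl = poly_span (iter_partial ` {vs. set vs \<subseteq> Basis})"

lemma weyl_iter: "set vs \<subseteq> Basis \<Longrightarrow> iter_partial vs \<in> weyl"
  unfolding weyl_def by (rule poly_span.base) simp

lemmas weyl_coord = poly_span.coord[of _ "iter_partial ` {vs. set vs \<subseteq> Basis}", folded weyl_def]
  and weyl_add = poly_span.add[of _ "iter_partial ` {vs. set vs \<subseteq> Basis}", folded weyl_def]
  and weyl_scale = poly_span.scale[of _ "iter_partial ` {vs. set vs \<subseteq> Basis}", folded weyl_def]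

lemma weyl_id: "(\<lambda>f :: 'a::euclidean_space \<Rightarrow> complex. f) \<in> weyl"
proof -
  have "iter_partial [] = (\<lambda>f::'a \<Rightarrow> complex. f)" by (rule ext) simp
  then show ?thesis using weyl_iter[of "[] :: 'a list"] by simp
qed

lemma weyl_sum:
  assumes "finite I" "\<And>i. i \<in> I \<Longrightarrow> A i \<in> weyl"
  shows "(\<lambda>f x. \<Sum>i\<in>I. A i f x) \<in> weyl"
  using assms
proof (induction I rule: finite_induct)
  case empty
  show ?case using weyl_scale[OF weyl_id, of 0] by simp
next
  case (insert i I)
  then show ?case using weyl_add[of "A i" "\<lambda>f x. \<Sum>i\<in>I. A i f x"] by simp
qed

lemma weyl_differentiable: "A \<in> weyl \<Longrightarrow> f \<in> schwartz \<Longrightarrow> A f differentiable (at x)"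
  unfolding weyl_def by (rule poly_span_differentiable[where A = A and p = f]) (auto simp: schwartz_iter_differentiable)

lemma weyl_partial:
  fixes A :: "('a::euclidean_space \<Rightarrow> complex) \<Rightarrow> 'a \<Rightarrow> complex"
  assumes "A \<in> weyl" "b \<in> Basis"
  shows "\<exists>B\<in>weyl. \<forall>f\<in>schwartz. partial_deriv b (A f) = B f"
  unfolding weyl_def
proof (rule poly_span_partial[OF assms(1)[unfolded weyl_def] assms(2)])
  fix D assume "D \<in> iter_partial ` {vs. set vs \<subseteq> (Basis :: 'a set)}"
  then obtain vs where vs: "set vs \<subseteq> (Basis :: 'a set)" "D = iter_partial vs" by auto
  then have "iter_partial (b # vs) \<in> weyl" using assms(2) by (intro weyl_iter) auto
  then show "\<exists>C\<in>poly_span (iter_partial ` {vs. set vs \<subseteq> Basis}). \<forall>f\<in>schwartz. partial_deriv b (D f) = C f"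
    unfolding weyl_def vs(2) by (intro bexI[of _ "iter_partial (b # vs)"]) auto
qed (auto simp: schwartz_iter_differentiable)

lemma weyl_tame:
  fixes A :: "('a::euclidean_space \<Rightarrow> complex) \<Rightarrow> 'a \<Rightarrow> complex"
  assumes "A \<in> weyl"
  shows "tame schwartz schwartz_norm (\<lambda>f x. (1 + norm x) ^ k * norm (A f x))"
proof (rule poly_span_tame[OF assms[unfolded weyl_def] graded_norm_schwartz])
  fix D k assume "D \<in> iter_partial ` {vs. set vs \<subseteq> (Basis :: 'a set)}"
  then obtain vs where vs: "set vs \<subseteq> (Basis :: 'a set)" "D = iter_partial vs" by auto
  show "tame schwartz schwartz_norm (\<lambda>f x. (1 + norm x) ^ k * norm (D f x))"
    unfolding tame_def vs(2)
    using schwartz_norm_ge[OF _ vs(1), of _ "max k (length vs)"]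
    by (intro exI[of _ 1] exI[of _ "max k (length vs)"]) auto
qed

definition cont_op :: "(('a::euclidean_space \<Rightarrow> complex) \<Rightarrow> 'b::euclidean_space \<Rightarrow> complex) \<Rightarrow> bool" where
  "cont_op A \<longleftrightarrow> (\<forall>f\<in>schwartz. A f \<in> schwartz) \<and>
     (\<forall>N. \<exists>C M. \<forall>f\<in>schwartz. schwartz_norm N (A f) \<le> C * schwartz_norm M f)"

lemma cont_opI:
  fixes A :: "('a::euclidean_space \<Rightarrow> complex) \<Rightarrow> 'b::euclidean_space \<Rightarrow> complex"
  assumes "\<And>f. f \<in> schwartz \<Longrightarrow> A f \<in> schwartz"
    and "\<And>k vs. set vs \<subseteq> Basis \<Longrightarrow>
      tame schwartz schwartz_norm (\<lambda>f x. (1 + norm x) ^ k * norm (iter_partial vs (A f) x))"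
  shows "cont_op A"
  unfolding cont_op_def
proof (intro conjI ballI allI)
  fix N
  let ?I = "{vs :: 'b list. set vs \<subseteq> Basis \<and> length vs \<le> N}"
  define good where "good vs C M \<longleftrightarrow> (\<forall>f\<in>schwartz. \<forall>n\<ge>M. \<forall>x.
      (1 + norm x) ^ N * norm (iter_partial vs (A f) x) \<le> C * schwartz_norm n f)" for vs C M
  have "\<exists>C M. good vs C M" if "vs \<in> ?I" for vs
  proof -
    have "tame schwartz schwartz_norm (\<lambda>f x. (1 + norm x) ^ N * norm (iter_partial vs (A f) x))"
      using assms(2) that by simp
    from tameE[OF this graded_norm_schwartz] show "\<exists>C M. good vs C M"
      unfolding good_def by metis
  qed
  then obtain C M where "\<And>vs. vs \<in> ?I \<Longrightarrow> good vs (C vs) (M vs)"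
    by metis
  then have CM: "(1 + norm x) ^ N * norm (iter_partial vs (A f) x) \<le> C vs * schwartz_norm n f"
    if "vs \<in> ?I" "f \<in> schwartz" "M vs \<le> n" for vs f n x
    using that unfolding good_def by blast
  define M' where "M' = Max (M ` ?I)"
  have M': "M vs \<le> M'" if "vs \<in> ?I" for vs
    unfolding M'_def using that finite_index_lists by (intro Max_ge) auto
  show "\<exists>C M. \<forall>f\<in>schwartz. schwartz_norm N (A f) \<le> C * schwartz_norm M f"
  proof (intro exI ballI)
    fix f :: "'a \<Rightarrow> complex" assume f: "f \<in> schwartz"
    have "schwartz_norm N (A f) \<le> (\<Sum>vs\<in>?I. C vs * schwartz_norm M' f)"
      using CM[OF _ f M'] by (intro schwartz_norm_le) auto
    then show "schwartz_norm N (A f) \<le> (\<Sum>vs\<in>?I. C vs) * schwartz_norm M' f"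
      by (simp add: sum_distrib_right)
  qed
qed (use assms in auto)

theorem cont_op_family:
  fixes \<A> :: "(('a::euclidean_space \<Rightarrow> complex) \<Rightarrow> 'b::euclidean_space \<Rightarrow> complex) set"
  assumes "\<And>A f x. A \<in> \<A> \<Longrightarrow> f \<in> schwartz \<Longrightarrow> A f differentiable (at x)"
    and "\<And>A. A \<in> \<A> \<Longrightarrow> tame schwartz schwartz_norm (\<lambda>f x. norm (A f x))"
    and "\<And>A b. A \<in> \<A> \<Longrightarrow> b \<in> Basis \<Longrightarrow> \<exists>B\<in>\<A>. \<forall>f\<in>schwartz. partial_deriv b (A f) = B f"
    and "\<And>A b. A \<in> \<A> \<Longrightarrow> b \<in> Basis \<Longrightarrow> \<exists>B\<in>\<A>. \<forall>f\<in>schwartz. coord_mult b (A f) = B f"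
    and "A \<in> \<A>"
  shows "cont_op A"
proof (rule cont_opI)
  show "\<And>f. f \<in> schwartz \<Longrightarrow> A f \<in> schwartz"
    by (rule schwartz_family(1)[where \<A> = \<A> and P = schwartz and q = schwartz_norm])
      (rule graded_norm_schwartz assms | assumption)+
  show "\<And>k vs. set vs \<subseteq> Basis \<Longrightarrow>
      tame schwartz schwartz_norm (\<lambda>f x. (1 + norm x) ^ k * norm (iter_partial vs (A f) x))"
    by (rule schwartz_family(2)[where \<A> = \<A> and P = schwartz and q = schwartz_norm])
      (rule graded_norm_schwartz assms | assumption)+
qed

lemma cont_op_schwartz: "cont_op A \<Longrightarrow> f \<in> schwartz \<Longrightarrow> A f \<in> schwartz"
  unfolding cont_op_def by blast

lemma cont_op_comp:
  fixes B :: "('a::euclidean_space \<Rightarrow> complex) \<Rightarrow> 'b::euclidean_space \<Rightarrow> complex"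
  assumes "cont_op A" "cont_op B"
  shows "cont_op (\<lambda>f. A (B f))"
  unfolding cont_op_def
proof (intro conjI ballI allI)
  fix N
  obtain C M where C: "\<And>f. f \<in> schwartz \<Longrightarrow> schwartz_norm N (A f) \<le> C * schwartz_norm M f"
    using assms(1) unfolding cont_op_def by metis
  obtain D L where D: "\<And>f. f \<in> schwartz \<Longrightarrow> schwartz_norm M (B f) \<le> D * schwartz_norm L f"
    using assms(2) unfolding cont_op_def by metis
  show "\<exists>C M. \<forall>f\<in>schwartz. schwartz_norm N (A (B f)) \<le> C * schwartz_norm M f"
  proof (intro exI ballI)
    fix f :: "'a \<Rightarrow> complex" assume f: "f \<in> schwartz"
    then have Bf: "B f \<in> schwartz" by (rule cont_op_schwartz[OF assms(2)])
    have "schwartz_norm N (A (B f)) \<le> C * schwartz_norm M (B f)" by (rule C[OF Bf])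
    also have "\<dots> \<le> max C 0 * schwartz_norm M (B f)"
      by (intro mult_right_mono schwartz_norm_nonneg Bf) auto
    also have "\<dots> \<le> max C 0 * (D * schwartz_norm L f)" using D[OF f] by (intro mult_left_mono) auto
    finally show "schwartz_norm N (A (B f)) \<le> (max C 0 * D) * schwartz_norm L f" by simp
  qed
qed (rule cont_op_schwartz[OF assms(1) cont_op_schwartz[OF assms(2)]])

lemma weyl_cont:
  assumes "A \<in> weyl" shows "cont_op A"
proof (rule cont_op_family[where \<A> = weyl])
  show "tame schwartz schwartz_norm (\<lambda>f x. norm (A f x))" if "A \<in> weyl" for A
    using weyl_tame[OF that, of 0] by simp
  show "\<exists>B\<in>weyl. \<forall>f\<in>schwartz. coord_mult b (A f) = B f" if "A \<in> weyl" "b \<in> Basis" for A b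
    by (intro bexI[OF _ weyl_coord[OF that]]) simp
qed (rule weyl_differentiable weyl_partial assms | assumption)+

lemmas schwartz_weyl = cont_op_schwartz[OF weyl_cont]

lemma schwartz_coord: "f \<in> schwartz \<Longrightarrow> b \<in> Basis \<Longrightarrow> coord_mult b f \<in> schwartz"
  by (rule schwartz_weyl[OF weyl_coord[OF weyl_id]])

lemma schwartz_scale: "f \<in> schwartz \<Longrightarrow> (\<lambda>x. c * f x) \<in> schwartz"
  by (rule schwartz_weyl[OF weyl_scale[OF weyl_id]])

lemma iter_partial_add:
  assumes "f \<in> schwartz" "g \<in> schwartz" "set vs \<subseteq> Basis"
  shows "iter_partial vs (\<lambda>x. f x + g x) = (\<lambda>x. iter_partial vs f x + iter_partial vs g x)"
  using assms(3)
proof (induction vs)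
  case (Cons v vs)
  show ?case
  proof
    fix x
    have "((\<lambda>x. iter_partial vs f x + iter_partial vs g x) has_derivative
      (\<lambda>h. frechet_derivative (iter_partial vs f) (at x) h + frechet_derivative (iter_partial vs g) (at x) h)) (at x)"
      using schwartz_iter_differentiable[of _ vs x] assms Cons.prems
      by (intro has_derivative_add) (simp_all flip: frechet_derivative_works)
    from partial_derivI[OF this, of v] show "iter_partial (v # vs) (\<lambda>x. f x + g x) x =
        iter_partial (v # vs) f x + iter_partial (v # vs) g x"
      using Cons by (simp add: partial_deriv_def)
  qed
qed auto

lemma iter_partial_scale:
  assumes "f \<in> schwartz" "set vs \<subseteq> Basis"
  shows "iter_partial vs (\<lambda>x. c * f x) = (\<lambda>x. c * iter_partial vs f x)"
  using assms(2)
proof (induction vs)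
  case (Cons v vs)
  show ?case
  proof
    fix x
    have "((\<lambda>x. c * iter_partial vs f x) has_derivative
      (\<lambda>h. c * frechet_derivative (iter_partial vs f) (at x) h)) (at x)"
      using schwartz_iter_differentiable[of _ vs x] assms Cons.prems
      by (intro has_derivative_mult_right) (simp_all flip: frechet_derivative_works)
    from partial_derivI[OF this, of v] show "iter_partial (v # vs) (\<lambda>x. c * f x) x =
        c * iter_partial (v # vs) f x"
      using Cons by (simp add: partial_deriv_def)
  qed
qed auto

lemma schwartz_add:
  fixes f :: "'a::euclidean_space \<Rightarrow> complex"
  assumes f: "f \<in> schwartz" and g: "g \<in> schwartz" shows "(\<lambda>x. f x + g x) \<in> schwartz"
  unfolding schwartz_def
proof (intro CollectI allI impI conjI)
  fix vs :: "'a list" and x k assume vs: "set vs \<subseteq> Basis"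
  show "iter_partial vs (\<lambda>x. f x + g x) differentiable (at x)"
    unfolding iter_partial_add[OF f g vs] by (intro differentiable_add schwartz_iter_differentiable f g vs)
  obtain C D where C: "\<And>x. (1 + norm x) ^ k * norm (iter_partial vs f x) \<le> C"
    and D: "\<And>x. (1 + norm x) ^ k * norm (iter_partial vs g x) \<le> D"
    using schwartz_iter_decay[OF f vs] schwartz_iter_decay[OF g vs] by meson
  have "norm x ^ k * norm (iter_partial vs f x + iter_partial vs g x) \<le> C + D" for x
  proof -
    have "norm x ^ k * norm (iter_partial vs f x + iter_partial vs g x)
      \<le> (1 + norm x) ^ k * (norm (iter_partial vs f x) + norm (iter_partial vs g x))"
      by (intro mult_mono power_mono norm_triangle_ineq) auto
    also have "\<dots> \<le> C + D" using add_mono[OF C D] by (simp add: distrib_left)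
    finally show ?thesis .
  qed
  then show "bounded (range (\<lambda>x. norm x ^ k * norm (iter_partial vs (\<lambda>x. f x + g x) x)))"
    unfolding iter_partial_add[OF f g vs] bounded_iff by (intro exI[of _ "C + D"]) auto
qed

lemma schwartz_diff: "f \<in> schwartz \<Longrightarrow> g \<in> schwartz \<Longrightarrow> (\<lambda>x. f x - g x) \<in> schwartz"
  using schwartz_add[of f "\<lambda>x. (-1) * g x"] schwartz_scale[of g "-1"] by (simp add: diff_conv_add_uminus del: add_uminus_conv_diff)

lemma schwartz_zero: "(\<lambda>_::'a::euclidean_space. 0) \<in> schwartz"
  by (rule schwartz_coinduct[where X = "{\<lambda>_. 0}"])
    (auto simp: partial_deriv_def coord_mult_def frechet_derivative_const)

lemma schwartz_sum:
  "finite I \<Longrightarrow> (\<And>i. i \<in> I \<Longrightarrow> f i \<in> schwartz) \<Longrightarrow> (\<lambda>x. \<Sum>i\<in>I. f i x) \<in> schwartz"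
  by (induction I rule: finite_induct) (auto simp: schwartz_zero schwartz_add)

section \<open>Pullbacks, tensor products and sections of Schwartz functions\<close>

lemma partial_deriv_has_derivative:
  fixes f :: "'a::euclidean_space \<Rightarrow> complex"
  assumes "f \<in> schwartz"
  shows "(f has_derivative (\<lambda>h. \<Sum>b\<in>Basis. (h \<bullet> b) *\<^sub>R partial_deriv b f x)) (at x)"
  by (rule differentiable_expand[OF schwartz_differentiable[OF assms]])

text \<open>The chain rule writes \<open>\<partial>\<^sub>b (f \<circ> L)\<close> as a combination of pullbacks of the \<open>\<partial>\<^sub>c f\<close>, and the left inverse
\<open>L'\<close> writes the coordinate \<open>x \<bullet> b\<close> as an affine function of \<open>a + L x\<close>. So the pullbacks of all Weyl
operators form a closed family.\<close>

lemma cont_op_affine: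
  fixes L :: "'a::euclidean_space \<Rightarrow> 'b::euclidean_space"
  assumes L: "linear L" and L': "linear L'" and inv: "\<And>x. L' (L x) = x"
  shows "cont_op (\<lambda>f x. f (a + L x))"
proof -
  define \<A> where "\<A> = (\<lambda>D f x. D f (a + L x)) ` (weyl :: (('b \<Rightarrow> complex) \<Rightarrow> 'b \<Rightarrow> complex) set)"
  have diff: "A f differentiable (at x)" if A: "A \<in> \<A>" and f: "f \<in> schwartz" for A f x
  proof -
    obtain D where D: "D \<in> weyl" "A = (\<lambda>f x. D f (a + L x))" using A unfolding \<A>_def by auto
    have "((\<lambda>x. a + L x) has_derivative L) (at x)"
      using has_derivative_add[OF has_derivative_const linear_imp_has_derivative[OF L], of a]
      by simp
    from has_derivative_compose[OF this weyl_differentiable[OF D(1) f, unfolded frechet_derivative_works]]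
    show ?thesis unfolding D by (rule differentiableI)
  qed
  have bnd: "tame schwartz schwartz_norm (\<lambda>f x. norm (A f x))" if A: "A \<in> \<A>" for A
  proof -
    obtain D where D: "D \<in> weyl" "A = (\<lambda>f x. D f (a + L x))" using A unfolding \<A>_def by auto
    show ?thesis using weyl_tame[OF D(1), of 0] unfolding D tame_def by auto
  qed
  have der: "\<exists>B\<in>\<A>. \<forall>f\<in>schwartz. partial_deriv b (A f) = B f" if A: "A \<in> \<A>" and b: "b \<in> Basis" for A b
  proof -
    obtain D where D: "D \<in> weyl" "A = (\<lambda>f x. D f (a + L x))" using A unfolding \<A>_def by auto
    have "\<forall>c\<in>Basis. \<exists>E\<in>weyl. \<forall>f\<in>schwartz. partial_deriv c (D f) = E f"
      using weyl_partial[OF D(1)] by auto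
    then obtain E where E: "\<And>c. c \<in> Basis \<Longrightarrow> E c \<in> weyl"
      "\<And>c f. c \<in> Basis \<Longrightarrow> f \<in> schwartz \<Longrightarrow> partial_deriv c (D f) = E c f" by metis
    define F where "F f x = (\<Sum>c\<in>Basis. complex_of_real (L b \<bullet> c) * E c f x)" for f x
    have F: "F \<in> weyl"
    proof -
      have "(\<lambda>f x. \<Sum>c\<in>Basis. complex_of_real (L b \<bullet> c) * E c f x) \<in> weyl"
        by (intro weyl_sum weyl_scale E) auto
      then show ?thesis by (simp add: F_def[abs_def])
    qed
    have "partial_deriv b (A f) = (\<lambda>x. F f (a + L x))" if f: "f \<in> schwartz" for f
    proof
      fix x
      have "((\<lambda>x. a + L x) has_derivative L) (at x)"
        using has_derivative_add[OF has_derivative_const linear_imp_has_derivative[OF L], of a]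
        by simp
      from has_derivative_compose[OF this differentiable_expand[OF weyl_differentiable[OF D(1) f]]]
      have "((\<lambda>x. D f (a + L x)) has_derivative
          (\<lambda>h. \<Sum>c\<in>Basis. (L h \<bullet> c) *\<^sub>R partial_deriv c (D f) (a + L x))) (at x)" .
      from partial_derivI[OF this, of b]
      show "partial_deriv b (A f) x = F f (a + L x)"
        by (simp add: D F_def E(2)[OF _ f] scaleR_conv_of_real)
    qed
    then show ?thesis using F by (intro bexI[of _ "\<lambda>f x. F f (a + L x)"]) (auto simp: \<A>_def)
  qed
  have crd: "\<exists>B\<in>\<A>. \<forall>f\<in>schwartz. coord_mult b (A f) = B f" if A: "A \<in> \<A>" and b: "b \<in> Basis" for A b
  proof -
    obtain D where D: "D \<in> weyl" "A = (\<lambda>f x. D f (a + L x))" using A unfolding \<A>_def by auto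
    define F where "F f x = (\<Sum>c\<in>Basis. complex_of_real (L' c \<bullet> b) * coord_mult c (D f) x)
      + complex_of_real (- (L' a \<bullet> b)) * D f x" for f x
    have F: "F \<in> weyl"
    proof -
      have "(\<lambda>f x. (\<Sum>c\<in>Basis. complex_of_real (L' c \<bullet> b) * coord_mult c (D f) x)
          + complex_of_real (- (L' a \<bullet> b)) * D f x) \<in> weyl"
        by (intro weyl_add weyl_sum weyl_scale weyl_coord D) auto
      then show ?thesis by (simp add: F_def[abs_def])
    qed
    have "coord_mult b (A f) x = F f (a + L x)" for f x
    proof -
      have "x \<bullet> b = L' ((a + L x) - a) \<bullet> b" using inv by simp
      also have "\<dots> = L' (a + L x) \<bullet> b - L' a \<bullet> b"
        by (subst linear_diff[OF L']) (simp add: inner_diff_left)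
      also have "L' (a + L x) = (\<Sum>c\<in>Basis. ((a + L x) \<bullet> c) *\<^sub>R L' c)"
        using arg_cong[OF euclidean_representation[of "a + L x"], of L']
        by (simp add: linear_sum[OF L'] linear_scale[OF L'])
      finally have *: "x \<bullet> b = (\<Sum>c\<in>Basis. ((a + L x) \<bullet> c) * (L' c \<bullet> b)) - L' a \<bullet> b"
        by (simp add: inner_sum_left)
      show ?thesis
        unfolding D F_def coord_mult_def
        by (subst *) (simp add: algebra_simps sum_distrib_left sum_distrib_right)
    qed
    then have "coord_mult b (A f) = (\<lambda>x. F f (a + L x))" for f by (rule ext)
    then show ?thesis using F by (intro bexI[of _ "\<lambda>f x. F f (a + L x)"]) (auto simp: \<A>_def)
  qed
  have mem: "(\<lambda>f x. f (a + L x)) \<in> \<A>"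
    unfolding \<A>_def by (rule image_eqI[OF _ weyl_id]) simp
  show ?thesis by (rule cont_op_family[where \<A> = \<A>]) (rule diff bnd der crd mem | assumption)+
qed

lemma cont_op_linear:
  fixes L :: "'a::euclidean_space \<Rightarrow> 'b::euclidean_space"
  assumes "linear L" "linear L'" "\<And>x. L' (L x) = x"
  shows "cont_op (\<lambda>f x. f (L x))"
  using cont_op_affine[OF assms, of 0] by simp

lemma schwartz_affine:
  fixes L :: "'a::euclidean_space \<Rightarrow> 'b::euclidean_space"
  assumes "linear L" "linear L'" "\<And>x. L' (L x) = x" "f \<in> schwartz"
  shows "(\<lambda>x. f (a + L x)) \<in> schwartz"
  by (rule cont_op_schwartz[OF cont_op_affine[OF assms(1-3)] assms(4)])

lemma schwartz_linear:
  fixes L :: "'a::euclidean_space \<Rightarrow> 'b::euclidean_space"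
  assumes "linear L" "linear L'" "\<And>x. L' (L x) = x" "f \<in> schwartz"
  shows "(\<lambda>x. f (L x)) \<in> schwartz"
  by (rule cont_op_schwartz[OF cont_op_linear[OF assms(1-3)] assms(4)])

lemma schwartz_minus: "f \<in> schwartz \<Longrightarrow> (\<lambda>x::'a::euclidean_space. f (- x)) \<in> schwartz"
  by (rule schwartz_linear[where L = uminus and L' = uminus]) (auto simp: linear_iff)

lemma schwartz_reflect: "f \<in> schwartz \<Longrightarrow> (\<lambda>x::'a::euclidean_space. f (z - x)) \<in> schwartz"
  using schwartz_affine[where L = uminus and L' = uminus and a = z and f = f] by (auto simp: linear_iff)

definition tensor :: "('a::euclidean_space \<Rightarrow> complex) \<Rightarrow> ('b::euclidean_space \<Rightarrow> complex) \<Rightarrow> 'a \<times> 'b \<Rightarrow> complex" where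
  "tensor f g = (\<lambda>(x, y). f x * g y)"

lemma Basis_prodE:
  assumes "b \<in> (Basis :: ('a::euclidean_space \<times> 'b::euclidean_space) set)"
  obtains c where "c \<in> Basis" "b = (c, 0)" | c where "c \<in> Basis" "b = (0, c)"
  using assms unfolding Basis_prod_def by auto

lemma schwartz_bounded:
  fixes f :: "'a::euclidean_space \<Rightarrow> complex"
  assumes "f \<in> schwartz" obtains C where "0 \<le> C" "\<And>x. norm (f x) \<le> C"
proof -
  obtain C where "\<And>x. norm (f x) \<le> C" using schwartz_iter_decay[OF assms, of "[]" 0] by auto
  moreover from this[of 0] have "0 \<le> C" using norm_ge_zero order_trans by blast
  ultimately show thesis using that by blast
qed

lemma schwartz_tensor:
  fixes f :: "'a::euclidean_space \<Rightarrow> complex" and g :: "'b::euclidean_space \<Rightarrow> complex"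
  assumes "f \<in> schwartz" "g \<in> schwartz"
  shows "tensor f g \<in> schwartz"
proof -
  let ?X = "{tensor f g | f g. f \<in> schwartz \<and> g \<in> schwartz} :: ('a \<times> 'b \<Rightarrow> complex) set"
  have D: "h differentiable (at p) \<and> (\<exists>C. \<forall>x. norm (h x) \<le> C) \<and>
      (b \<in> Basis \<longrightarrow> partial_deriv b h \<in> ?X \<and> coord_mult b h \<in> ?X)" if "h \<in> ?X" for h b p
  proof (intro conjI impI)
    obtain f g where h: "h = tensor f g" and fg: "f \<in> schwartz" "g \<in> schwartz"
      using \<open>h \<in> ?X\<close> by auto
    have der: "(h has_derivative (\<lambda>q. f (fst p) * frechet_derivative g (at (snd p)) (snd q)
        + frechet_derivative f (at (fst p)) (fst q) * g (snd p))) (at p)" for p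
      unfolding h tensor_def split_def
      by (intro has_derivative_mult has_derivative_compose[OF has_derivative_fst[OF has_derivative_ident]]
         has_derivative_compose[OF has_derivative_snd[OF has_derivative_ident]]
         schwartz_differentiable[OF fg(1), unfolded frechet_derivative_works]
         schwartz_differentiable[OF fg(2), unfolded frechet_derivative_works])
    then show "h differentiable (at p)" using differentiableI by blast
    obtain C D where C: "0 \<le> C" "\<And>x. norm (f x) \<le> C" and D: "\<And>x. norm (g x) \<le> D"
      by (metis schwartz_bounded fg)
    show "\<exists>C. \<forall>x. norm (h x) \<le> C"
      by (intro exI[of _ "C * D"]) (auto simp: h tensor_def norm_mult intro!: mult_mono C D)
    have lin: "frechet_derivative f (at x) 0 = 0" "frechet_derivative g (at y) 0 = 0" for x y
      using fg[THEN schwartz_differentiable] by (auto intro!: linear_0 has_derivative_linear simp: frechet_derivative_works)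
    assume "b \<in> Basis"
    then show "partial_deriv b h \<in> ?X"
    proof (cases rule: Basis_prodE)
      case (1 c)
      have "partial_deriv b h = tensor (partial_deriv c f) g"
        using partial_derivI[OF der] 1 by (auto simp: fun_eq_iff tensor_def lin partial_deriv_def[of c])
      then show ?thesis using fg schwartz_partial[OF fg(1) 1(1)] by auto
    next
      case (2 c)
      have "partial_deriv b h = tensor f (partial_deriv c g)"
        using partial_derivI[OF der] 2 by (auto simp: fun_eq_iff tensor_def lin partial_deriv_def[of c])
      then show ?thesis using fg schwartz_partial[OF fg(2) 2(1)] by auto
    qed
    from \<open>b \<in> Basis\<close> show "coord_mult b h \<in> ?X"
    proof (cases rule: Basis_prodE)
      case (1 c)
      have "coord_mult b h = tensor (coord_mult c f) g"
        by (auto simp: 1 h coord_mult_def tensor_def)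
      then show ?thesis using fg schwartz_coord[OF fg(1) 1(1)] by auto
    next
      case (2 c)
      have "coord_mult b h = tensor f (coord_mult c g)"
        by (auto simp: 2 h coord_mult_def tensor_def)
      then show ?thesis using fg schwartz_coord[OF fg(2) 2(1)] by auto
    qed
  qed
  show ?thesis
    by (rule schwartz_coinduct[where X = ?X]) (use D assms in blast)+
qed

lemma section_has_derivative:
  assumes "(H has_derivative H') (at (u, z))"
  shows "((\<lambda>u. H (u, z)) has_derivative (\<lambda>h. H' (h, 0))) (at u)"
  using has_derivative_compose[OF has_derivative_Pair[OF has_derivative_ident has_derivative_const] assms]
  by simp

lemma partial_deriv_section:
  assumes "H \<in> schwartz"
  shows "partial_deriv b (\<lambda>u. H (u, z)) u = partial_deriv (b, 0) H (u, z)"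
  using partial_derivI[OF section_has_derivative[OF
    schwartz_differentiable[OF assms, unfolded frechet_derivative_works]]]
  by (simp add: partial_deriv_def)

lemma partial_deriv_section2:
  assumes "H \<in> schwartz"
  shows "partial_deriv b (\<lambda>y. H (x, y)) y = partial_deriv (0, b) H (x, y)"
proof -
  have "((\<lambda>y. H (x, y)) has_derivative (\<lambda>h. frechet_derivative H (at (x, y)) (0, h))) (at y)"
    using has_derivative_compose[OF has_derivative_Pair[OF has_derivative_const has_derivative_ident]
      schwartz_differentiable[OF assms, unfolded frechet_derivative_works]] by simp
  from partial_derivI[OF this] show ?thesis by (simp add: partial_deriv_def)
qed

lemma schwartz_section:
  fixes H :: "'a::euclidean_space \<times> 'b::euclidean_space \<Rightarrow> complex"
  assumes "H \<in> schwartz"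
  shows "(\<lambda>u. H (u, z)) \<in> schwartz"
proof -
  let ?X = "{\<lambda>u. H (u, z) | H. H \<in> schwartz} :: ('a \<Rightarrow> complex) set"
  have D: "h differentiable (at p) \<and> (\<exists>C. \<forall>x. norm (h x) \<le> C) \<and>
      (b \<in> Basis \<longrightarrow> partial_deriv b h \<in> ?X \<and> coord_mult b h \<in> ?X)" if "h \<in> ?X" for h b p
  proof (intro conjI impI)
    obtain H :: "'a \<times> 'b \<Rightarrow> complex" where h: "h = (\<lambda>u. H (u, z))" and H: "H \<in> schwartz"
      using \<open>h \<in> ?X\<close> by auto
    show "h differentiable (at p)" unfolding h
      using section_has_derivative[OF schwartz_differentiable[OF H, unfolded frechet_derivative_works]]
      by (rule differentiableI)
    show "\<exists>C. \<forall>x. norm (h x) \<le> C" using schwartz_bounded[OF H] unfolding h by metis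
    assume b: "b \<in> Basis"
    then have b': "(b, 0) \<in> (Basis :: ('a \<times> 'b) set)" by (simp add: Basis_prod_def)
    have "partial_deriv b h = (\<lambda>u. partial_deriv (b, 0) H (u, z))"
      unfolding h by (rule ext) (rule partial_deriv_section[OF H])
    then show "partial_deriv b h \<in> ?X" using schwartz_partial[OF H b'] by blast
    have "coord_mult b h = (\<lambda>u. coord_mult (b, 0) H (u, z))"
      by (simp add: h coord_mult_def)
    then show "coord_mult b h \<in> ?X" using schwartz_coord[OF H b'] by blast
  qed
  show ?thesis
    by (rule schwartz_coinduct[where X = ?X]) (use D assms in blast)+
qed

lemma iter_partial_section:
  fixes H :: "'a::euclidean_space \<times> 'b::euclidean_space \<Rightarrow> complex"
  assumes "H \<in> schwartz" "set vs \<subseteq> Basis"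
  shows "iter_partial vs (\<lambda>u. H (u, z)) = (\<lambda>u. iter_partial (map (\<lambda>b. (b, 0)) vs) H (u, z))"
  using assms(2)
proof (induction vs)
  case (Cons v vs)
  have "set (map (\<lambda>b. (b, 0)) vs) \<subseteq> (Basis :: ('a \<times> 'b) set)"
    using Cons.prems by (auto simp: Basis_prod_def)
  then have "iter_partial (map (\<lambda>b. (b, 0)) vs) H \<in> schwartz"
    using schwartz_weyl[OF weyl_iter] assms(1) by blast
  moreover have "iter_partial vs (\<lambda>u. H (u, z)) = (\<lambda>u. iter_partial (map (\<lambda>b. (b, 0)) vs) H (u, z))"
    using Cons by simp
  ultimately show ?case
    by (simp add: partial_deriv_section)
qed simp

lemma schwartz_swap:
  fixes H :: "'a::euclidean_space \<times> 'b::euclidean_space \<Rightarrow> complex"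
  assumes "H \<in> schwartz" shows "(\<lambda>(y, x). H (x, y)) \<in> schwartz"
  using schwartz_linear[of "\<lambda>(y, x). (x, y)" "\<lambda>(x, y). (y, x)" H] assms
  by (auto simp: linear_iff case_prod_unfold)

lemma schwartz_section2:
  fixes H :: "'a::euclidean_space \<times> 'b::euclidean_space \<Rightarrow> complex"
  assumes "H \<in> schwartz" shows "(\<lambda>y. H (x, y)) \<in> schwartz"
  using schwartz_section[OF schwartz_swap[OF assms], of x] by simp

lemma schwartz_cnj:
  fixes f :: "'a::euclidean_space \<Rightarrow> complex"
  assumes "f \<in> schwartz" shows "(\<lambda>x. cnj (f x)) \<in> schwartz"
proof -
  let ?X = "{\<lambda>x. cnj (f x) | f. f \<in> schwartz} :: ('a \<Rightarrow> complex) set"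
  have D: "h differentiable (at p) \<and> (\<exists>C. \<forall>x. norm (h x) \<le> C) \<and>
      (b \<in> Basis \<longrightarrow> partial_deriv b h \<in> ?X \<and> coord_mult b h \<in> ?X)" if "h \<in> ?X" for h b p
  proof (intro conjI impI)
    obtain f where h: "h = (\<lambda>x. cnj (f x))" and f: "f \<in> schwartz" using \<open>h \<in> ?X\<close> by auto
    have der: "(h has_derivative (\<lambda>q. cnj (frechet_derivative f (at p) q))) (at p)" for p
      unfolding h
      by (rule has_derivative_cnj[OF schwartz_differentiable[OF f, unfolded frechet_derivative_works]])
    then show "h differentiable (at p)" using differentiableI by blast
    show "\<exists>C. \<forall>x. norm (h x) \<le> C" using schwartz_bounded[OF f] unfolding h by (metis complex_mod_cnj)
    assume b: "b \<in> Basis"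
    have "partial_deriv b h = (\<lambda>x. cnj (partial_deriv b f x))"
      using partial_derivI[OF der] by (auto simp: fun_eq_iff partial_deriv_def[of b f])
    then show "partial_deriv b h \<in> ?X" using schwartz_partial[OF f b] by blast
    have "coord_mult b h = (\<lambda>x. cnj (coord_mult b f x))"
      by (simp add: h coord_mult_def)
    then show "coord_mult b h \<in> ?X" using schwartz_coord[OF f b] by blast
  qed
  show ?thesis
    by (rule schwartz_coinduct[where X = ?X]) (use D assms in blast)+
qed

section \<open>The Gaussian\<close>

text \<open>Normalised so that it has integral 1 and is its own Fourier transform.\<close>

definition gauss :: "'a::euclidean_space \<Rightarrow> complex" where
  "gauss x = complex_of_real (exp (- pi * (x \<bullet> x)))"

lemma gauss_has_derivative:
  "(gauss has_derivative (\<lambda>h. - 2 * pi * (x \<bullet> h) * gauss x)) (at x)"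
proof -
  have "((\<lambda>x. exp (- pi * (x \<bullet> x))) has_derivative (\<lambda>h. exp (- pi * (x \<bullet> x)) * (- pi * (x \<bullet> h + h \<bullet> x)))) (at x)"
    by (rule derivative_eq_intros refl)+ (simp add: algebra_simps)
  from has_derivative_of_real[OF this] show ?thesis
    unfolding gauss_def[abs_def]
    by (rule has_derivative_eq_rhs) (simp add: fun_eq_iff inner_commute algebra_simps)
qed

lemma gauss_decay: "\<exists>C. \<forall>x::'a::euclidean_space. (1 + norm x) ^ k * norm (gauss x) \<le> C"
proof -
  have "(1 + norm x) ^ k * norm (gauss x) \<le> exp (real k ^ 2)" for x :: 'a
  proof -
    let ?r = "norm x"
    \<comment> \<open>Completing the square, after bounding \<open>(1 + r) ^ k\<close> by \<open>exp (k * r)\<close>.\<close>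
    have "real k * ?r \<le> real k ^ 2 / 4 + ?r ^ 2"
      using zero_le_power2[of "real k / 2 - ?r"] by (simp add: power2_eq_square algebra_simps)
    also have "\<dots> \<le> real k ^ 2 + pi * ?r ^ 2"
      using pi_ge_two mult_right_mono[of 1 pi "?r ^ 2"] by (intro add_mono) auto
    finally have *: "real k * ?r - pi * ?r ^ 2 \<le> real k ^ 2" by simp
    have "(1 + ?r) ^ k \<le> exp ?r ^ k"
      by (intro power_mono) (auto simp: exp_ge_add_one_self)
    then have "(1 + ?r) ^ k * norm (gauss x) \<le> exp (real k * ?r) * exp (- pi * ?r ^ 2)"
      by (simp add: gauss_def exp_of_nat_mult power2_norm_eq_inner)
    also have "\<dots> \<le> exp (real k ^ 2)" using * by (simp flip: exp_add)
    finally show ?thesis .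
  qed
  then show ?thesis by blast
qed

lemma schwartz_gauss: "(gauss :: 'a::euclidean_space \<Rightarrow> complex) \<in> schwartz"
proof -
  let ?G = "{\<lambda>_::unit. gauss :: 'a \<Rightarrow> complex}"
  let ?q = "\<lambda>(_::nat) (_::unit). 1 :: real"
  have q: "graded_norm UNIV ?q" by (simp add: graded_norm_def mono_def)
  have diff: "B p differentiable (at x)" if "B \<in> ?G" for B p x
    using that gauss_has_derivative differentiableI by blast
  have der: "\<exists>C\<in>poly_span ?G. \<forall>p\<in>UNIV. partial_deriv b (B p) = C p" if "B \<in> ?G" "b \<in> Basis" for B b
  proof (intro bexI ballI)
    show "(\<lambda>p x. complex_of_real (- 2 * pi) * coord_mult b gauss x) \<in> poly_span ?G"
      by (rule poly_span.scale[OF poly_span.coord[OF poly_span.base that(2)]]) simp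
    show "partial_deriv b (B p) = (\<lambda>x. complex_of_real (- 2 * pi) * coord_mult b gauss x)" for p
    proof -
      have B: "B = (\<lambda>_. gauss)" using that(1) by simp
      show ?thesis
        unfolding B by (simp add: fun_eq_iff partial_derivI[OF gauss_has_derivative] coord_mult_def)
    qed
  qed
  have tame: "tame UNIV ?q (\<lambda>p x. (1 + norm x) ^ k * norm (B p x))" if "B \<in> ?G" for B k
    using gauss_decay[of k] that unfolding tame_def by auto
  have "(\<lambda>_::unit. gauss :: 'a \<Rightarrow> complex) () \<in> schwartz"
  proof (rule schwartz_family(1)[where \<A> = "poly_span ?G", OF q])
    show "tame UNIV ?q (\<lambda>p x. norm (A p x))" if "A \<in> poly_span ?G" for A
      using poly_span_tame[OF that q tame, where k = 0] by simp
    show "\<exists>B\<in>poly_span ?G. \<forall>p\<in>UNIV. partial_deriv b (A p) = B p" if "A \<in> poly_span ?G" "b \<in> Basis" for A b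
      by (rule poly_span_partial[OF that]) (rule diff der that | assumption)+
    show "\<exists>B\<in>poly_span ?G. \<forall>p\<in>UNIV. coord_mult b (A p) = B p" if "A \<in> poly_span ?G" "b \<in> Basis" for A b
      by (intro bexI[OF _ poly_span.coord[OF that]]) simp
    show "A p differentiable (at x)" if "A \<in> poly_span ?G" for A p x
      by (rule poly_span_differentiable[OF that]) (rule diff)
  qed (auto intro: poly_span.base)
  then show ?thesis by simp
qed

section \<open>Integrability\<close>

text \<open>Lebesgue measure is the image of the product of one-dimensional Lebesgue measures, so products
of functions of the coordinates integrate factor by factor.\<close>

lemma lborel_prod_coords:
  fixes g :: "'a::euclidean_space \<Rightarrow> real \<Rightarrow> 'b::{real_normed_field,banach,second_countable_topology}"
  assumes g: "\<And>b. b \<in> Basis \<Longrightarrow> integrable lborel (g b)"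
  shows "integrable lborel (\<lambda>x. \<Prod>b\<in>Basis. g b (x \<bullet> b))"
    and "(LINT x|lborel. (\<Prod>b\<in>Basis. g b (x \<bullet> b))) = (\<Prod>b\<in>Basis. (LINT t|lborel. g b t))"
proof -
  interpret product_sigma_finite "\<lambda>b::'a. lborel :: real measure" by standard
  let ?T = "\<lambda>f. \<Sum>b\<in>Basis. f b *\<^sub>R b :: 'a"
  have gm[measurable]: "b \<in> Basis \<Longrightarrow> g b \<in> borel_measurable borel" for b
    using borel_measurable_integrable[OF g] by simp
  have T: "?T \<in> (\<Pi>\<^sub>M b\<in>Basis. lborel) \<rightarrow>\<^sub>M borel" by measurable
  have M: "(\<lambda>x. \<Prod>b\<in>Basis. g b (x \<bullet> b)) \<in> borel_measurable borel" by measurable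
  have eq: "(\<Prod>b\<in>Basis. g b (?T f \<bullet> b)) = (\<Prod>b\<in>Basis. g b (f b))" for f
    by (intro prod.cong refl) (simp add: inner_sum_left inner_Basis if_distrib cong: if_cong)
  show "integrable lborel (\<lambda>x. \<Prod>b\<in>Basis. g b (x \<bullet> b))"
    by (subst lborel_eq, subst integrable_distr_eq[OF T M], unfold eq)
      (rule product_integrable_prod[OF _ g], auto)
  show "(LINT x|lborel. (\<Prod>b\<in>Basis. g b (x \<bullet> b))) = (\<Prod>b\<in>Basis. (LINT t|lborel. g b t))"
    by (subst lborel_eq, subst integral_distr[OF T M], unfold eq)
      (rule product_integral_prod[OF _ g], auto)
qed

text \<open>A fixed integrable weight. The exponent makes it smaller than the product over the basis of the
one-dimensional weights \<open>1 / (1 + (x \<bullet> b)\<^sup>2)\<close>, whence it is integrable.\<close>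

definition decay :: "'a::euclidean_space \<Rightarrow> real" where
  "decay x = inverse ((1 + norm x) ^ (2 * DIM('a)))"

lemma decay_pos: "0 < decay x"
  by (simp add: decay_def add_pos_nonneg)

lemma decay_measurable [measurable]: "decay \<in> borel_measurable borel"
  unfolding decay_def[abs_def] by measurable

lemma decay_integrable: "integrable lborel (decay :: 'a::euclidean_space \<Rightarrow> real)"
proof (rule Bochner_Integration.integrable_bound)
  have "integrable lborel (\<lambda>t::real. inverse (1 + t\<^sup>2))"
    using integrable_inverse_1_plus_square by (simp add: set_integrable_def)
  then show "integrable lborel (\<lambda>x::'a. \<Prod>b\<in>Basis. inverse (1 + (x \<bullet> b)\<^sup>2))"
    using lborel_prod_coords(1)[of "\<lambda>_ t. inverse (1 + t\<^sup>2)"] by blast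
  show "AE x::'a in lborel. norm (decay x) \<le> norm (\<Prod>b\<in>Basis. inverse (1 + (x \<bullet> b)\<^sup>2))"
  proof (rule AE_I2)
    fix x :: 'a
    have "(\<Prod>b\<in>Basis. 1 + (x \<bullet> b)\<^sup>2) \<le> (\<Prod>b\<in>(Basis::'a set). (1 + norm x)\<^sup>2)"
    proof (rule prod_mono, safe)
      fix b :: 'a assume b: "b \<in> Basis"
      have "(x \<bullet> b)\<^sup>2 \<le> (norm x)\<^sup>2"
        using Basis_le_norm[OF b, of x] by (metis abs_ge_zero power2_abs power_mono)
      then show "1 + (x \<bullet> b)\<^sup>2 \<le> (1 + norm x)\<^sup>2"
        using norm_ge_zero[of x] unfolding power2_sum power_one mult_1_right by linarith
    qed auto
    then have "(\<Prod>b\<in>Basis. 1 + (x \<bullet> b)\<^sup>2) \<le> (1 + norm x) ^ (2 * DIM('a))"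
      by (simp add: power_mult)
    moreover have "0 < (\<Prod>b\<in>Basis. 1 + (x \<bullet> b)\<^sup>2)"
      by (intro prod_pos) (auto simp: add_pos_nonneg)
    ultimately have "decay x \<le> inverse (\<Prod>b\<in>Basis. 1 + (x \<bullet> b)\<^sup>2)"
      unfolding decay_def by (intro le_imp_inverse_le) auto
    then show "norm (decay x) \<le> norm (\<Prod>b\<in>Basis. inverse (1 + (x \<bullet> b)\<^sup>2))"
      using decay_pos[of x] by (simp add: prod_inversef[symmetric] prod_nonneg abs_prod o_def)
  qed
qed simp

lemma integrable_decay_bound:
  fixes f :: "'a::euclidean_space \<Rightarrow> complex"
  assumes "f \<in> borel_measurable borel" "\<And>x. norm (f x) \<le> C * decay x"
  shows "integrable lborel f"
  by (rule Bochner_Integration.integrable_bound[OF integrable_mult_right[OF decay_integrable, of C]])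
    (use assms in \<open>auto intro!: AE_I2 order_trans[OF assms(2)]\<close>)

lemma schwartz_decay:
  fixes f :: "'a::euclidean_space \<Rightarrow> complex"
  assumes "f \<in> schwartz" "set vs \<subseteq> Basis"
  shows "\<exists>C. 0 \<le> C \<and> (\<forall>x. norm (iter_partial vs f x) \<le> C * decay x)"
proof -
  obtain C where C: "\<And>x. (1 + norm x) ^ (2 * DIM('a)) * norm (iter_partial vs f x) \<le> C"
    using schwartz_iter_decay[OF assms] by blast
  have "norm (iter_partial vs f x) \<le> C * decay x" for x
    using C[of x] by (simp add: decay_def field_simps add_pos_nonneg)
  moreover have "0 \<le> C" using C[of 0] by (simp add: order_trans[OF norm_ge_zero])
  ultimately show ?thesis by blast
qed

lemma schwartz_integrable:
  fixes f :: "'a::euclidean_space \<Rightarrow> complex"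
  assumes "f \<in> schwartz" shows "integrable lborel f"
proof -
  obtain C where "\<And>x. norm (f x) \<le> C * decay x" using schwartz_decay[OF assms, of "[]"] by auto
  then show ?thesis by (rule integrable_decay_bound[OF schwartz_measurable[OF assms]])
qed

section \<open>Differentiation under the integral\<close>

text \<open>By the mean value inequality the difference quotients of the integrand inherit the integrable
bound on its derivative, so dominated convergence applies along every sequence tending to \<open>p0\<close>.\<close>

lemma has_derivative_integral:
  fixes h :: "'p::real_normed_vector \<Rightarrow> 'y::euclidean_space \<Rightarrow> complex"
  assumes int: "\<And>p. integrable M (h p)"
    and D: "\<And>p y. p \<in> ball p0 1 \<Longrightarrow> ((\<lambda>p. h p y) has_derivative D p y) (at p)"
    and bound: "\<And>p y v. p \<in> ball p0 1 \<Longrightarrow> norm (D p y v) \<le> W y * norm v"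
    and W: "integrable M W" "\<And>y. 0 \<le> W y"
    and meas: "\<And>v. (\<lambda>y. D p0 y v) \<in> borel_measurable M"
  shows "((\<lambda>p. LINT y|M. h p y) has_derivative (\<lambda>v. LINT y|M. D p0 y v)) (at p0)"
proof -
  have p0: "p0 \<in> ball p0 1" by simp
  have intD: "integrable M (\<lambda>y. D p0 y v)" for v
    by (rule Bochner_Integration.integrable_bound[OF integrable_mult_left[OF W(1), of "norm v"] meas])
      (use bound[OF p0] W(2) in \<open>auto intro!: AE_I2\<close>)
  have lin: "linear (D p0 y)" for y using D[OF p0] by (rule has_derivative_linear)
  have "bounded_linear (\<lambda>v. LINT y|M. D p0 y v)"
  proof (rule bounded_linear_intro[where K = "LINT y|M. W y"])
    show "(LINT y|M. D p0 y (v + w)) = (LINT y|M. D p0 y v) + (LINT y|M. D p0 y w)" for v w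
      by (simp add: linear_add[OF lin] intD)
    show "(LINT y|M. D p0 y (r *\<^sub>R v)) = r *\<^sub>R (LINT y|M. D p0 y v)" for r v
      by (simp add: linear_scale[OF lin])
    show "norm (LINT y|M. D p0 y v) \<le> norm v * (LINT y|M. W y)" for v
    proof -
      have "norm (LINT y|M. D p0 y v) \<le> (LINT y|M. W y * norm v)"
        using intD[of v] integrable_mult_left[OF W(1), of "norm v"] bound[OF p0]
        by (intro Bochner_Integration.integral_norm_bound_integral) auto
      then show ?thesis by (simp add: mult.commute)
    qed
  qed
  moreover have "(\<lambda>v. norm ((LINT y|M. h (p0 + v) y) - (LINT y|M. h p0 y) - (LINT y|M. D p0 y v)) / norm v) \<midarrow>0\<rightarrow> 0"
  proof (rule LIMSEQ_SEQ_conv[THEN iffD1], intro allI impI)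
    fix V :: "nat \<Rightarrow> 'p" assume V: "(\<forall>n. V n \<noteq> 0) \<and> V \<longlonglongrightarrow> 0"
    define q where "q v y = (1 / norm v) *\<^sub>R (h (p0 + v) y - h p0 y - D p0 y v)" for v y
    have qint: "integrable M (q v)" for v
      unfolding q_def[abs_def] by (intro integrable_scaleR_right Bochner_Integration.integrable_diff int intD)
    have q_bound: "norm (q v y) \<le> 2 * W y" if v: "norm v < 1" "v \<noteq> 0" for v y
    proof -
      have "norm (h (p0 + v) y - h p0 y) \<le> W y * norm ((p0 + v) - p0)"
      proof (rule differentiable_bound[where S = "ball p0 1" and f' = "\<lambda>p. D p y"])
        show "((\<lambda>p. h p y) has_derivative D p y) (at p within ball p0 1)" if "p \<in> ball p0 1" for p
          using D[OF that] by (rule has_derivative_at_withinI)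
        show "onorm (D p y) \<le> W y" if "p \<in> ball p0 1" for p
          using bound[OF that] W(2) by (intro onorm_bound) auto
      qed (use v in \<open>auto simp: dist_norm\<close>)
      then have "norm (h (p0 + v) y - h p0 y) \<le> W y * norm v" by simp
      moreover have "norm (D p0 y v) \<le> W y * norm v" by (rule bound[OF p0])
      ultimately have "norm (h (p0 + v) y - h p0 y - D p0 y v) \<le> 2 * W y * norm v"
        using norm_triangle_ineq4[of "h (p0 + v) y - h p0 y" "D p0 y v"] by simp
      then show ?thesis using v(2) by (simp add: q_def divide_simps)
    qed
    have "\<forall>\<^sub>F n in sequentially. norm (V n) < 1"
      using V tendstoD[of V 0 sequentially 1] by auto
    then obtain N where N: "\<And>n. norm (V (n + N)) < 1"
      unfolding eventually_sequentially by (metis le_add2)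
    have "(\<lambda>n. LINT y|M. q (V (n + N)) y) \<longlonglongrightarrow> (LINT y|M. 0)"
    proof (rule integral_dominated_convergence)
      show "integrable M (\<lambda>y. 2 * W y)" using W by auto
      show "AE y in M. norm (q (V (n + N)) y) \<le> 2 * W y" for n
        using q_bound N V by (intro AE_I2) auto
      show "AE y in M. (\<lambda>n. q (V (n + N)) y) \<longlonglongrightarrow> 0"
      proof (rule AE_I2)
        fix y
        have "(\<lambda>v. norm (h (p0 + v) y - h p0 y - D p0 y v) / norm v) \<midarrow>0\<rightarrow> 0"
          using D[OF p0] unfolding has_derivative_at by blast
        then have "(\<lambda>v. norm (q v y)) \<midarrow>0\<rightarrow> 0"
          by (simp add: q_def)
        then have "(\<lambda>n. norm (q (V n) y)) \<longlonglongrightarrow> 0"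
          by (rule LIMSEQ_SEQ_conv[THEN iffD2, THEN spec, THEN mp, OF _ V])
        then show "(\<lambda>n. q (V (n + N)) y) \<longlonglongrightarrow> 0"
          by (intro LIMSEQ_ignore_initial_segment) (simp add: tendsto_norm_zero_iff)
      qed
    qed (use qint in auto)
    then have "(\<lambda>n. LINT y|M. q (V n) y) \<longlonglongrightarrow> (LINT y|M. 0)"
      by (rule LIMSEQ_offset)
    then have "(\<lambda>n. norm (LINT y|M. q (V n) y)) \<longlonglongrightarrow> 0"
      by (intro tendsto_norm_zero) simp
    moreover have "norm (LINT y|M. q v y) =
      norm ((LINT y|M. h (p0 + v) y) - (LINT y|M. h p0 y) - (LINT y|M. D p0 y v)) / norm v" for v
      unfolding q_def by (simp add: int intD)
    ultimately show "(\<lambda>n. norm ((LINT y|M. h (p0 + V n) y) - (LINT y|M. h p0 y) -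
        (LINT y|M. D p0 y (V n))) / norm (V n)) \<longlonglongrightarrow> 0" by simp
  qed
  ultimately show ?thesis unfolding has_derivative_at by blast
qed

lemma integral_translate:
  fixes f :: "'a::euclidean_space \<Rightarrow> complex"
  assumes [measurable]: "f \<in> borel_measurable borel"
  shows "(LINT y|lborel. f (y + c)) = (LINT y|lborel. f y)"
proof -
  have "(LINT y|lborel. f y) = (LINT y|distr lborel borel ((+) c). f y)"
    by (simp add: lborel_distr_plus)
  also have "\<dots> = (LINT y|lborel. f (c + y))" by (rule integral_distr) auto
  finally show ?thesis by (simp add: add.commute)
qed

lemma integral_scale:
  fixes f :: "'a::euclidean_space \<Rightarrow> complex"
  assumes [measurable]: "f \<in> borel_measurable borel" and c: "c \<noteq> 0"
  shows "(LINT y|lborel. f y) = of_real (\<bar>c\<bar> ^ DIM('a)) * (LINT y|lborel. f (a + c *\<^sub>R y))"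
proof -
  have "(LINT y|lborel. f y) = (LINT y|density (distr lborel borel (\<lambda>x. a + c *\<^sub>R x)) (\<lambda>_. ennreal (\<bar>c\<bar> ^ DIM('a))). f y)"
    using lborel_affine[OF c, of a] by simp
  also have "\<dots> = (LINT y|distr lborel borel (\<lambda>x. a + c *\<^sub>R x). \<bar>c\<bar> ^ DIM('a) *\<^sub>R f y)"
    by (rule integral_density) auto
  also have "\<dots> = (LINT y|lborel. \<bar>c\<bar> ^ DIM('a) *\<^sub>R f (a + c *\<^sub>R y))"
    by (rule integral_distr) auto
  finally show ?thesis by (simp add: scaleR_conv_of_real)
qed

section \<open>The Fourier transform\<close>

lemma cis_measurable [measurable]: "f \<in> borel_measurable M \<Longrightarrow> (\<lambda>x. cis (f x)) \<in> borel_measurable M"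
  by (rule measurable_compose[of f M borel]) (auto intro!: borel_measurable_continuous_onI continuous_intros)

lemma integrable_cis_mult:
  fixes f :: "'a \<Rightarrow> complex"
  assumes "integrable M f" "g \<in> borel_measurable M"
  shows "integrable M (\<lambda>x. cis (g x) * f x)"
  by (rule Bochner_Integration.integrable_bound[OF assms(1)])
    (use assms in \<open>auto simp: norm_mult borel_measurable_integrable\<close>)

lemma fourier_integrable:
  "f \<in> schwartz \<Longrightarrow> integrable lborel (\<lambda>w. cis (- 2 * pi * (z \<bullet> w)) * f w)"
  by (intro integrable_cis_mult schwartz_integrable) auto

lemma fourier_minus: "fourier (\<lambda>x. f (- x)) z = fourier f (- z)"
  if [measurable]: "f \<in> borel_measurable borel" for f :: "'a::euclidean_space \<Rightarrow> complex"
proof -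
  have "fourier f (- z) = of_real (\<bar>- 1\<bar> ^ DIM('a)) * (LINT w|lborel. cis (- 2 * pi * (- z \<bullet> (0 + (- 1) *\<^sub>R w))) * f (0 + (- 1) *\<^sub>R w))"
    unfolding fourier_def by (rule integral_scale) auto
  then show ?thesis by (simp add: fourier_def)
qed

lemma fourier_scale: "fourier (\<lambda>x. c * f x) z = c * fourier f z"
  unfolding fourier_def by (simp add: mult.left_commute[of _ c])

text \<open>Peetre's inequality: translation changes a polynomial weight by a bounded factor.\<close>

lemma norm_shift_le: "1 + norm y \<le> (1 + norm (y + v)) * (1 + norm v)" for y v :: "'a::real_normed_vector"
proof -
  have "norm y \<le> norm (y + v) + norm v" using norm_triangle_ineq4[of "y + v" v] by simp
  moreover have "0 \<le> norm (y + v) * norm v" by simp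
  ultimately show ?thesis unfolding distrib_left distrib_right mult_1_left mult_1_right by linarith
qed

lemma decay_shift_le: "decay (y + v) \<le> (1 + norm v) ^ (2 * DIM('a)) * decay y" for y v :: "'a::euclidean_space"
proof -
  have "(1 + norm y) ^ (2 * DIM('a)) \<le> ((1 + norm (y + v)) * (1 + norm v)) ^ (2 * DIM('a))"
    by (intro power_mono norm_shift_le) auto
  then have "inverse ((1 + norm (y + v)) ^ (2 * DIM('a))) \<le> (1 + norm v) ^ (2 * DIM('a)) * inverse ((1 + norm y) ^ (2 * DIM('a)))"
    unfolding power_mult_distrib by (simp add: divide_simps add_pos_nonneg mult.commute)
  then show ?thesis by (simp add: decay_def)
qed

text \<open>Translating \<open>f\<close> by \<open>t *\<^sub>R b\<close> multiplies its transform by the character \<open>cis (2 * pi * (z \<bullet> b) * t)\<close>.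
Differentiating this identity at \<open>t = 0\<close>, under the integral on the left, gives the claim; it replaces
an integration by parts over the whole space.\<close>

theorem fourier_partial:
  fixes f :: "'a::euclidean_space \<Rightarrow> complex"
  assumes f: "f \<in> schwartz" and b: "b \<in> Basis"
  shows "fourier (partial_deriv b f) z = 2 * pi * \<i> * (z \<bullet> b) * fourier f z"
proof -
  note [measurable] = schwartz_measurable[OF f] schwartz_measurable[OF schwartz_partial[OF f b]]
  let ?e = "\<lambda>y. cis (- 2 * pi * (z \<bullet> y))"
  obtain C where C: "0 \<le> C" "\<And>x. norm (partial_deriv b f x) \<le> C * decay x"
    using schwartz_decay[OF f, of "[b]"] b by auto
  have shift_schwartz: "(\<lambda>y. f (t *\<^sub>R b + y)) \<in> schwartz" for t :: real
    by (rule schwartz_affine[where L = "\<lambda>x. x" and L' = "\<lambda>x. x", OF _ _ _ f]) (auto simp: linear_iff)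
  have 1: "((\<lambda>t. LINT y|lborel. ?e y * f (t *\<^sub>R b + y)) has_derivative
      (\<lambda>s. LINT y|lborel. ?e y * (s *\<^sub>R partial_deriv b f (0 *\<^sub>R b + y)))) (at (0::real))"
  proof (rule has_derivative_integral[where D = "\<lambda>t y s. ?e y * (s *\<^sub>R partial_deriv b f (t *\<^sub>R b + y))"
      and W = "\<lambda>y. C * 2 ^ (2 * DIM('a)) * decay y"])
    show "integrable lborel (\<lambda>y. ?e y * f (t *\<^sub>R b + y))" for t
      by (rule fourier_integrable[OF shift_schwartz])
    show "((\<lambda>t. ?e y * f (t *\<^sub>R b + y)) has_derivative (\<lambda>s. ?e y * (s *\<^sub>R partial_deriv b f (t *\<^sub>R b + y)))) (at t)"
      for t y
    proof (rule has_derivative_mult_right)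
      have "((\<lambda>t. t *\<^sub>R b + y) has_derivative (\<lambda>s. s *\<^sub>R b)) (at t)"
        by (auto intro!: derivative_eq_intros)
      from has_derivative_compose[OF this schwartz_differentiable[OF f, unfolded frechet_derivative_works]]
      have "((\<lambda>t. f (t *\<^sub>R b + y)) has_derivative (\<lambda>s. frechet_derivative f (at (t *\<^sub>R b + y)) (s *\<^sub>R b))) (at t)" .
      moreover have "linear (frechet_derivative f (at (t *\<^sub>R b + y)))"
        using schwartz_differentiable[OF f] by (auto intro!: has_derivative_linear simp: frechet_derivative_works)
      ultimately show "((\<lambda>t. f (t *\<^sub>R b + y)) has_derivative (\<lambda>s. s *\<^sub>R partial_deriv b f (t *\<^sub>R b + y))) (at t)"
        by (simp add: linear_scale partial_deriv_def)
    qed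
    show "norm (?e y * (s *\<^sub>R partial_deriv b f (t *\<^sub>R b + y))) \<le> C * 2 ^ (2 * DIM('a)) * decay y * norm s"
      if t: "t \<in> ball 0 1" for t s :: real and y
    proof -
      have "decay (y + t *\<^sub>R b) \<le> (1 + norm (t *\<^sub>R b)) ^ (2 * DIM('a)) * decay y"
        by (rule decay_shift_le)
      also have "\<dots> \<le> 2 ^ (2 * DIM('a)) * decay y"
        using t b less_imp_le[OF decay_pos[of y]] by (intro mult_right_mono power_mono) (auto simp: dist_norm)
      finally have "norm (partial_deriv b f (t *\<^sub>R b + y)) \<le> C * (2 ^ (2 * DIM('a)) * decay y)"
        using C(1) by (intro order_trans[OF C(2)] mult_left_mono) (auto simp: add.commute)
      then have "\<bar>s\<bar> * norm (partial_deriv b f (t *\<^sub>R b + y)) \<le> \<bar>s\<bar> * (C * (2 ^ (2 * DIM('a)) * decay y))"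
        by (intro mult_left_mono) auto
      then show ?thesis by (simp add: norm_mult mult_ac)
    qed
    show "integrable lborel (\<lambda>y. C * 2 ^ (2 * DIM('a)) * decay y)"
      by (intro integrable_mult_right decay_integrable)
    show "0 \<le> C * 2 ^ (2 * DIM('a)) * decay y" for y
      using C(1) less_imp_le[OF decay_pos[of y]] by auto
  qed measurable
  have "(LINT y|lborel. ?e y * f (t *\<^sub>R b + y)) = cis (2 * pi * (z \<bullet> b) * t) * fourier f z" for t :: real
  proof -
    have "fourier f z = (LINT y|lborel. ?e (y + t *\<^sub>R b) * f (y + t *\<^sub>R b))"
      unfolding fourier_def by (rule integral_translate[symmetric]) measurable
    also have "\<dots> = (LINT y|lborel. cis (- (2 * pi * (z \<bullet> b) * t)) * (?e y * f (t *\<^sub>R b + y)))"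
    proof (intro Bochner_Integration.integral_cong refl)
      fix y
      have "?e (y + t *\<^sub>R b) = cis (- (2 * pi * (z \<bullet> b) * t)) * ?e y"
        by (simp add: cis_mult inner_add_right algebra_simps)
      then show "?e (y + t *\<^sub>R b) * f (y + t *\<^sub>R b) = cis (- (2 * pi * (z \<bullet> b) * t)) * (?e y * f (t *\<^sub>R b + y))"
        by (simp only: mult.assoc add.commute)
    qed
    also have "\<dots> = cis (- (2 * pi * (z \<bullet> b) * t)) * (LINT y|lborel. ?e y * f (t *\<^sub>R b + y))"
      by simp
    finally have "cis (2 * pi * (z \<bullet> b) * t) * fourier f z =
        (cis (2 * pi * (z \<bullet> b) * t) * cis (- (2 * pi * (z \<bullet> b) * t))) * (LINT y|lborel. ?e y * f (t *\<^sub>R b + y))"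
      by (simp add: mult.assoc)
    then show ?thesis by (simp add: cis_mult)
  qed
  moreover have "((\<lambda>t. cis (2 * pi * (z \<bullet> b) * t) * fourier f z) has_derivative
      (\<lambda>s. s *\<^sub>R (2 * pi * \<i> * (z \<bullet> b) * fourier f z))) (at (0::real))"
    by (rule derivative_eq_intros refl)+ (auto simp: fun_eq_iff scaleR_conv_of_real)
  ultimately have 2: "((\<lambda>t. LINT y|lborel. ?e y * f (t *\<^sub>R b + y)) has_derivative
      (\<lambda>s. s *\<^sub>R (2 * pi * \<i> * (z \<bullet> b) * fourier f z))) (at (0::real))" by simp
  from fun_cong[OF has_derivative_unique[OF 1 2], of 1] show ?thesis
    by (simp add: fourier_def)
qed

section \<open>The partial Fourier transform\<close>

text \<open>Transform in the second variable only. The Wigner distribution is of this form, and taking a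
section or a marginal recovers the ordinary Fourier transform and integration over a fibre.\<close>

definition partial_fourier :: "('a::euclidean_space \<times> 'b::euclidean_space \<Rightarrow> complex) \<Rightarrow> 'a \<times> 'b \<Rightarrow> complex" where
  "partial_fourier H = (\<lambda>(x, \<omega>). fourier (\<lambda>y. H (x, y)) \<omega>)"

lemma norm_le_norm_Pair: "norm x \<le> norm (x, y)" "norm y \<le> norm (x, y)"
  using norm_fst_le[of x y] norm_snd_le[of y x] by auto

text \<open>Weights in both variables are available together with integrability in the second one, because
the norm of a pair dominates the norms of its components.\<close>

lemma schwartz_decay_snd:
  fixes H :: "'a::euclidean_space \<times> 'b::euclidean_space \<Rightarrow> complex"
  assumes "H \<in> schwartz"
  shows "\<exists>C. 0 \<le> C \<and> (\<forall>x y. (1 + norm x) ^ j * (1 + norm y) ^ k * norm (H (x, y)) \<le> C * decay y)"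
proof -
  obtain C where C: "\<And>p. (1 + norm p) ^ (j + k + 2 * DIM('b)) * norm (H p) \<le> C"
    using schwartz_iter_decay[OF assms, of "[]" "j + k + 2 * DIM('b)"] by (metis empty_subsetI iter_partial.simps(1) list.set(1))
  have "(1 + norm x) ^ j * (1 + norm y) ^ k * norm (H (x, y)) \<le> C * decay y" for x y
  proof -
    have "((1 + norm x) ^ j * (1 + norm y) ^ k * (1 + norm y) ^ (2 * DIM('b))) * norm (H (x, y))
      \<le> (1 + norm (x, y)) ^ (j + k + 2 * DIM('b)) * norm (H (x, y))"
      unfolding power_add by (intro mult_right_mono mult_mono power_mono) (auto simp: norm_le_norm_Pair)
    also note C
    finally show ?thesis by (simp add: decay_def field_simps add_pos_nonneg)
  qed
  moreover have "0 \<le> C" using C[of 0] by (simp add: order_trans[OF norm_ge_zero])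
  ultimately show ?thesis by blast
qed

lemma partial_fourier_has_derivative:
  fixes H :: "'a::euclidean_space \<times> 'b::euclidean_space \<Rightarrow> complex"
  assumes H: "H \<in> schwartz"
  shows "(partial_fourier H has_derivative
    (\<lambda>v. LINT y|lborel. cis (- 2 * pi * (\<omega> \<bullet> y)) * ((\<Sum>b\<in>Basis. (fst v \<bullet> b) *\<^sub>R partial_deriv (b, 0) H (x, y))
        + (- 2 * pi * \<i>) * (snd v \<bullet> y) * H (x, y)))) (at (x, \<omega>))"
proof -
  have B: "(b, 0) \<in> (Basis :: ('a \<times> 'b) set)" if "b \<in> Basis" for b :: 'a
    using that by (simp add: Basis_prod_def)
  have [measurable]: "H \<in> borel_measurable borel"
    "\<And>b. b \<in> Basis \<Longrightarrow> partial_deriv (b, 0) H \<in> borel_measurable borel"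
    using schwartz_measurable H schwartz_partial[OF H B] by auto
  have "\<exists>C. 0 \<le> C \<and> (\<forall>x y. norm (partial_deriv (b, 0) H (x, y)) \<le> C * decay y)" if "b \<in> Basis" for b
    using schwartz_decay_snd[OF schwartz_partial[OF H B[OF that]], of 0 0] by simp
  then obtain C where C: "\<And>b. b \<in> Basis \<Longrightarrow> 0 \<le> C b"
    "\<And>b x y. b \<in> Basis \<Longrightarrow> norm (partial_deriv (b, 0) H (x, y)) \<le> C b * decay y" by metis
  obtain C0 where C0: "0 \<le> C0" "\<And>x y. (1 + norm y) * norm (H (x, y)) \<le> C0 * decay y"
    using schwartz_decay_snd[OF H, of 0 1] by auto
  define K where "K = (\<Sum>b\<in>Basis. C b) + 2 * pi * C0"
  have K: "0 \<le> K" unfolding K_def using C(1) C0 by (intro add_nonneg_nonneg sum_nonneg) auto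
  let ?e = "\<lambda>\<omega> y. cis (- 2 * pi * (\<omega> \<bullet> y))"
  let ?D = "\<lambda>p y v. ?e (snd p) y * ((\<Sum>b\<in>Basis. (fst v \<bullet> b) *\<^sub>R partial_deriv (b, 0) H (fst p, y))
        + (- 2 * pi * \<i>) * (snd v \<bullet> y) * H (fst p, y))"
  have "((\<lambda>p. LINT y|lborel. ?e (snd p) y * H (fst p, y)) has_derivative
    (\<lambda>v. LINT y|lborel. ?D (x, \<omega>) y v)) (at (x, \<omega>))"
  proof (rule has_derivative_integral[where D = ?D and W = "\<lambda>y. K * decay y"])
    show "integrable lborel (\<lambda>y. ?e (snd p) y * H (fst p, y))" for p
      by (rule fourier_integrable[OF schwartz_section2[OF H]])
    show "((\<lambda>p. ?e (snd p) y * H (fst p, y)) has_derivative ?D p y) (at p)" for p y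
    proof -
      have sec: "((\<lambda>u. H (u, y)) has_derivative
          (\<lambda>h. \<Sum>b\<in>Basis. (h \<bullet> b) *\<^sub>R partial_deriv (b, 0) H (fst p, y))) (at (fst p))"
        using partial_deriv_has_derivative[OF schwartz_section[OF H, of y], of "fst p"]
        by (simp add: partial_deriv_section[OF H])
      have 1: "((\<lambda>p. H (fst p, y)) has_derivative
          (\<lambda>v. \<Sum>b\<in>Basis. (fst v \<bullet> b) *\<^sub>R partial_deriv (b, 0) H (fst p, y))) (at p)"
        by (rule has_derivative_compose[OF has_derivative_fst[OF has_derivative_ident] sec])
      have 2: "((\<lambda>p. ?e (snd p) y) has_derivative
          (\<lambda>v. (- 2 * pi * (snd v \<bullet> y)) *\<^sub>R (\<i> * ?e (snd p) y))) (at p)"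
        by (rule has_derivative_cis) (auto intro!: derivative_eq_intros)
      show ?thesis
        by (rule has_derivative_eq_rhs[OF has_derivative_mult[OF 2 1]])
          (simp add: fun_eq_iff algebra_simps scaleR_conv_of_real)
    qed
    show "norm (?D p y v) \<le> K * decay y * norm v" for p y and v :: "'a \<times> 'b"
    proof -
      have "norm (\<Sum>b\<in>Basis. (fst v \<bullet> b) *\<^sub>R partial_deriv (b, 0) H (fst p, y))
          \<le> (\<Sum>b\<in>Basis. norm v * (C b * decay y))"
      proof (rule sum_norm_le)
        fix b :: 'a assume b: "b \<in> Basis"
        have "\<bar>fst v \<bullet> b\<bar> \<le> norm v"
          using Basis_le_norm[OF b, of "fst v"] norm_fst_le[of "fst v" "snd v"] by simp
        then show "norm ((fst v \<bullet> b) *\<^sub>R partial_deriv (b, 0) H (fst p, y)) \<le> norm v * (C b * decay y)"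
          using C(2)[OF b] by (simp add: mult_mono)
      qed
      also have "\<dots> = (\<Sum>b\<in>Basis. C b) * decay y * norm v"
        by (simp add: sum_distrib_left sum_distrib_right mult_ac)
      finally have 1: "norm (\<Sum>b\<in>Basis. (fst v \<bullet> b) *\<^sub>R partial_deriv (b, 0) H (fst p, y))
          \<le> (\<Sum>b\<in>Basis. C b) * decay y * norm v" .
      have "\<bar>snd v \<bullet> y\<bar> \<le> norm v * (1 + norm y)"
        using norm_snd_le[of "snd v" "fst v"]
        by (intro order_trans[OF Cauchy_Schwarz_ineq2] mult_mono) auto
      then have "\<bar>snd v \<bullet> y\<bar> * norm (H (fst p, y)) \<le> norm v * (1 + norm y) * norm (H (fst p, y))"
        by (intro mult_right_mono) auto
      also have "\<dots> \<le> norm v * (C0 * decay y)"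
        using C0(2)[of y "fst p"] by (simp add: mult.assoc mult_left_mono)
      finally have "2 * pi * (\<bar>snd v \<bullet> y\<bar> * norm (H (fst p, y))) \<le> 2 * pi * (norm v * (C0 * decay y))"
        by (intro mult_left_mono) auto
      then have 2: "norm ((- 2 * pi * \<i>) * (snd v \<bullet> y) * H (fst p, y)) \<le> 2 * pi * C0 * decay y * norm v"
        by (simp add: norm_mult mult_ac)
      show ?thesis
        using order_trans[OF norm_triangle_ineq add_mono[OF 1 2]] unfolding K_def norm_mult norm_cis
        by (simp add: distrib_right)
    qed
    show "integrable lborel (\<lambda>y. K * decay y :: real)" by (intro integrable_mult_right decay_integrable)
    show "0 \<le> K * decay y" for y :: 'b using K less_imp_le[OF decay_pos[of y]] by auto
    show "(\<lambda>y. ?D (x, \<omega>) y v) \<in> borel_measurable lborel" for v by measurable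
  qed
  then show ?thesis
    by (simp add: partial_fourier_def fourier_def case_prod_unfold)
qed

lemma partial_fourier_partial_fst:
  fixes H :: "'a::euclidean_space \<times> 'b::euclidean_space \<Rightarrow> complex"
  assumes H: "H \<in> schwartz" and b: "b \<in> Basis"
  shows "partial_deriv (b, 0) (partial_fourier H) = partial_fourier (partial_deriv (b, 0) H)"
proof
  fix p :: "'a \<times> 'b" obtain x \<omega> where p: "p = (x, \<omega>)" by fastforce
  have "(\<Sum>c\<in>Basis. (b \<bullet> c) *\<^sub>R partial_deriv (c, 0) H (x, y)) = partial_deriv (b, 0) H (x, y)" for y
  proof -
    have "(\<Sum>c\<in>Basis. (b \<bullet> c) *\<^sub>R partial_deriv (c, 0) H (x, y)) =
        (\<Sum>c\<in>Basis. if b = c then partial_deriv (c, 0) H (x, y) else 0)"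
      using b by (intro sum.cong) (auto simp: inner_Basis)
    then show ?thesis using b by simp
  qed
  then show "partial_deriv (b, 0) (partial_fourier H) p = partial_fourier (partial_deriv (b, 0) H) p"
    unfolding p by (subst partial_derivI[OF partial_fourier_has_derivative[OF H]])
      (simp add: partial_fourier_def fourier_def)
qed

lemma partial_fourier_partial_snd:
  fixes H :: "'a::euclidean_space \<times> 'b::euclidean_space \<Rightarrow> complex"
  assumes H: "H \<in> schwartz"
  shows "partial_deriv (0, b) (partial_fourier H) =
    partial_fourier (\<lambda>p. (- 2 * pi * \<i>) * coord_mult (0, b) H p)"
proof
  fix p :: "'a \<times> 'b" obtain x \<omega> where p: "p = (x, \<omega>)" by fastforce
  show "partial_deriv (0, b) (partial_fourier H) p =
      partial_fourier (\<lambda>p. (- 2 * pi * \<i>) * coord_mult (0, b) H p) p"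
    unfolding p by (subst partial_derivI[OF partial_fourier_has_derivative[OF H]])
      (simp add: partial_fourier_def fourier_def coord_mult_def inner_commute mult_ac)
qed

lemma partial_fourier_coord_fst:
  "coord_mult (b, 0) (partial_fourier H) = partial_fourier (coord_mult (b, 0) H)"
  by (simp add: fun_eq_iff coord_mult_def partial_fourier_def fourier_scale)

lemma partial_fourier_coord_snd:
  fixes H :: "'a::euclidean_space \<times> 'b::euclidean_space \<Rightarrow> complex"
  assumes H: "H \<in> schwartz" and b: "b \<in> Basis"
  shows "coord_mult (0, b) (partial_fourier H) =
    partial_fourier (\<lambda>p. (1 / (2 * pi * \<i>)) * partial_deriv (0, b) H p)"
proof
  fix p :: "'a \<times> 'b" obtain x \<omega> where p: "p = (x, \<omega>)" by fastforce
  have "(\<lambda>y. partial_deriv (0, b) H (x, y)) = partial_deriv b (\<lambda>y. H (x, y))"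
    by (simp add: fun_eq_iff partial_deriv_section2[OF H])
  then show "coord_mult (0, b) (partial_fourier H) p =
      partial_fourier (\<lambda>p. (1 / (2 * pi * \<i>)) * partial_deriv (0, b) H p) p"
    unfolding p partial_fourier_def case_prod_conv fourier_scale
    by (simp add: fourier_partial[OF schwartz_section2[OF H] b] coord_mult_def partial_fourier_def)
qed

lemma partial_fourier_bound:
  fixes H :: "'a::euclidean_space \<times> 'b::euclidean_space \<Rightarrow> complex"
  assumes H: "H \<in> schwartz"
  shows "norm (partial_fourier H p) \<le> (LINT y|lborel. decay (y :: 'b)) * schwartz_norm (2 * DIM('b)) H"
proof -
  obtain x \<omega> where p: "p = (x, \<omega>)" by fastforce
  let ?C = "schwartz_norm (2 * DIM('b)) H"
  have "norm (partial_fourier H p) \<le> (LINT y|lborel. decay (y :: 'b) * ?C)"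
    unfolding p partial_fourier_def case_prod_conv fourier_def
  proof (rule Bochner_Integration.integral_norm_bound_integral[OF fourier_integrable[OF schwartz_section2[OF H]] integrable_mult_left[OF decay_integrable]])
    fix y :: 'b
    have "(1 + norm y) ^ (2 * DIM('b)) * norm (H (x, y)) \<le> (1 + norm (x, y)) ^ (2 * DIM('b)) * norm (H (x, y))"
      by (intro mult_right_mono power_mono) (auto simp: norm_le_norm_Pair)
    also have "\<dots> \<le> ?C"
      using schwartz_norm_ge[OF H, of "[]"] by simp
    finally show "norm (cis (- 2 * pi * (\<omega> \<bullet> y)) * H (x, y)) \<le> decay y * ?C"
      by (simp add: norm_mult decay_def field_simps add_pos_nonneg)
  qed
  then show ?thesis by simp
qed

text \<open>The transform commutes with \<open>\<partial>\<close> and \<open>x\<close> in the first variable and exchanges them, up to constants, in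
the second. Its compositions with Weyl operators are therefore a closed family, and each of them is
bounded pointwise by a Schwartz norm times the integral of \<open>decay\<close>.\<close>

theorem cont_op_partial_fourier:
  "cont_op (partial_fourier :: ('a::euclidean_space \<times> 'b::euclidean_space \<Rightarrow> complex) \<Rightarrow> _)"
proof -
  define \<A> where "\<A> = (\<lambda>D f. partial_fourier (D f)) `
    (weyl :: (('a \<times> 'b \<Rightarrow> complex) \<Rightarrow> 'a \<times> 'b \<Rightarrow> complex) set)"
  have \<A>I: "(\<lambda>f. partial_fourier (D f)) \<in> \<A>" if "D \<in> weyl" for D
    unfolding \<A>_def using that by (rule image_eqI[OF refl])
  have diff: "A f differentiable (at p)" if A: "A \<in> \<A>" and f: "f \<in> schwartz" for A f p
  proof -
    obtain D where D: "D \<in> weyl" "A = (\<lambda>f. partial_fourier (D f))" using A unfolding \<A>_def by auto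
    show ?thesis unfolding D
      using partial_fourier_has_derivative[OF schwartz_weyl[OF D(1) f], of "snd p" "fst p"]
      by (simp add: differentiableI)
  qed
  have bnd: "tame schwartz schwartz_norm (\<lambda>f x. norm (A f x))" if A: "A \<in> \<A>" for A
  proof -
    obtain D where D: "D \<in> weyl" "A = (\<lambda>f. partial_fourier (D f))" using A unfolding \<A>_def by auto
    let ?c = "LINT y|lborel. decay (y :: 'b)"
    have c: "0 \<le> ?c" by (intro integral_nonneg_AE AE_I2 less_imp_le decay_pos)
    obtain C M where M: "\<And>f. f \<in> schwartz \<Longrightarrow> schwartz_norm (2 * DIM('b)) (D f) \<le> C * schwartz_norm M f"
      using weyl_cont[OF D(1)] unfolding cont_op_def by metis
    have "norm (A f x) \<le> ?c * C * schwartz_norm M f" if f: "f \<in> schwartz" for f x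
      using order_trans[OF partial_fourier_bound[OF schwartz_weyl[OF D(1) f]] mult_left_mono[OF M[OF f] c]]
      by (simp add: D mult.assoc)
    then show ?thesis unfolding tame_def by blast
  qed
  have der: "\<exists>B\<in>\<A>. \<forall>f\<in>schwartz. partial_deriv b (A f) = B f" if A: "A \<in> \<A>" and b: "b \<in> Basis" for A b
  proof -
    obtain D where D: "D \<in> weyl" "A = (\<lambda>f. partial_fourier (D f))" using A unfolding \<A>_def by auto
    from b show ?thesis
    proof (cases rule: Basis_prodE)
      case (1 c)
      obtain E where E: "E \<in> weyl" "\<And>f. f \<in> schwartz \<Longrightarrow> partial_deriv b (D f) = E f"
        using weyl_partial[OF D(1) b] by auto
      have "partial_deriv b (A f) = partial_fourier (E f)" if f: "f \<in> schwartz" for f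
        using partial_fourier_partial_fst[OF schwartz_weyl[OF D(1) f] 1(1)] E(2)[OF f] by (simp add: D 1)
      then show ?thesis by (intro bexI[OF _ \<A>I[OF E(1)]]) simp
    next
      case (2 c)
      have "partial_deriv b (A f) = partial_fourier (\<lambda>p. (- 2 * pi * \<i>) * coord_mult b (D f) p)" if f: "f \<in> schwartz" for f
        using partial_fourier_partial_snd[OF schwartz_weyl[OF D(1) f], of c] by (simp add: D 2)
      moreover have W: "(\<lambda>f p. (- 2 * pi * \<i>) * coord_mult b (D f) p) \<in> weyl"
        by (intro weyl_scale weyl_coord D b)
      ultimately show ?thesis by (intro bexI[OF _ \<A>I[OF W]]) simp
    qed
  qed
  have crd: "\<exists>B\<in>\<A>. \<forall>f\<in>schwartz. coord_mult b (A f) = B f" if A: "A \<in> \<A>" and b: "b \<in> Basis" for A b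
  proof -
    obtain D where D: "D \<in> weyl" "A = (\<lambda>f. partial_fourier (D f))" using A unfolding \<A>_def by auto
    from b show ?thesis
    proof (cases rule: Basis_prodE)
      case (1 c)
      have "coord_mult b (A f) = partial_fourier (coord_mult b (D f))" for f
        by (simp add: D 1 partial_fourier_coord_fst)
      moreover have W: "(\<lambda>f. coord_mult b (D f)) \<in> weyl" by (intro weyl_coord D b)
      ultimately show ?thesis by (intro bexI[OF _ \<A>I[OF W]]) simp
    next
      case (2 c)
      obtain E where E: "E \<in> weyl" "\<And>f. f \<in> schwartz \<Longrightarrow> partial_deriv b (D f) = E f"
        using weyl_partial[OF D(1) b] by auto
      have "coord_mult b (A f) = partial_fourier (\<lambda>p. (1 / (2 * pi * \<i>)) * E f p)" if f: "f \<in> schwartz" for f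
        using partial_fourier_coord_snd[OF schwartz_weyl[OF D(1) f] 2(1)] E(2)[OF f] by (simp add: D 2)
      moreover have W: "(\<lambda>f p. (1 / (2 * pi * \<i>)) * E f p) \<in> weyl" by (intro weyl_scale E)
      ultimately show ?thesis by (intro bexI[OF _ \<A>I[OF W]]) simp
    qed
  qed
  have mem: "partial_fourier \<in> \<A>"
    using \<A>I[OF weyl_id] by simp
  show ?thesis by (rule cont_op_family[where \<A> = \<A>]) (rule diff bnd der crd mem | assumption)+
qed

lemmas schwartz_partial_fourier = cont_op_schwartz[OF cont_op_partial_fourier]

text \<open>Since \<open>gauss 0 = 1\<close>, the transform of \<open>f\<close> is the section at \<open>0\<close> of the partial transform of
\<open>tensor gauss f\<close>. The auxiliary first variable is a real line.\<close>

lemma schwartz_fourier: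
  fixes f :: "'a::euclidean_space \<Rightarrow> complex"
  assumes "f \<in> schwartz" shows "fourier f \<in> schwartz"
proof -
  have "(\<lambda>\<omega>. partial_fourier (tensor gauss f) (0::real, \<omega>)) \<in> schwartz"
    by (intro schwartz_section2 schwartz_partial_fourier schwartz_tensor schwartz_gauss assms)
  then show ?thesis by (simp add: partial_fourier_def tensor_def gauss_def)
qed

section \<open>The Gaussian is its own Fourier transform\<close>

lemma integrable_gauss_real: "integrable lborel (\<lambda>t::real. complex_of_real (exp (- pi * t\<^sup>2)))"
  using schwartz_integrable[OF schwartz_gauss, where 'a = real]
  by (simp add: gauss_def[abs_def] power2_eq_square)

text \<open>The substitution \<open>x = sqrt (2 * pi) * t\<close> turns the characteristic function of the standard normal
distribution into the Fourier transform in the present normalisation.\<close>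

lemma fourier_gauss_real:
  "(LINT t|lborel. cis (- 2 * pi * (s * t)) * complex_of_real (exp (- pi * t\<^sup>2))) = complex_of_real (exp (- pi * s\<^sup>2))"
proof -
  define \<tau> where "\<tau> = - (sqrt (2 * pi) * s)"
  define g where "g x = complex_of_real (std_normal_density x) * cis (\<tau> * x)" for x
  have [measurable]: "g \<in> borel_measurable borel" unfolding g_def[abs_def] by measurable
  have sq: "sqrt (2 * pi) * sqrt (2 * pi) = 2 * pi" by simp
  have "char std_normal_distribution \<tau> = (LINT x|lborel. std_normal_density x *\<^sub>R iexp (\<tau> * x))"
    unfolding char_def by (rule integral_density) auto
  also have "\<dots> = (LINT x|lborel. g x)"
    by (simp add: g_def cis_conv_exp scaleR_conv_of_real)
  also have "\<dots> = complex_of_real (\<bar>sqrt (2 * pi)\<bar> ^ DIM(real)) * (LINT t|lborel. g (0 + sqrt (2 * pi) *\<^sub>R t))"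
    by (rule integral_scale) auto
  also have "\<dots> = (LINT t|lborel. cis (- 2 * pi * (s * t)) * complex_of_real (exp (- pi * t\<^sup>2)))"
  proof -
    have "complex_of_real (sqrt (2 * pi)) * g (sqrt (2 * pi) * t)
        = cis (- 2 * pi * (s * t)) * complex_of_real (exp (- pi * t\<^sup>2))" for t
    proof -
      have "\<tau> * (sqrt (2 * pi) * t) = - (sqrt (2 * pi) * sqrt (2 * pi)) * (s * t)"
        unfolding \<tau>_def by simp
      then have 1: "\<tau> * (sqrt (2 * pi) * t) = - 2 * pi * (s * t)" unfolding sq by simp
      have "(sqrt (2 * pi) * t)\<^sup>2 / 2 = pi * t\<^sup>2" by (simp add: power_mult_distrib)
      then have 2: "sqrt (2 * pi) * std_normal_density (sqrt (2 * pi) * t) = exp (- pi * t\<^sup>2)"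
        unfolding std_normal_density_def by simp
      show ?thesis
        unfolding g_def 1 2[symmetric] of_real_mult by (simp add: mult_ac)
    qed
    then show ?thesis
      by (simp del: of_real_mult flip: Bochner_Integration.integral_mult_right_zero)
  qed
  finally have "(LINT t|lborel. cis (- 2 * pi * (s * t)) * complex_of_real (exp (- pi * t\<^sup>2))) = exp (- (\<tau>\<^sup>2) / 2)"
    unfolding char_std_normal_distribution by simp
  also have "- (\<tau>\<^sup>2) / 2 = - pi * s\<^sup>2" by (simp add: \<tau>_def power_mult_distrib)
  finally show ?thesis .
qed

theorem fourier_gauss: "fourier gauss z = gauss z" for z :: "'a::euclidean_space"
proof -
  define g where "g b t = cis (- 2 * pi * ((z \<bullet> b) * t)) * complex_of_real (exp (- pi * t\<^sup>2))" for b t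
  have split: "(\<Sum>b\<in>Basis. (w \<bullet> b)\<^sup>2) = w \<bullet> w" for w :: 'a
    by (subst euclidean_inner) (simp add: power2_eq_square)
  have gauss_prod: "(\<Prod>b\<in>Basis. complex_of_real (exp (- pi * (w \<bullet> b)\<^sup>2))) = gauss w" for w :: 'a
  proof -
    have "(\<Prod>b\<in>Basis. exp (- pi * (w \<bullet> b)\<^sup>2)) = exp (- pi * (w \<bullet> w))"
      unfolding split[symmetric] sum_distrib_left by (simp add: exp_sum)
    then show ?thesis by (simp add: gauss_def flip: of_real_prod)
  qed
  have "(\<Prod>b\<in>Basis. g b (w \<bullet> b)) = cis (- 2 * pi * (z \<bullet> w)) * gauss w" for w
  proof -
    have "(\<Prod>b\<in>Basis. cis (- 2 * pi * ((z \<bullet> b) * (w \<bullet> b)))) = cis (- 2 * pi * (z \<bullet> w))"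
    proof -
      have "(\<Prod>b\<in>B. cis (h b)) = cis (\<Sum>b\<in>B. h b)" if "finite B" for h :: "'a \<Rightarrow> real" and B
        using that by (induction B rule: finite_induct) (auto simp: cis_mult)
      moreover have "(\<Sum>b\<in>Basis. - 2 * pi * ((z \<bullet> b) * (w \<bullet> b))) = - 2 * pi * (z \<bullet> w)"
        by (subst euclidean_inner) (simp add: sum_distrib_left)
      ultimately show ?thesis by simp
    qed
    then show ?thesis unfolding g_def prod.distrib gauss_prod by simp
  qed
  then have "fourier gauss z = (LINT w|lborel. (\<Prod>b\<in>Basis. g b (w \<bullet> b)))"
    by (simp add: fourier_def)
  also have "\<dots> = (\<Prod>b\<in>Basis. (LINT t|lborel. g b t))"
    by (rule lborel_prod_coords(2), unfold g_def) (intro integrable_cis_mult integrable_gauss_real, measurable)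
  also have "\<dots> = gauss z"
    unfolding g_def fourier_gauss_real gauss_prod ..
  finally show ?thesis .
qed

lemma integral_gauss: "(LINT w|lborel. gauss (w :: 'a::euclidean_space)) = 1"
  using fourier_gauss[of "0::'a"] by (simp add: fourier_def gauss_def)

section \<open>Fourier inversion\<close>

lemma lborel_integral_prod:
  fixes h :: "'a::euclidean_space \<times> 'b::euclidean_space \<Rightarrow> complex"
  assumes "integrable lborel h"
  shows "(LINT p|lborel. h p) = (LINT x|lborel. LINT y|lborel. h (x, y))"
    and "(LINT p|lborel. h p) = (LINT y|lborel. LINT x|lborel. h (x, y))"
proof -
  have h: "integrable (lborel \<Otimes>\<^sub>M lborel) (\<lambda>(x, y). h (x, y))" using assms by (simp add: lborel_prod)
  show "(LINT p|lborel. h p) = (LINT x|lborel. LINT y|lborel. h (x, y))"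
    using lborel_pair.integral_fst[OF h] by (simp add: lborel_prod)
  show "(LINT p|lborel. h p) = (LINT y|lborel. LINT x|lborel. h (x, y))"
    using lborel_pair.integral_snd[OF h] by (simp add: lborel_prod)
qed

lemma lborel_integral_swap:
  fixes h :: "'a::euclidean_space \<times> 'b::euclidean_space \<Rightarrow> complex"
  assumes "integrable lborel h"
  shows "(LINT x|lborel. LINT y|lborel. h (x, y)) = (LINT y|lborel. LINT x|lborel. h (x, y))"
  using lborel_integral_prod[OF assms] by simp

lemma gauss_bound: "norm (gauss x) \<le> 1"
  by (simp add: gauss_def)

text \<open>The damping factor \<open>gauss (e *\<^sub>R \<xi>)\<close> makes the double integral absolutely convergent, so that the
order of integration may be exchanged; the inner integral is then the transform of a Gaussian,
which reappears as the averaging kernel on the left.\<close>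

lemma gaussian_average_fourier:
  fixes f :: "'a::euclidean_space \<Rightarrow> complex"
  assumes f: "f \<in> schwartz" and e: "0 < e"
  shows "(LINT y|lborel. f (x + e *\<^sub>R y) * gauss y) =
    (LINT \<xi>|lborel. gauss (e *\<^sub>R \<xi>) * (cis (2 * pi * (x \<bullet> \<xi>)) * fourier f \<xi>))"
proof -
  note [measurable] = schwartz_measurable[OF f] schwartz_measurable[OF schwartz_fourier[OF f]]
    schwartz_measurable[OF schwartz_gauss]
  define g where "g y = f (x + e *\<^sub>R y)" for y
  have g: "g \<in> schwartz"
    unfolding g_def[abs_def]
    by (rule schwartz_affine[where L = "\<lambda>y. e *\<^sub>R y" and L' = "\<lambda>y. (1 / e) *\<^sub>R y", OF _ _ _ f])
      (use e in \<open>auto simp: linear_iff algebra_simps\<close>)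
  have F: "cis (2 * pi * (x \<bullet> \<xi>)) * fourier f \<xi> = of_real (e ^ DIM('a)) * fourier g (e *\<^sub>R \<xi>)" for \<xi>
  proof -
    have "fourier f \<xi> = of_real (\<bar>e\<bar> ^ DIM('a)) * (LINT y|lborel. cis (- 2 * pi * (\<xi> \<bullet> (x + e *\<^sub>R y))) * f (x + e *\<^sub>R y))"
      unfolding fourier_def by (rule integral_scale) (use e in auto)
    also have "(\<lambda>y. cis (- 2 * pi * (\<xi> \<bullet> (x + e *\<^sub>R y))) * f (x + e *\<^sub>R y)) =
        (\<lambda>y. cis (- (2 * pi * (x \<bullet> \<xi>))) * (cis (- 2 * pi * ((e *\<^sub>R \<xi>) \<bullet> y)) * g y))"
    proof
      fix y
      have "cis (- 2 * pi * (\<xi> \<bullet> (x + e *\<^sub>R y))) = cis (- (2 * pi * (x \<bullet> \<xi>))) * cis (- 2 * pi * ((e *\<^sub>R \<xi>) \<bullet> y))"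
        by (simp add: cis_mult inner_add_right algebra_simps inner_commute)
      then show "cis (- 2 * pi * (\<xi> \<bullet> (x + e *\<^sub>R y))) * f (x + e *\<^sub>R y) =
        cis (- (2 * pi * (x \<bullet> \<xi>))) * (cis (- 2 * pi * ((e *\<^sub>R \<xi>) \<bullet> y)) * g y)"
        by (simp add: g_def mult.assoc)
    qed
    finally have "cis (2 * pi * (x \<bullet> \<xi>)) * fourier f \<xi> =
        of_real (e ^ DIM('a)) * ((cis (2 * pi * (x \<bullet> \<xi>)) * cis (- (2 * pi * (x \<bullet> \<xi>)))) * fourier g (e *\<^sub>R \<xi>))"
      using e unfolding Bochner_Integration.integral_mult_right_zero fourier_def[of g, symmetric]
      by (simp only: mult_ac abs_of_pos)
    then show ?thesis by (simp add: cis_mult)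
  qed
  have [measurable]: "g \<in> borel_measurable borel" "fourier g \<in> borel_measurable borel"
    using schwartz_measurable g schwartz_fourier[OF g] by auto
  have "(LINT \<xi>|lborel. gauss (e *\<^sub>R \<xi>) * (cis (2 * pi * (x \<bullet> \<xi>)) * fourier f \<xi>)) =
      of_real (e ^ DIM('a)) * (LINT \<xi>|lborel. gauss (0 + e *\<^sub>R \<xi>) * fourier g (0 + e *\<^sub>R \<xi>))"
    unfolding F by (simp add: mult.left_commute[of _ "of_real (e ^ DIM('a))"] del: of_real_power)
  also have "\<dots> = (LINT \<xi>|lborel. gauss \<xi> * fourier g \<xi>)"
    using integral_scale[of "\<lambda>\<xi>. gauss \<xi> * fourier g \<xi>" e 0] e by simp
  also have "\<dots> = (LINT \<xi>|lborel. LINT y|lborel. cis (- 2 * pi * (\<xi> \<bullet> y)) * (gauss \<xi> * g y))"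
    unfolding fourier_def by (simp add: mult.left_commute flip: Bochner_Integration.integral_mult_right_zero)
  also have "\<dots> = (LINT y|lborel. LINT \<xi>|lborel. cis (- 2 * pi * (\<xi> \<bullet> y)) * (gauss \<xi> * g y))"
  proof -
    have "integrable lborel (\<lambda>p. cis (- 2 * pi * (fst p \<bullet> snd p)) * tensor gauss g p)"
    proof (intro integrable_cis_mult schwartz_integrable schwartz_tensor schwartz_gauss g)
      have "(\<lambda>p :: 'a \<times> 'a. - 2 * pi * (fst p \<bullet> snd p)) \<in> borel_measurable borel"
        by (intro borel_measurable_continuous_onI continuous_intros)
      then show "(\<lambda>p :: 'a \<times> 'a. - 2 * pi * (fst p \<bullet> snd p)) \<in> borel_measurable lborel" by simp
    qed
    from lborel_integral_swap[OF this] show ?thesis by (simp add: tensor_def)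
  qed
  also have "\<dots> = (LINT y|lborel. fourier gauss y * g y)"
    unfolding fourier_def by (simp add: inner_commute mult.assoc[symmetric])
  finally show ?thesis by (simp add: fourier_gauss g_def mult.commute)
qed

text \<open>Let \<open>e\<close> tend to \<open>0\<close> in \<open>gaussian_average_fourier\<close>: the Gaussian average of \<open>f\<close> tends to the value of \<open>f\<close>
at the base point, and the damping disappears on the other side.\<close>

theorem fourier_inversion:
  fixes f :: "'a::euclidean_space \<Rightarrow> complex"
  assumes f: "f \<in> schwartz"
  shows "fourier (fourier f) x = f (- x)"
proof -
  note [measurable] = schwartz_measurable[OF f] schwartz_measurable[OF schwartz_fourier[OF f]]
    schwartz_measurable[OF schwartz_gauss]
  define e where "e n = inverse (real (Suc n))" for n
  have e: "0 < e n" for n by (simp add: e_def)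
  have e0: "e \<longlonglongrightarrow> 0" unfolding e_def[abs_def] by (rule LIMSEQ_inverse_real_of_nat)
  obtain C where C: "0 \<le> C" "\<And>x. norm (f x) \<le> C" using schwartz_bounded[OF f] by metis
  have lim1: "(\<lambda>n. LINT y|lborel. f (- x + e n *\<^sub>R y) * gauss y) \<longlonglongrightarrow> (LINT y|lborel. f (- x) * gauss (y :: 'a))"
  proof (rule integral_dominated_convergence)
    show "integrable lborel (\<lambda>y::'a. C * norm (gauss y))"
      by (intro integrable_mult_right integrable_norm schwartz_integrable schwartz_gauss)
    show "AE y in lborel. norm (f (- x + e n *\<^sub>R y) * gauss y) \<le> C * norm (gauss y)" for n
      by (intro AE_I2) (auto simp: norm_mult intro!: mult_right_mono C)
    show "AE y in lborel. (\<lambda>n. f (- x + e n *\<^sub>R y) * gauss y) \<longlonglongrightarrow> f (- x) * gauss y"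
    proof (rule AE_I2, rule tendsto_mult[OF _ tendsto_const])
      fix y
      have "(\<lambda>n. - x + e n *\<^sub>R y) \<longlonglongrightarrow> - x + 0 *\<^sub>R y" by (intro tendsto_intros e0)
      moreover have "isCont f (- x)"
        using schwartz_continuous[OF f, of UNIV] by (simp add: continuous_on_eq_continuous_at)
      ultimately show "(\<lambda>n. f (- x + e n *\<^sub>R y)) \<longlonglongrightarrow> f (- x)"
        by (auto intro: isCont_tendsto_compose)
    qed
  qed measurable
  have lim2: "(\<lambda>n. LINT \<xi>|lborel. gauss (e n *\<^sub>R \<xi>) * (cis (2 * pi * (- x \<bullet> \<xi>)) * fourier f \<xi>)) \<longlonglongrightarrow>
      (LINT \<xi>|lborel. cis (2 * pi * (- x \<bullet> \<xi>)) * fourier f \<xi>)"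
  proof (rule integral_dominated_convergence)
    show "integrable lborel (\<lambda>\<xi>. norm (fourier f \<xi>))"
      by (intro integrable_norm schwartz_integrable schwartz_fourier f)
    show "AE \<xi> in lborel. norm (gauss (e n *\<^sub>R \<xi>) * (cis (2 * pi * (- x \<bullet> \<xi>)) * fourier f \<xi>)) \<le> norm (fourier f \<xi>)" for n
      using mult_right_mono[OF gauss_bound norm_ge_zero] by (intro AE_I2) (auto simp: norm_mult)
    show "AE \<xi> in lborel. (\<lambda>n. gauss (e n *\<^sub>R \<xi>) * (cis (2 * pi * (- x \<bullet> \<xi>)) * fourier f \<xi>)) \<longlonglongrightarrow>
        cis (2 * pi * (- x \<bullet> \<xi>)) * fourier f \<xi>"
    proof (rule AE_I2)
      fix \<xi> :: 'a
      have "(\<lambda>n. e n *\<^sub>R \<xi>) \<longlonglongrightarrow> 0 *\<^sub>R \<xi>" by (intro tendsto_intros e0)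
      moreover have "isCont gauss (0 :: 'a)"
        using schwartz_continuous[OF schwartz_gauss[where 'a = 'a], of UNIV] by (simp add: continuous_on_eq_continuous_at)
      ultimately have "(\<lambda>n. gauss (e n *\<^sub>R \<xi>)) \<longlonglongrightarrow> gauss (0 :: 'a)"
        by (auto intro: isCont_tendsto_compose)
      from tendsto_mult[OF this tendsto_const]
      show "(\<lambda>n. gauss (e n *\<^sub>R \<xi>) * (cis (2 * pi * (- x \<bullet> \<xi>)) * fourier f \<xi>)) \<longlonglongrightarrow>
          cis (2 * pi * (- x \<bullet> \<xi>)) * fourier f \<xi>" by (auto simp: gauss_def)
    qed
  qed measurable
  have "(LINT y|lborel. f (- x) * gauss (y :: 'a)) = (LINT \<xi>|lborel. cis (2 * pi * (- x \<bullet> \<xi>)) * fourier f \<xi>)"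
    using LIMSEQ_unique[OF lim1] lim2 gaussian_average_fourier[OF f e, of "- x"] by simp
  then show ?thesis by (simp add: fourier_def integral_gauss)
qed

text \<open>This is how oscillatory integrals collapse below: integrating a partial transform against a
character evaluates the original function at the frequency of that character.\<close>

lemma partial_fourier_twice:
  assumes H: "H \<in> schwartz"
  shows "partial_fourier (partial_fourier H) (x, y) = H (x, - y)"
  using fourier_inversion[OF schwartz_section2[OF H]] by (simp add: partial_fourier_def)

section \<open>Linear change of variables\<close>

lemma nn_integral_permute_coords:
  fixes f :: "real^'n \<Rightarrow> ennreal" and \<pi> :: "'n \<Rightarrow> 'n"
  assumes \<pi>: "bij \<pi>" and [measurable]: "f \<in> borel_measurable borel"
  shows "(\<integral>\<^sup>+x. f (\<chi> i. x $ \<pi> i) \<partial>lborel) = (\<integral>\<^sup>+x. f x \<partial>lborel)"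
proof -
  let ?T = "\<lambda>x::real^'n. \<chi> i. x $ \<pi> i"
  have T[measurable]: "?T \<in> borel_measurable borel"
    by (intro borel_measurable_continuous_onI continuous_intros)
  have "lborel = distr lborel borel ?T"
  proof (rule lborel_eqI)
    fix l u :: "real^'n" assume lu: "\<And>b. b \<in> Basis \<Longrightarrow> l \<bullet> b \<le> u \<bullet> b"
    let ?S = "\<lambda>x::real^'n. \<chi> i. x $ (inv \<pi>) i"
    have inv: "\<pi> (inv \<pi> i) = i" "inv \<pi> (\<pi> i) = i" for i
      using \<pi> by (auto simp: bij_is_surj surj_f_inv_f bij_is_inj)
    have vim: "?T -` box l u = box (?S l) (?S u)"
      by (auto simp: mem_box_cart) (metis inv)+
    have prodv: "(\<Prod>b\<in>Basis. x \<bullet> b) = (\<Prod>i\<in>UNIV. x $ i)" for x :: "real^'n"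
    proof -
      have "(\<Prod>b\<in>Basis. x \<bullet> b) = (\<Prod>b\<in>range (\<lambda>i. axis i 1). x \<bullet> b)"
        by (rule prod.cong) (auto simp: Basis_vec_def)
      also have "\<dots> = (\<Prod>i\<in>UNIV. x $ i)"
        by (subst prod.reindex) (auto simp: inj_on_def axis_eq_axis inner_axis)
      finally show ?thesis .
    qed
    have le: "?S l $ i \<le> ?S u $ i" for i using lu[of "axis (inv \<pi> i) 1"] by (auto simp: inner_axis Basis_vec_def)
    have "emeasure (distr lborel borel ?T) (box l u) = emeasure lborel (box (?S l) (?S u))"
      by (subst emeasure_distr) (auto simp: vim)
    also have "\<dots> = ennreal (\<Prod>b\<in>Basis. (?S u - ?S l) \<bullet> b)"
      using le by (subst emeasure_lborel_box) (auto simp: Basis_vec_def inner_axis)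
    also have "(\<Prod>b\<in>Basis. (?S u - ?S l) \<bullet> b) = (\<Prod>i\<in>UNIV. (u - l) $ (inv \<pi> i))"
      by (simp add: prodv)
    also have "\<dots> = (\<Prod>i\<in>UNIV. (u - l) $ i)"
      by (rule prod.reindex_bij_betw) (use \<pi> in \<open>auto simp: bij_imp_bij_inv\<close>)
    finally show "emeasure (distr lborel borel ?T) (box l u) = ennreal (\<Prod>b\<in>Basis. (u - l) \<bullet> b)"
      by (simp add: prodv)
  qed simp
  then have "(\<integral>\<^sup>+x. f x \<partial>lborel) = (\<integral>\<^sup>+x. f x \<partial>distr lborel borel ?T)" by simp
  also have "\<dots> = (\<integral>\<^sup>+x. f (?T x) \<partial>lborel)" by (rule nn_integral_distr) auto
  finally show ?thesis ..
qed

text \<open>In the coordinate along \<open>b\<close> the shear is a translation whose length depends only on the other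
coordinates; integrate in that coordinate first.\<close>

lemma nn_integral_shear:
  fixes f :: "'a::euclidean_space \<Rightarrow> ennreal"
  assumes b: "b \<in> Basis" "c \<in> Basis" "b \<noteq> c" and [measurable]: "f \<in> borel_measurable borel"
  shows "(\<integral>\<^sup>+x. f (x + (k * (x \<bullet> c)) *\<^sub>R b) \<partial>lborel) = (\<integral>\<^sup>+x. f x \<partial>lborel)"
proof -
  interpret product_sigma_finite "\<lambda>b::'a. lborel :: real measure" by standard
  let ?T = "\<lambda>p. \<Sum>b\<in>Basis. p b *\<^sub>R b :: 'a"
  let ?B = "Basis - {b}"
  have T[measurable]: "?T \<in> (\<Pi>\<^sub>M b\<in>Basis. lborel) \<rightarrow>\<^sub>M borel" by measurable
  have ins: "insert b ?B = Basis" using b by auto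
  define v where "v p = ?T (p(b := 0))" for p
  have upd: "?T (p(b := t)) = v p + t *\<^sub>R b" for p t
    unfolding v_def by (subst (1 2) sum.remove[OF _ b(1)]) (auto intro!: sum.cong)
  have T': "?T \<in> (\<Pi>\<^sub>M b\<in>insert b ?B. lborel) \<rightarrow>\<^sub>M borel" using T unfolding ins .
  have iter: "(\<integral>\<^sup>+x. g x \<partial>lborel) = (\<integral>\<^sup>+p. (\<integral>\<^sup>+t. g (v p + t *\<^sub>R b) \<partial>lborel) \<partial>(\<Pi>\<^sub>M b\<in>?B. lborel))"
    if [measurable]: "g \<in> borel_measurable borel" for g :: "'a \<Rightarrow> ennreal"
  proof -
    have "(\<integral>\<^sup>+x. g x \<partial>lborel) = (\<integral>\<^sup>+p. g (?T p) \<partial>(\<Pi>\<^sub>M b\<in>Basis. lborel))"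
      by (subst lborel_eq, subst nn_integral_distr) auto
    also have "\<dots> = (\<integral>\<^sup>+p. g (?T p) \<partial>(\<Pi>\<^sub>M b\<in>insert b ?B. lborel))" unfolding ins ..
    also have "\<dots> = (\<integral>\<^sup>+p. (\<integral>\<^sup>+t. g (?T (p(b := t))) \<partial>lborel) \<partial>(\<Pi>\<^sub>M b\<in>?B. lborel))"
      by (rule product_nn_integral_insert) (use measurable_compose[OF T' that] in auto)
    finally show ?thesis unfolding upd .
  qed
  have "(\<integral>\<^sup>+x. f (x + (k * (x \<bullet> c)) *\<^sub>R b) \<partial>lborel) =
      (\<integral>\<^sup>+p. (\<integral>\<^sup>+t. f (v p + t *\<^sub>R b + (k * ((v p + t *\<^sub>R b) \<bullet> c)) *\<^sub>R b) \<partial>lborel) \<partial>(\<Pi>\<^sub>M b\<in>?B. lborel))"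
    by (rule iter) measurable
  also have "\<dots> = (\<integral>\<^sup>+p. (\<integral>\<^sup>+t. f (v p + t *\<^sub>R b) \<partial>lborel) \<partial>(\<Pi>\<^sub>M b\<in>?B. lborel))"
  proof (rule nn_integral_cong)
    fix p
    have "(\<integral>\<^sup>+t. f (v p + t *\<^sub>R b) \<partial>lborel) = (\<integral>\<^sup>+t. f (v p + t *\<^sub>R b) \<partial>distr lborel borel ((+) (k * (v p \<bullet> c))))"
      by (simp add: lborel_distr_plus)
    also have "\<dots> = (\<integral>\<^sup>+t. f (v p + (k * (v p \<bullet> c) + t) *\<^sub>R b) \<partial>lborel)"
      by (rule nn_integral_distr) auto
    finally show "(\<integral>\<^sup>+t. f (v p + t *\<^sub>R b + (k * ((v p + t *\<^sub>R b) \<bullet> c)) *\<^sub>R b) \<partial>lborel) =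
        (\<integral>\<^sup>+t. f (v p + t *\<^sub>R b) \<partial>lborel)"
      using b by (simp add: inner_add_left inner_not_same_Basis algebra_simps)
  qed
  also have "\<dots> = (\<integral>\<^sup>+x. f x \<partial>lborel)" by (rule iter[symmetric]) measurable
  finally show ?thesis .
qed

text \<open>The identity passes to products of matrices, so by row reduction it suffices to treat diagonal
matrices, transpositions and shears.\<close>

lemma nn_integral_matrix:
  fixes A :: "real^'n^'n"
  shows "det A \<noteq> 0 \<Longrightarrow> f \<in> borel_measurable borel \<Longrightarrow>
    (\<integral>\<^sup>+x. f x \<partial>lborel) = ennreal \<bar>det A\<bar> * (\<integral>\<^sup>+x. f (A *v x) \<partial>lborel)"
proof (induction A arbitrary: f rule: induct_matrix_elementary)
  case (1 A B)
  note mult_prems = "1.prems" and mult_IH = "1.IH"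
  have [measurable]: "(\<lambda>x. f (A *v x)) \<in> borel_measurable borel"
    by (rule measurable_compose[OF _ mult_prems(2)]) (intro borel_measurable_continuous_onI matrix_vector_mult_linear_continuous_on)
  have "det A \<noteq> 0" "det B \<noteq> 0" using mult_prems(1) by (auto simp: det_mul)
  then have "(\<integral>\<^sup>+x. f x \<partial>lborel) = ennreal \<bar>det A\<bar> * (ennreal \<bar>det B\<bar> * (\<integral>\<^sup>+x. f (A *v (B *v x)) \<partial>lborel))"
    using mult_IH(1)[OF _ mult_prems(2)] mult_IH(2)[of "\<lambda>x. f (A *v x)"] by simp
  then show ?case
    by (simp add: det_mul abs_mult ennreal_mult' matrix_vector_mul_assoc mult.assoc)
next
  case (2 A i)
    then show ?case using det_zero_row(1)[of i A] by (simp add: row_def vec_eq_iff)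
next
  case (3 A)
  note diagonal_hyps = "3.hyps" and diagonal_prems = "3.prems"
  have dA: "det A = (\<Prod>i\<in>UNIV. A $ i $ i)" using diagonal_hyps by (rule det_diagonal)
  define c where "c b = b \<bullet> (A *v b)" for b
  have cax: "c (axis i 1) = A $ i $ i" for i
    by (simp add: c_def inner_axis' matrix_vector_mult_basis column_def inner_axis)
  have "(\<Prod>b\<in>Basis. \<bar>c b\<bar>) = (\<Prod>b\<in>range (\<lambda>i::'n. axis i 1). \<bar>c b\<bar>)"
    by (rule prod.cong) (auto simp: Basis_vec_def)
  also have "\<dots> = (\<Prod>i\<in>UNIV. \<bar>A $ i $ i\<bar>)"
    by (subst prod.reindex) (auto simp: inj_on_def axis_eq_axis cax)
  finally have pc: "(\<Prod>b\<in>Basis. \<bar>c b\<bar>) = \<bar>det A\<bar>" by (simp add: dA abs_prod)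
  have cnz: "c b \<noteq> 0" if "b \<in> Basis" for b
    using that diagonal_prems(1) dA cax by (auto simp: Basis_vec_def)
  have Ax: "(0 + (\<Sum>b\<in>Basis. (c b * (x \<bullet> b)) *\<^sub>R b)) = A *v x" for x
  proof -
    have "(\<Sum>b\<in>Basis. (c b * (x \<bullet> b)) *\<^sub>R b) = (\<Sum>b\<in>range (\<lambda>i::'n. axis i 1). (c b * (x \<bullet> b)) *\<^sub>R b)"
      by (rule sum.cong) (auto simp: Basis_vec_def)
    also have "\<dots> = (\<Sum>i\<in>UNIV. (A $ i $ i * x $ i) *\<^sub>R axis i 1)"
      by (subst sum.reindex) (auto simp: inj_on_def axis_eq_axis cax inner_axis)
    also have "\<dots> = A *v x"
    proof (subst vec_eq_iff, rule allI)
      fix j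
      have "(A *v x) $ j = (\<Sum>i\<in>UNIV. if i = j then A $ j $ i * x $ i else 0)"
        unfolding matrix_vector_mult_def by (subst vec_lambda_beta, rule sum.cong) (use diagonal_hyps in auto)
      then show "(\<Sum>i\<in>UNIV. (A $ i $ i * x $ i) *\<^sub>R axis i 1) $ j = (A *v x) $ j"
        by (simp add: axis_def if_distrib cong: if_cong)
    qed
    finally show ?thesis by simp
  qed
  have "(\<integral>\<^sup>+x. f x \<partial>lborel) = (\<integral>\<^sup>+x. f x \<partial>density (distr lborel borel (\<lambda>x. A *v x)) (\<lambda>_. ennreal \<bar>det A\<bar>))"
    using lborel_affine_euclidean[of c 0] cnz unfolding Ax pc by simp
  also have "\<dots> = (\<integral>\<^sup>+x. ennreal \<bar>det A\<bar> * f x \<partial>distr lborel borel (\<lambda>x. A *v x))"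
    by (rule nn_integral_density) (use diagonal_prems in auto)
  also have "\<dots> = (\<integral>\<^sup>+x. ennreal \<bar>det A\<bar> * f (A *v x) \<partial>lborel)"
    by (rule nn_integral_distr) (use diagonal_prems in \<open>auto intro!: borel_measurable_continuous_onI matrix_vector_mult_linear_continuous_on\<close>)
  also have "\<dots> = ennreal \<bar>det A\<bar> * (\<integral>\<^sup>+x. f (A *v x) \<partial>lborel)"
    by (rule nn_integral_cmult, rule measurable_compose[OF _ diagonal_prems(2)])
      (auto intro!: borel_measurable_continuous_onI matrix_vector_mult_linear_continuous_on)
  finally show ?case .
next
  case (4 m n)
  note swap1_hyps = "4.hyps" and swap1_prems = "4.prems"
  let ?P = "\<chi> i j. mat 1 $ i $ Transposition.transpose m n j :: real^'n^'n"
  have P: "?P *v x = (\<chi> i. x $ Transposition.transpose m n i)" for x :: "real^'n"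
  proof (subst vec_eq_iff, rule allI)
    fix i
    have "(?P *v x) $ i = (\<Sum>j\<in>UNIV. if j = Transposition.transpose m n i then x $ j else 0)"
      unfolding matrix_vector_mult_def
      by (subst vec_lambda_beta, rule sum.cong) (auto simp: mat_def)
    then show "(?P *v x) $ i = (\<chi> i. x $ Transposition.transpose m n i) $ i" by simp
  qed
  have "\<bar>det ?P\<bar> = 1"
  proof -
    have "det ?P = of_int (sign (Transposition.transpose m n)) * det (mat 1 :: real^'n^'n)"
      by (rule det_permute_columns) (simp add: permutes_swap_id)
    then show ?thesis using swap1_hyps by (simp add: sign_swap_id)
  qed
  then show ?case
    using nn_integral_permute_coords[OF _ swap1_prems(2), of "Transposition.transpose m n"]
    by (simp add: P)
next
  case (5 m n c)
  note idplus_hyps = "5.hyps" and idplus_prems = "5.prems"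
  let ?P = "\<chi> i j. if i = m \<and> j = n then c else of_bool (i = j) :: real^'n^'n"
  have P: "?P *v x = x + (c * (x \<bullet> axis n 1)) *\<^sub>R axis m 1" for x :: "real^'n"
  proof (subst vec_eq_iff, rule allI)
    fix i
    have "(?P *v x) $ i = (\<Sum>j\<in>UNIV. (if j = i then x $ j else 0) + (if j = n then (if i = m then c * x $ n else 0) else 0))"
      unfolding matrix_vector_mult_def
      by (subst vec_lambda_beta, rule sum.cong) (use idplus_hyps in auto)
    also have "\<dots> = x $ i + (if i = m then c * x $ n else 0)" unfolding sum.distrib by simp
    finally show "(?P *v x) $ i = (x + (c * (x \<bullet> axis n 1)) *\<^sub>R axis m 1) $ i"
      unfolding inner_axis by (simp add: axis_def)
  qed
  have "det ?P = 1"
  proof -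
    have "det ?P = det (\<chi> k. if k = m then row m (mat 1 :: real^'n^'n) + c *s row n (mat 1) else row k (mat 1))"
      by (rule arg_cong[where f = det])
        (use idplus_hyps in \<open>auto simp: vec_eq_iff mat_def row_def\<close>)
    also have "\<dots> = 1" using idplus_hyps by (subst det_row_operation) auto
    finally show ?thesis .
  qed
  then show ?case
    using nn_integral_shear[of "axis m 1" "axis n 1" f c] idplus_hyps idplus_prems
    by (simp add: P axis_eq_axis Basis_vec_def)
qed

theorem integral_matrix:
  fixes A :: "real^'n^'n" and f :: "real^'n \<Rightarrow> complex"
  assumes A: "det A \<noteq> 0" and f: "f \<in> borel_measurable borel"
  shows "(LINT x|lborel. f x) = of_real \<bar>det A\<bar> * (LINT x|lborel. f (A *v x))"
proof -
  have m[measurable]: "(\<lambda>x. A *v x) \<in> borel_measurable borel"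
    by (intro borel_measurable_continuous_onI matrix_vector_mult_linear_continuous_on)
  have eq: "lborel = density (distr lborel borel (\<lambda>x. A *v x)) (\<lambda>_. ennreal \<bar>det A\<bar>)" (is "_ = ?M")
  proof (rule measure_eqI)
    fix X :: "(real^'n) set" assume "X \<in> sets lborel"
    then have [measurable]: "X \<in> sets borel" by simp
    have "emeasure lborel X = (\<integral>\<^sup>+x. indicator X x \<partial>lborel)" by simp
    also have "\<dots> = ennreal \<bar>det A\<bar> * (\<integral>\<^sup>+x. indicator X (A *v x) \<partial>lborel)"
      by (rule nn_integral_matrix[OF A]) measurable
    also have "\<dots> = ennreal \<bar>det A\<bar> * (\<integral>\<^sup>+x. indicator X x \<partial>distr lborel borel (\<lambda>x. A *v x))"
      by (subst nn_integral_distr) auto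
    also have "\<dots> = emeasure ?M X"
      by (subst emeasure_density) (auto simp: nn_integral_cmult)
    finally show "emeasure lborel X = emeasure ?M X" .
  qed simp
  have "(LINT x|lborel. f x) = (LINT x|?M. f x)" using eq by simp
  also have "\<dots> = (LINT x|distr lborel borel (\<lambda>x. A *v x). \<bar>det A\<bar> *\<^sub>R f x)"
    by (rule integral_density) (use f in auto)
  also have "\<dots> = (LINT x|lborel. \<bar>det A\<bar> *\<^sub>R f (A *v x))"
    by (rule integral_distr) (use f in auto)
  finally show ?thesis by (simp add: scaleR_conv_of_real)
qed

section \<open>Continuous functionals commute with integration over a parameter\<close>

text \<open>Membership in \<open>tempered\<close> without the extensionality condition, which composition with operators
would destroy.\<close>

definition schwartz_functional :: "(('a::euclidean_space \<Rightarrow> complex) \<Rightarrow> complex) \<Rightarrow> bool" where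
  "schwartz_functional T \<longleftrightarrow>
     (\<forall>\<phi>\<in>schwartz. \<forall>\<psi>\<in>schwartz. T (\<lambda>x. \<phi> x + \<psi> x) = T \<phi> + T \<psi>) \<and>
     (\<forall>c. \<forall>\<phi>\<in>schwartz. T (\<lambda>x. c * \<phi> x) = c * T \<phi>) \<and>
     (\<exists>C N. \<forall>\<phi>\<in>schwartz. norm (T \<phi>) \<le> C * schwartz_norm N \<phi>)"

lemma tempered_iff: "T \<in> tempered \<longleftrightarrow> T \<in> extensional schwartz \<and> schwartz_functional T"
  unfolding tempered_def schwartz_functional_def by auto

lemma functional_add:
  "schwartz_functional T \<Longrightarrow> \<phi> \<in> schwartz \<Longrightarrow> \<psi> \<in> schwartz \<Longrightarrow> T (\<lambda>x. \<phi> x + \<psi> x) = T \<phi> + T \<psi>"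
  unfolding schwartz_functional_def by blast

lemma functional_scale:
  "schwartz_functional T \<Longrightarrow> \<phi> \<in> schwartz \<Longrightarrow> T (\<lambda>x. c * \<phi> x) = c * T \<phi>"
  unfolding schwartz_functional_def by blast

lemma functional_diff:
  assumes "schwartz_functional T" "\<phi> \<in> schwartz" "\<psi> \<in> schwartz"
  shows "T (\<lambda>x. \<phi> x - \<psi> x) = T \<phi> - T \<psi>"
  using functional_add[OF assms(1,2) schwartz_scale[OF assms(3), of "-1"]]
    functional_scale[OF assms(1,3), of "-1"] by simp

lemma functional_sum:
  assumes "schwartz_functional T" "finite I" "\<And>i. i \<in> I \<Longrightarrow> f i \<in> schwartz"
  shows "T (\<lambda>x. \<Sum>i\<in>I. f i x) = (\<Sum>i\<in>I. T (f i))"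
  using assms(2,3)
proof (induction I rule: finite_induct)
  case empty
  show ?case using functional_scale[OF assms(1) schwartz_zero, of 0] by simp
next
  case (insert i I)
  then have "T (\<lambda>x. f i x + (\<Sum>i\<in>I. f i x)) = T (f i) + T (\<lambda>x. \<Sum>i\<in>I. f i x)"
    by (intro functional_add[OF assms(1)] schwartz_sum) auto
  then show ?case using insert by simp
qed

lemma functional_bound:
  assumes "schwartz_functional T"
  obtains C N where "0 \<le> C" "\<And>\<phi>. \<phi> \<in> schwartz \<Longrightarrow> norm (T \<phi>) \<le> C * schwartz_norm N \<phi>"
proof -
  obtain C N where C: "\<And>\<phi>. \<phi> \<in> schwartz \<Longrightarrow> norm (T \<phi>) \<le> C * schwartz_norm N \<phi>"
    using assms unfolding schwartz_functional_def by blast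
  have "norm (T \<phi>) \<le> max C 0 * schwartz_norm N \<phi>" if "\<phi> \<in> schwartz" for \<phi>
    by (rule order_trans[OF C[OF that] mult_right_mono[OF _ schwartz_norm_nonneg[OF that]]]) simp
  then show thesis by (intro that[of "max C 0"]) auto
qed

lemma functional_comp:
  assumes T: "schwartz_functional T" and A: "cont_op A"
    and add: "\<And>\<phi> \<psi>. \<phi> \<in> schwartz \<Longrightarrow> \<psi> \<in> schwartz \<Longrightarrow> A (\<lambda>x. \<phi> x + \<psi> x) = (\<lambda>x. A \<phi> x + A \<psi> x)"
    and scale: "\<And>c \<phi>. \<phi> \<in> schwartz \<Longrightarrow> A (\<lambda>x. c * \<phi> x) = (\<lambda>x. c * A \<phi> x)"
  shows "schwartz_functional (\<lambda>\<phi>. T (A \<phi>))"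
proof -
  obtain C N where C: "0 \<le> C" "\<And>\<phi>. \<phi> \<in> schwartz \<Longrightarrow> norm (T \<phi>) \<le> C * schwartz_norm N \<phi>"
    using functional_bound[OF T] by metis
  obtain D M where D: "\<And>f. f \<in> schwartz \<Longrightarrow> schwartz_norm N (A f) \<le> D * schwartz_norm M f"
    using A unfolding cont_op_def by metis
  have "norm (T (A \<phi>)) \<le> C * D * schwartz_norm M \<phi>" if \<phi>: "\<phi> \<in> schwartz" for \<phi>
    using order_trans[OF C(2)[OF cont_op_schwartz[OF A \<phi>]] mult_left_mono[OF D[OF \<phi>] C(1)]]
    by (simp add: mult.assoc)
  then show ?thesis
    unfolding schwartz_functional_def
    using functional_add[OF T] functional_scale[OF T] cont_op_schwartz[OF A] add scale by auto
qed

lemma functional_minus: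
  assumes S: "schwartz_functional S" and T: "schwartz_functional T"
  shows "schwartz_functional (\<lambda>\<phi>. S \<phi> - T \<phi>)"
proof -
  obtain C N where C: "0 \<le> C" "\<And>\<phi>. \<phi> \<in> schwartz \<Longrightarrow> norm (S \<phi>) \<le> C * schwartz_norm N \<phi>"
    using functional_bound[OF S] by metis
  obtain D M where D: "0 \<le> D" "\<And>\<phi>. \<phi> \<in> schwartz \<Longrightarrow> norm (T \<phi>) \<le> D * schwartz_norm M \<phi>"
    using functional_bound[OF T] by metis
  have "norm (S \<phi> - T \<phi>) \<le> (C + D) * schwartz_norm (max N M) \<phi>" if \<phi>: "\<phi> \<in> schwartz" for \<phi>
  proof -
    have m: "schwartz_norm N \<phi> \<le> schwartz_norm (max N M) \<phi>" "schwartz_norm M \<phi> \<le> schwartz_norm (max N M) \<phi>"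
      using graded_norm_schwartz \<phi> unfolding graded_norm_def mono_def by auto
    have "norm (S \<phi>) + norm (T \<phi>) \<le> C * schwartz_norm (max N M) \<phi> + D * schwartz_norm (max N M) \<phi>"
      by (intro add_mono order_trans[OF C(2)[OF \<phi>]] order_trans[OF D(2)[OF \<phi>]] mult_left_mono m C D)
    then show ?thesis using norm_triangle_ineq4[of "S \<phi>" "T \<phi>"] by (simp add: distrib_right)
  qed
  then show ?thesis
    unfolding schwartz_functional_def
    using functional_add[OF S] functional_add[OF T] functional_scale[OF S] functional_scale[OF T]
    by (auto simp: right_diff_distrib)
qed

text \<open>Integration over the fibre is the partial Fourier transform at frequency \<open>0\<close>, and so inherits its
properties.\<close>

definition marginal :: "('a::euclidean_space \<times> 'b::euclidean_space \<Rightarrow> complex) \<Rightarrow> 'a \<Rightarrow> complex" where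
  "marginal H u = (LINT z|lborel. H (u, z))"

lemma marginal_partial_fourier: "marginal H = (\<lambda>u. partial_fourier H (u, 0))"
  by (simp add: fun_eq_iff marginal_def partial_fourier_def fourier_def)

lemma schwartz_marginal: "H \<in> schwartz \<Longrightarrow> marginal H \<in> schwartz"
  unfolding marginal_partial_fourier by (intro schwartz_section schwartz_partial_fourier)

lemma partial_deriv_marginal:
  assumes "H \<in> schwartz" "b \<in> Basis"
  shows "partial_deriv b (marginal H) = marginal (partial_deriv (b, 0) H)"
  unfolding marginal_partial_fourier
  by (rule ext, subst partial_deriv_section[OF schwartz_partial_fourier[OF assms(1)]])
    (simp add: partial_fourier_partial_fst[OF assms])

lemma schwartz_iter: "f \<in> schwartz \<Longrightarrow> set vs \<subseteq> Basis \<Longrightarrow> iter_partial vs f \<in> schwartz"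
  by (rule schwartz_weyl[OF weyl_iter])

lemma lift_Basis: "set vs \<subseteq> Basis \<Longrightarrow> set (map (\<lambda>b. (b, 0)) vs) \<subseteq> Basis"
  by (auto simp: Basis_prod_def)

lemma iter_partial_marginal:
  assumes "H \<in> schwartz" "set vs \<subseteq> Basis"
  shows "iter_partial vs (marginal H) = marginal (iter_partial (map (\<lambda>b. (b, 0)) vs) H)"
  using assms(2)
proof (induction vs)
  case (Cons v vs)
  then have "iter_partial (v # vs) (marginal H) = partial_deriv v (marginal (iter_partial (map (\<lambda>b. (b, 0)) vs) H))"
    by simp
  also have "\<dots> = marginal (partial_deriv (v, 0) (iter_partial (map (\<lambda>b. (b, 0)) vs) H))"
    using Cons.prems by (intro partial_deriv_marginal schwartz_iter[OF assms(1) lift_Basis]) auto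
  finally show ?case by simp
qed simp

lemma iter_partial_sum:
  assumes "finite I" "\<And>i. i \<in> I \<Longrightarrow> f i \<in> schwartz" "set vs \<subseteq> Basis"
  shows "iter_partial vs (\<lambda>x. \<Sum>i\<in>I. f i x) = (\<lambda>x. \<Sum>i\<in>I. iter_partial vs (f i) x)"
  using assms(1,2)
proof (induction I rule: finite_induct)
  case empty
  show ?case using iter_partial_scale[OF schwartz_zero assms(3), of 0] by simp
next
  case (insert i I)
  then show ?case
    using iter_partial_add[OF _ schwartz_sum assms(3), of "f i" I f] by simp
qed

lemma iter_partial_diff:
  assumes "f \<in> schwartz" "g \<in> schwartz" "set vs \<subseteq> Basis"
  shows "iter_partial vs (\<lambda>x. f x - g x) = (\<lambda>x. iter_partial vs f x - iter_partial vs g x)"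
  using iter_partial_add[OF assms(1) schwartz_scale[OF assms(2)] assms(3), of "-1"]
    iter_partial_scale[OF assms(2,3), of "-1"] by simp

lemma onorm_partial_le:
  fixes f :: "'a::euclidean_space \<Rightarrow> complex"
  assumes "\<And>b. b \<in> Basis \<Longrightarrow> norm (partial_deriv b f x) \<le> B b"
  shows "onorm (\<lambda>h. \<Sum>b\<in>Basis. (h \<bullet> b) *\<^sub>R partial_deriv b f x) \<le> (\<Sum>b\<in>Basis. B b)"
proof (rule onorm_bound)
  show "0 \<le> (\<Sum>b\<in>Basis. B b)"
    by (intro sum_nonneg order_trans[OF norm_ge_zero assms])
  show "norm (\<Sum>b\<in>Basis. (h \<bullet> b) *\<^sub>R partial_deriv b f x) \<le> (\<Sum>b\<in>Basis. B b) * norm h" for h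
    unfolding sum_distrib_right
    by (intro sum_norm_le) (auto simp: mult.commute[of _ "norm h"] intro!: mult_mono assms Basis_le_norm)
qed

lemma decay_le_1: "decay x \<le> 1"
  unfolding decay_def by (simp add: inverse_le_1_iff one_le_power)

text \<open>The partial derivatives in the second variable, multiplied by \<open>(1 + norm u) ^ N\<close>, are bounded uniformly
in both variables, and the mean value inequality transports this to increments.\<close>

lemma schwartz_uniform_Lipschitz_snd:
  fixes H :: "'a::euclidean_space \<times> 'b::euclidean_space \<Rightarrow> complex"
  assumes H: "H \<in> schwartz"
  shows "\<exists>L. 0 \<le> L \<and> (\<forall>u z z'. (1 + norm u) ^ N * norm (H (u, z) - H (u, z')) \<le> L * norm (z - z'))"
proof -
  have "\<exists>C. 0 \<le> C \<and> (\<forall>u z. (1 + norm u) ^ N * norm (partial_deriv (0, b) H (u, z)) \<le> C)" if "b \<in> Basis" for b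
  proof -
    have "(0, b) \<in> (Basis :: ('a \<times> 'b) set)" using that by (simp add: Basis_prod_def)
    from schwartz_decay_snd[OF schwartz_partial[OF H this], of N 0]
    obtain C where C: "0 \<le> C" "\<And>u z. (1 + norm u) ^ N * norm (partial_deriv (0, b) H (u, z)) \<le> C * decay z"
      by auto
    have "C * decay z \<le> C" for z :: 'b using mult_left_mono[OF decay_le_1 C(1), of z] by simp
    then show ?thesis using C order_trans by blast
  qed
  then obtain C where C: "\<And>b. b \<in> Basis \<Longrightarrow> 0 \<le> C b"
    "\<And>b u z. b \<in> Basis \<Longrightarrow> (1 + norm u) ^ N * norm (partial_deriv (0, b) H (u, z)) \<le> C b" by metis
  have "(1 + norm u) ^ N * norm (H (u, z) - H (u, z')) \<le> (\<Sum>b\<in>Basis. C b) * norm (z - z')" for u z z'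
  proof -
    let ?w = "(1 + norm u) ^ N"
    have w: "0 < ?w" by (simp add: add_pos_nonneg)
    have "norm (H (u, z) - H (u, z')) \<le> (\<Sum>b\<in>Basis. C b / ?w) * norm (z - z')"
    proof (rule differentiable_bound[where S = UNIV])
      show "((\<lambda>z. H (u, z)) has_derivative
          (\<lambda>h. \<Sum>b\<in>Basis. (h \<bullet> b) *\<^sub>R partial_deriv b (\<lambda>z. H (u, z)) z)) (at z within UNIV)" for z
        using partial_deriv_has_derivative[OF schwartz_section2[OF H]] by simp
      show "onorm (\<lambda>h. \<Sum>b\<in>Basis. (h \<bullet> b) *\<^sub>R partial_deriv b (\<lambda>z. H (u, z)) z) \<le> (\<Sum>b\<in>Basis. C b / ?w)" for z
        using C(2)[of _ u z] w
        by (intro onorm_partial_le) (simp add: partial_deriv_section2[OF H] pos_le_divide_eq mult.commute)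
    qed auto
    then show ?thesis using w by (simp add: sum_divide_distrib[symmetric] field_simps)
  qed
  moreover have "0 \<le> (\<Sum>b\<in>Basis. C b)" by (intro sum_nonneg C)
  ultimately show ?thesis by blast
qed

lemma decay_tail:
  assumes e: "0 < e"
  shows "\<exists>a. (LINT z|lborel. indicator (- cbox (- a) a) z * decay (z :: 'b::euclidean_space)) < e"
proof -
  let ?s = "\<lambda>n z. indicator (- cbox (- (real n *\<^sub>R One)) (real n *\<^sub>R One)) z * decay (z :: 'b)"
  have "(\<lambda>n. LINT z|lborel. ?s n z) \<longlonglongrightarrow> (LINT z::'b|lborel. (0 :: real))"
  proof (rule integral_dominated_convergence[OF _ _ decay_integrable])
    show "AE z in lborel. (\<lambda>n. ?s n z) \<longlonglongrightarrow> 0"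
    proof (rule AE_I2, rule tendsto_eventually)
      fix z :: 'b
      obtain n0 :: nat where n0: "norm z \<le> real n0" using real_arch_simple by blast
      have "z \<in> cbox (- (real n *\<^sub>R One)) (real n *\<^sub>R One)" if "n0 \<le> n" for n
        unfolding mem_box
      proof
        fix b :: 'b assume b: "b \<in> Basis"
        have "\<bar>z \<bullet> b\<bar> \<le> real n" using Basis_le_norm[OF b, of z] n0 that by linarith
        then show "- (real n *\<^sub>R One) \<bullet> b \<le> z \<bullet> b \<and> z \<bullet> b \<le> real n *\<^sub>R One \<bullet> b"
          using b by auto
      qed
      then show "\<forall>\<^sub>F n in sequentially. ?s n z = 0"
        by (intro eventually_sequentiallyI[of n0]) (simp add: indicator_def)
    qed
    show "AE z in lborel. norm (?s n z) \<le> decay z" for n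
      by (intro AE_I2) (auto simp: indicator_def less_imp_le[OF decay_pos])
  qed (auto intro!: borel_measurable_times borel_measurable_indicator)
  then have "\<forall>\<^sub>F n in sequentially. (LINT z|lborel. ?s n z) < e"
    using e by (intro order_tendstoD) auto
  then show ?thesis unfolding eventually_sequentially by blast
qed

text \<open>One set of sample points serves all of the finitely many functions and all \<open>u\<close> simultaneously, with
an error measured in the weight of the Schwartz norms. Outside a large box the integral is small by
integrability of \<open>decay\<close>; inside it the weighted Lipschitz bound controls a fine tagged division.\<close>

lemma uniform_Riemann_sum:
  fixes \<F> :: "('a::euclidean_space \<times> 'b::euclidean_space \<Rightarrow> complex) set"
  assumes fin: "finite \<F>" and S: "\<F> \<subseteq> schwartz" and e: "0 < e"
  shows "\<exists>p :: ('b \<times> 'b set) set. finite p \<and> (\<forall>H\<in>\<F>. \<forall>u. (1 + norm u) ^ N *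
    norm (marginal H u - (\<Sum>(z, k)\<in>p. complex_of_real (measure lborel k) * H (u, z))) \<le> e)"
proof -
  have "\<forall>H\<in>\<F>. \<exists>A L. 0 \<le> A \<and> 0 \<le> L \<and> (\<forall>u z. (1 + norm u) ^ N * norm (H (u, z)) \<le> A * decay z) \<and>
      (\<forall>u z z'. (1 + norm u) ^ N * norm (H (u, z) - H (u, z')) \<le> L * norm (z - z'))"
    using schwartz_decay_snd[of _ N 0] schwartz_uniform_Lipschitz_snd[of _ N] S by (simp add: subset_iff) blast
  then obtain A0 L0 where 0: "\<And>H. H \<in> \<F> \<Longrightarrow> 0 \<le> A0 H \<and> 0 \<le> L0 H"
    "\<And>H u z. H \<in> \<F> \<Longrightarrow> (1 + norm u) ^ N * norm (H (u, z)) \<le> A0 H * decay z"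
    "\<And>H u z z'. H \<in> \<F> \<Longrightarrow> (1 + norm u) ^ N * norm (H (u, z) - H (u, z')) \<le> L0 H * norm (z - z')"
    by metis
  \<comment> \<open>Common constants for all functions; adding 1 keeps them positive for the divisions below.\<close>
  define A where "A = (\<Sum>H\<in>\<F>. A0 H) + 1"
  define L where "L = (\<Sum>H\<in>\<F>. L0 H) + 1"
  have AL: "0 < A" "0 < L" unfolding A_def L_def using 0(1) by (auto intro!: add_nonneg_pos sum_nonneg)
  have "A0 H \<le> A" "L0 H \<le> L" if "H \<in> \<F>" for H
    using member_le_sum[OF that _ fin, of A0] member_le_sum[OF that _ fin, of L0] 0(1) unfolding A_def L_def by force+
  then have A: "(1 + norm u) ^ N * norm (H (u, z)) \<le> A * decay z"
    and L: "(1 + norm u) ^ N * norm (H (u, z) - H (u, z')) \<le> L * norm (z - z')" if "H \<in> \<F>" for H u z z'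
    using 0(2,3)[OF that] that
    by (meson order_trans mult_right_mono less_imp_le decay_pos norm_ge_zero)+
  obtain a :: 'b where a: "(LINT z|lborel. indicator (- cbox (- a) a) z * decay z) < e / (2 * A)"
    using decay_tail[of "e / (2 * A)"] e AL by auto
  let ?B = "cbox (- a) a"
  define c where "c = measure lborel ?B + 1"
  have c: "0 < c" unfolding c_def by (simp add: add_nonneg_pos)
  \<comment> \<open>This mesh makes the error inside the box at most half of the tolerance.\<close>
  define \<delta> where "\<delta> = e / (2 * L * c)"
  have \<delta>: "0 < \<delta>" unfolding \<delta>_def using e AL c by simp
  obtain p where p: "p tagged_division_of ?B" "(\<lambda>z. ball z \<delta>) fine p"
    using fine_division_exists[OF gauge_ball[OF \<delta>]] by blast
  have finp: "finite p" using p(1) by (rule tagged_division_of_finite)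
  have "(1 + norm u) ^ N * norm (marginal H u - (\<Sum>(z, k)\<in>p. complex_of_real (measure lborel k) * H (u, z))) \<le> e"
    if H: "H \<in> \<F>" for H u
  proof -
    let ?R = "\<Sum>(z, k)\<in>p. complex_of_real (measure lborel k) * H (u, z)"
    let ?w = "(1 + norm u) ^ N"
    have w: "0 < ?w" by (simp add: add_pos_nonneg)
    have HS: "H \<in> schwartz" using H S by blast
    define h where "h z = H (u, z)" for z
    have hS: "h \<in> schwartz" unfolding h_def[abs_def] by (rule schwartz_section2[OF HS])
    note hm[measurable] = schwartz_measurable[OF hS]
    have hc: "continuous_on X h" for X by (rule schwartz_continuous[OF hS])
    have hi: "h integrable_on cbox l r" for l r by (rule integrable_continuous[OF hc])
    have int: "integrable lborel h" by (rule schwartz_integrable[OF hS])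
    have setint: "set_integrable lborel X h" if "X \<in> sets borel" for X
      unfolding set_integrable_def by (rule integrable_mult_indicator[OF _ int]) (use that in simp)
    have split: "marginal H u = (LINT z|lborel. indicator (- ?B) z *\<^sub>R h z) + integral ?B h"
    proof -
      have "marginal H u = (LINT z|lborel. indicator (- ?B) z *\<^sub>R h z + indicator ?B z *\<^sub>R h z)"
        unfolding marginal_def h_def[symmetric]
        by (intro Bochner_Integration.integral_cong) (auto simp: indicator_def)
      also have "\<dots> = (LINT z|lborel. indicator (- ?B) z *\<^sub>R h z) + (LINT z|lborel. indicator ?B z *\<^sub>R h z)"
        by (rule Bochner_Integration.integral_add) (use setint in \<open>auto simp: set_integrable_def\<close>)
      also have "(LINT z|lborel. indicator ?B z *\<^sub>R h z) = integral ?B h"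
        using set_borel_integral_eq_integral(2)[OF setint, of ?B] by (simp add: set_lebesgue_integral_def)
      finally show ?thesis .
    qed
    have tail: "?w * norm (LINT z|lborel. indicator (- ?B) z *\<^sub>R h z) \<le> e / 2"
    proof -
      have "norm (LINT z|lborel. indicator (- ?B) z *\<^sub>R h z) \<le> (LINT z|lborel. (A / ?w) * (indicator (- ?B) z * decay z))"
      proof (rule Bochner_Integration.integral_norm_bound_integral)
        show "integrable lborel (\<lambda>z. indicator (- ?B) z *\<^sub>R h z)"
          using setint[of "- ?B"] by (simp add: set_integrable_def)
        have "integrable lborel (\<lambda>z. indicator (- ?B) z *\<^sub>R decay z)"
          by (rule integrable_mult_indicator[OF _ decay_integrable]) simp
        then show "integrable lborel (\<lambda>z. (A / ?w) * (indicator (- ?B) z * decay z))"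
          by (intro integrable_mult_right) simp
        show "norm (indicator (- ?B) z *\<^sub>R h z) \<le> (A / ?w) * (indicator (- ?B) z * decay z)" for z
          using A[OF H, of u z] w by (auto simp: h_def indicator_def field_simps)
      qed
      also have "\<dots> = (A / ?w) * (LINT z|lborel. indicator (- ?B) z * decay z)" by simp
      also have "\<dots> \<le> (A / ?w) * (e / (2 * A))"
        using a AL w by (intro mult_left_mono) auto
      finally show ?thesis using AL w by (simp add: field_simps)
    qed
    have sum: "?w * norm (integral ?B h - ?R) \<le> e / 2"
    proof -
      have I: "integral ?B h = (\<Sum>(z, k)\<in>p. integral k h)"
        by (rule integral_combine_tagged_division_topdown[OF hi p(1)])
      have each: "norm (integral k h - complex_of_real (measure lborel k) * H (u, z)) \<le> (L * \<delta> / ?w) * measure lborel k"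
        if zk: "(z, k) \<in> p" for z k
      proof -
        obtain l r where k: "k = cbox l r" using tagged_division_ofD(4)[OF p(1) zk] by blast
        have "integral k (\<lambda>y. h y - h z) = integral k h - complex_of_real (measure lborel k) * H (u, z)"
          unfolding k using hi[of l r]
          by (subst Henstock_Kurzweil_Integration.integral_diff) (auto simp: h_def scaleR_conv_of_real)
        moreover have "norm (integral (cbox l r) (\<lambda>y. h y - h z)) \<le> (L * \<delta> / ?w) * measure lborel (cbox l r)"
        proof (rule has_integral_bound[OF _ integrable_integral])
          show "0 \<le> L * \<delta> / ?w" using AL \<delta> w by simp
          show "(\<lambda>y. h y - h z) integrable_on cbox l r"
            by (intro integrable_continuous continuous_intros hc)
          fix y assume "y \<in> cbox l r"
          then have "norm (y - z) \<le> \<delta>"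
            using fineD[OF p(2) zk] k by (auto simp: dist_norm norm_minus_commute)
          then have "L * norm (y - z) \<le> L * \<delta>" using AL by simp
          then show "norm (h y - h z) \<le> L * \<delta> / ?w"
            using order_trans[OF L[OF H, of u y z]] w by (simp add: h_def field_simps)
        qed
        ultimately show ?thesis using k by simp
      qed
      have "integral ?B h - ?R =
          (\<Sum>(z, k)\<in>p. integral k h - complex_of_real (measure lborel k) * H (u, z))"
        unfolding I by (simp add: sum_subtractf case_prod_unfold)
      also have "norm \<dots> \<le> (\<Sum>(z, k)\<in>p. (L * \<delta> / ?w) * measure lborel k)"
        by (rule sum_norm_le) (use each in auto)
      also have "\<dots> = (L * \<delta> / ?w) * measure lborel ?B"
        unfolding case_prod_unfold sum_distrib_left[symmetric]
        using additive_content_tagged_division[OF p(1)] by (simp add: case_prod_unfold)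
      also have "\<dots> \<le> (L * \<delta> / ?w) * c"
        using AL \<delta> w by (intro mult_left_mono) (auto simp: c_def)
      finally show ?thesis using w AL c by (simp add: \<delta>_def field_simps)
    qed
    have "norm (marginal H u - ?R) \<le>
      norm (LINT z|lborel. indicator (- ?B) z *\<^sub>R h z) +
      norm (integral ?B h - ?R)"
      unfolding split using norm_triangle_ineq by (simp add: add_diff_eq[symmetric] del: scaleR_conv_of_real)
    from mult_left_mono[OF this, of ?w] show ?thesis using w tail sum by (simp add: distrib_left)
  qed
  then show ?thesis using finp by blast
qed

lemma le_all_scale_imp_zero:
  fixes x :: complex assumes "\<And>e. 0 < e \<Longrightarrow> e \<le> 1 \<Longrightarrow> norm x \<le> K * (e :: real)"
  shows "x = 0"
proof (rule ccontr)
  assume "x \<noteq> 0"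
  then have x: "0 < norm x" by simp
  have "norm x \<le> K" using assms[of 1] by simp
  with x have K: "0 < K" by linarith
  let ?e = "min 1 (norm x / (2 * K))"
  have "norm x \<le> K * ?e" using x K by (intro assms) auto
  also have "\<dots> \<le> K * (norm x / (2 * K))" using K by (intro mult_left_mono) auto
  finally show False using x K by simp
qed

text \<open>The Riemann sums of \<open>z \<mapsto> H (_, z)\<close> are finite linear combinations of sections of \<open>H\<close>, which \<open>T\<close>
annihilates, and by \<open>uniform_Riemann_sum\<close>, applied to the finitely many derivatives of \<open>H\<close> that occur
in the norm bounding \<open>T\<close>, they converge to the marginal in that norm. This exchange of \<open>T\<close> with an
integral is carried out entirely inside the Schwartz space.\<close>

theorem functional_marginal_eq_0:
  fixes H :: "'a::euclidean_space \<times> 'b::euclidean_space \<Rightarrow> complex"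
  assumes T: "schwartz_functional T" and H: "H \<in> schwartz" and zero: "\<And>z. T (\<lambda>u. H (u, z)) = 0"
  shows "T (marginal H) = 0"
proof -
  obtain C N where C: "0 \<le> C" "\<And>\<phi>. \<phi> \<in> schwartz \<Longrightarrow> norm (T \<phi>) \<le> C * schwartz_norm N \<phi>"
    using functional_bound[OF T] by metis
  let ?V = "{vs :: 'a list. set vs \<subseteq> Basis \<and> length vs \<le> N}"
  let ?l = "\<lambda>vs. iter_partial (map (\<lambda>b. (b, 0)) vs) H"
  have "norm (T (marginal H)) \<le> (C * card ?V) * e" if e: "0 < e" for e
  proof -
    have "finite (?l ` ?V)" using finite_index_lists by blast
    moreover have "?l ` ?V \<subseteq> schwartz" using schwartz_iter[OF H lift_Basis] by blast
    ultimately obtain p :: "('b \<times> 'b set) set" where p: "finite p" and "\<forall>F\<in>?l ` ?V. \<forall>u. (1 + norm u) ^ N *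
      norm (marginal F u - (\<Sum>(z, k)\<in>p. complex_of_real (measure lborel k) * F (u, z))) \<le> e"
      using uniform_Riemann_sum[OF _ _ e, of "?l ` ?V" N] by meson
    then have approx: "(1 + norm u) ^ N *
      norm (marginal (?l vs) u - (\<Sum>(z, k)\<in>p. complex_of_real (measure lborel k) * ?l vs (u, z))) \<le> e"
      if "vs \<in> ?V" for vs u
      using that by auto
    define f where "f = (\<lambda>(zk :: 'b \<times> 'b set) u. complex_of_real (measure lborel (snd zk)) * H (u, fst zk))"
    have f: "f zk \<in> schwartz" for zk unfolding f_def by (intro schwartz_scale schwartz_section H)
    let ?R = "\<lambda>u. \<Sum>zk\<in>p. f zk u"
    have R: "?R \<in> schwartz" by (rule schwartz_sum[OF p f])
    have "T ?R = 0"
      unfolding functional_sum[OF T p f]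
      by (simp add: f_def functional_scale[OF T schwartz_section[OF H]] zero)
    then have "norm (T (marginal H)) = norm (T (\<lambda>u. marginal H u - ?R u))"
      by (simp add: functional_diff[OF T schwartz_marginal[OF H] R])
    also have "\<dots> \<le> C * schwartz_norm N (\<lambda>u. marginal H u - ?R u)"
      by (intro C schwartz_diff schwartz_marginal H R)
    also have "\<dots> \<le> C * (\<Sum>vs\<in>?V. e)"
    proof (intro mult_left_mono C schwartz_norm_le)
      fix vs :: "'a list" and u assume vs: "set vs \<subseteq> Basis" "length vs \<le> N"
      have "iter_partial vs ?R u = (\<Sum>(z, k)\<in>p. complex_of_real (measure lborel k) * ?l vs (u, z))"
      proof -
        have "iter_partial vs (f zk) u = complex_of_real (measure lborel (snd zk)) * ?l vs (u, fst zk)" for zk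
          unfolding f_def iter_partial_scale[OF schwartz_section[OF H] vs(1)] iter_partial_section[OF H vs(1)] ..
        then show ?thesis
          by (simp add: iter_partial_sum[OF p f vs(1)] case_prod_unfold)
      qed
      then show "(1 + norm u) ^ N * norm (iter_partial vs (\<lambda>u. marginal H u - ?R u) u) \<le> e"
        using approx[of vs u] vs
        by (simp add: iter_partial_diff[OF schwartz_marginal[OF H] R] iter_partial_marginal[OF H])
    qed
    finally show ?thesis by (simp add: mult_ac)
  qed
  then show ?thesis by (rule le_all_scale_imp_zero)
qed

section \<open>Density of the tensor products\<close>

text \<open>The average of translates of \<open>\<Phi>\<close> at scale \<open>e\<close> against the Gaussian. In this form the kernel does not
depend on \<open>e\<close>; a substitution turns it into a superposition of translates of a narrow Gaussian.\<close>

definition mollify :: "real \<Rightarrow> ('a::euclidean_space \<Rightarrow> complex) \<Rightarrow> 'a \<Rightarrow> complex" where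
  "mollify e \<Phi> u = (LINT v|lborel. \<Phi> (u - e *\<^sub>R v) * gauss v)"

lemma mollify_marginal:
  fixes \<Phi> :: "'a::euclidean_space \<Rightarrow> complex"
  assumes "\<Phi> \<in> schwartz"
  shows "(\<lambda>(u, v). \<Phi> (u - e *\<^sub>R v) * gauss v) \<in> schwartz"
    and "mollify e \<Phi> = marginal (\<lambda>(u, v). \<Phi> (u - e *\<^sub>R v) * gauss v)"
proof -
  have "(\<lambda>p. tensor \<Phi> gauss ((\<lambda>(u, v). (u - e *\<^sub>R v, v)) p)) \<in> schwartz"
    by (rule schwartz_linear[where L' = "\<lambda>(u, v). (u + e *\<^sub>R v, v)", OF _ _ _ schwartz_tensor[OF assms schwartz_gauss]])
      (auto simp: linear_iff algebra_simps)
  then show "(\<lambda>(u, v). \<Phi> (u - e *\<^sub>R v) * gauss v) \<in> schwartz"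
    by (simp add: tensor_def case_prod_unfold)
  show "mollify e \<Phi> = marginal (\<lambda>(u, v). \<Phi> (u - e *\<^sub>R v) * gauss v)"
    by (simp add: fun_eq_iff mollify_def marginal_def)
qed

lemma schwartz_mollify: "\<Phi> \<in> schwartz \<Longrightarrow> mollify e \<Phi> \<in> schwartz"
  unfolding mollify_marginal(2) by (intro schwartz_marginal mollify_marginal(1))

lemma partial_deriv_mollify:
  fixes \<Phi> :: "'a::euclidean_space \<Rightarrow> complex"
  assumes \<Phi>: "\<Phi> \<in> schwartz" and b: "b \<in> Basis"
  shows "partial_deriv b (mollify e \<Phi>) = mollify e (partial_deriv b \<Phi>)"
proof -
  let ?H = "\<lambda>(u, v). \<Phi> (u - e *\<^sub>R v) * gauss v"
  have "partial_deriv (b, 0) ?H (u, v) = partial_deriv b \<Phi> (u - e *\<^sub>R v) * gauss v" for u v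
  proof -
    have 1: "((\<lambda>u. u - e *\<^sub>R v) has_derivative (\<lambda>h. h)) (at u)" by (auto intro!: derivative_eq_intros)
    have "((\<lambda>u. \<Phi> (u - e *\<^sub>R v) * gauss v) has_derivative (\<lambda>h. frechet_derivative \<Phi> (at (u - e *\<^sub>R v)) h * gauss v)) (at u)"
      by (rule has_derivative_mult_left[OF has_derivative_compose[OF 1
        schwartz_differentiable[OF \<Phi>, unfolded frechet_derivative_works]]])
    from partial_derivI[OF this, of b] show ?thesis
      using partial_deriv_section[OF mollify_marginal(1)[OF \<Phi>], of b e v u] by (simp add: partial_deriv_def)
  qed
  then have "partial_deriv (b, 0) ?H = (\<lambda>(u, v). partial_deriv b \<Phi> (u - e *\<^sub>R v) * gauss v)"
    by (simp add: fun_eq_iff)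
  then show ?thesis
    unfolding mollify_marginal(2)[OF \<Phi>] mollify_marginal(2)[OF schwartz_partial[OF \<Phi> b]]
    by (simp add: partial_deriv_marginal[OF mollify_marginal(1)[OF \<Phi>] b])
qed

lemma iter_partial_mollify:
  assumes \<Phi>: "\<Phi> \<in> schwartz" and vs: "set vs \<subseteq> Basis"
  shows "iter_partial vs (mollify e \<Phi>) = mollify e (iter_partial vs \<Phi>)"
  using vs by (induction vs) (auto simp: partial_deriv_mollify schwartz_iter[OF \<Phi>])

text \<open>Mean value inequality on the ball of radius \<open>norm (e *\<^sub>R v)\<close> around \<open>u\<close>, where by Peetre's
inequality the decay of the derivatives is worse than at \<open>u\<close> by at most a power of \<open>1 + norm v\<close>.\<close>

lemma schwartz_increment:
  fixes \<Psi> :: "'a::euclidean_space \<Rightarrow> complex"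
  assumes \<Psi>: "\<Psi> \<in> schwartz"
  shows "\<exists>C. 0 \<le> C \<and> (\<forall>e u v. 0 < e \<longrightarrow> e \<le> 1 \<longrightarrow>
    (1 + norm u) ^ N * norm (\<Psi> (u - e *\<^sub>R v) - \<Psi> u) \<le> e * C * (1 + norm v) ^ Suc N)"
proof -
  have "\<exists>C. \<forall>x. (1 + norm x) ^ N * norm (partial_deriv b \<Psi> x) \<le> C" if "b \<in> Basis" for b
    using schwartz_iter_decay[OF \<Psi>, of "[b]" N] that by simp
  then obtain C where C: "\<And>b x. b \<in> Basis \<Longrightarrow> (1 + norm x) ^ N * norm (partial_deriv b \<Psi> x) \<le> C b" by metis
  have C0: "0 \<le> (\<Sum>b\<in>Basis. C b)"
    by (intro sum_nonneg order_trans[OF _ C[of _ 0]]) auto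
  have "(1 + norm u) ^ N * norm (\<Psi> (u - e *\<^sub>R v) - \<Psi> u) \<le> e * (\<Sum>b\<in>Basis. C b) * (1 + norm v) ^ Suc N"
    if e: "0 < e" "e \<le> 1" for e u v
  proof -
    let ?q = "(1 + norm v) ^ N / (1 + norm u) ^ N"
    have u: "0 < (1 + norm u) ^ N" by (simp add: add_pos_nonneg)
    have ev: "norm (e *\<^sub>R v) \<le> norm v" using e by (simp add: mult_left_le_one_le)
    have "norm (\<Psi> (u - e *\<^sub>R v) - \<Psi> u) \<le> (\<Sum>b\<in>Basis. C b * ?q) * norm ((u - e *\<^sub>R v) - u)"
    proof (rule differentiable_bound[where S = "cball u (norm (e *\<^sub>R v))"])
      show "(\<Psi> has_derivative (\<lambda>h. \<Sum>b\<in>Basis. (h \<bullet> b) *\<^sub>R partial_deriv b \<Psi> x)) (at x within cball u (norm (e *\<^sub>R v)))" for x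
        by (rule has_derivative_at_withinI[OF partial_deriv_has_derivative[OF \<Psi>]])
      fix x assume "x \<in> cball u (norm (e *\<^sub>R v))"
      then have x: "norm (x - u) \<le> norm v" using ev by (simp add: dist_norm norm_minus_commute)
      have "1 + norm u \<le> (1 + norm (u + (x - u))) * (1 + norm (x - u))" by (rule norm_shift_le)
      also have "\<dots> \<le> (1 + norm x) * (1 + norm v)" using x by (intro mult_mono) auto
      finally have xu: "(1 + norm u) ^ N \<le> (1 + norm x) ^ N * (1 + norm v) ^ N"
        unfolding power_mult_distrib[symmetric] by (intro power_mono) auto
      show "onorm (\<lambda>h. \<Sum>b\<in>Basis. (h \<bullet> b) *\<^sub>R partial_deriv b \<Psi> x) \<le> (\<Sum>b\<in>Basis. C b * ?q)"
      proof (rule onorm_partial_le)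
        fix b :: 'a assume b: "b \<in> Basis"
        have "(1 + norm u) ^ N * norm (partial_deriv b \<Psi> x) \<le>
            ((1 + norm x) ^ N * (1 + norm v) ^ N) * norm (partial_deriv b \<Psi> x)"
          by (intro mult_right_mono xu) auto
        also have "\<dots> = ((1 + norm x) ^ N * norm (partial_deriv b \<Psi> x)) * (1 + norm v) ^ N" by simp
        also have "\<dots> \<le> C b * (1 + norm v) ^ N" by (intro mult_right_mono C b) auto
        finally show "norm (partial_deriv b \<Psi> x) \<le> C b * ?q" using u by (simp add: field_simps)
      qed
    qed auto
    also have "\<dots> = ((\<Sum>b\<in>Basis. C b) * (1 + norm v) ^ N * (e * norm v)) / (1 + norm u) ^ N"
      unfolding sum_distrib_right[symmetric] using e by simp
    finally have "(1 + norm u) ^ N * norm (\<Psi> (u - e *\<^sub>R v) - \<Psi> u) \<le>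
        (\<Sum>b\<in>Basis. C b) * (1 + norm v) ^ N * (e * norm v)"
      using u by (simp add: pos_le_divide_eq mult.commute)
    also have "\<dots> \<le> (\<Sum>b\<in>Basis. C b) * (1 + norm v) ^ N * (e * (1 + norm v))"
      using e C0 by (intro mult_left_mono) auto
    finally show ?thesis by (simp add: mult_ac)
  qed
  then show ?thesis using C0 by blast
qed

text \<open>The error is linear in \<open>e\<close> because the moments of the Gaussian absorb the powers of \<open>1 + norm v\<close>
from \<open>schwartz_increment\<close>.\<close>

lemma mollify_approx:
  fixes \<Psi> :: "'a::euclidean_space \<Rightarrow> complex"
  assumes \<Psi>: "\<Psi> \<in> schwartz"
  shows "\<exists>K. \<forall>e u. 0 < e \<longrightarrow> e \<le> 1 \<longrightarrow> (1 + norm u) ^ N * norm (\<Psi> u - mollify e \<Psi> u) \<le> K * e"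
proof -
  obtain C where C: "0 \<le> C" "\<And>e u v. 0 < e \<Longrightarrow> e \<le> 1 \<Longrightarrow>
    (1 + norm u) ^ N * norm (\<Psi> (u - e *\<^sub>R v) - \<Psi> u) \<le> e * C * (1 + norm v) ^ Suc N"
    using schwartz_increment[OF \<Psi>] by blast
  define W where "W v = (1 + norm v) ^ Suc N * norm (gauss v)" for v :: 'a
  \<comment> \<open>The decay estimate for pairs, with a real first component held at \<open>0\<close>, where \<open>gauss\<close> equals 1.\<close>
  obtain D where D: "\<And>v :: 'a. (1 + norm (0 :: real)) ^ 0 * (1 + norm v) ^ Suc N * norm (tensor gauss gauss (0 :: real, v)) \<le> D * decay v"
    using schwartz_decay_snd[OF schwartz_tensor[OF schwartz_gauss schwartz_gauss], of 0 "Suc N"] by blast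
  note [measurable] = schwartz_measurable[OF schwartz_gauss] schwartz_measurable[OF \<Psi>]
  have W: "integrable lborel W"
  proof (rule Bochner_Integration.integrable_bound[OF integrable_mult_right[OF decay_integrable, of D]])
    show "AE v in lborel. norm (W v) \<le> norm (D * decay v)"
    proof (rule AE_I2)
      fix v :: 'a
      have "W v \<le> D * decay v" using D[of v] by (simp add: W_def tensor_def gauss_def)
      then show "norm (W v) \<le> norm (D * decay v)" by (simp add: W_def)
    qed
  qed (simp add: W_def[abs_def])
  have "(1 + norm u) ^ N * norm (\<Psi> u - mollify e \<Psi> u) \<le> (C * (LINT v|lborel. W v)) * e" if e: "0 < e" "e \<le> 1" for e u
  proof -
    have u: "0 < (1 + norm u) ^ N" by (simp add: add_pos_nonneg)
    have i1: "integrable lborel (\<lambda>v. \<Psi> (u - e *\<^sub>R v) * gauss v)"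
      using schwartz_integrable[OF schwartz_section2[OF mollify_marginal(1)[OF \<Psi>, of e], of u]] by simp
    have i2: "integrable lborel (\<lambda>v::'a. \<Psi> u * gauss v)"
      by (intro integrable_mult_right schwartz_integrable schwartz_gauss)
    have "mollify e \<Psi> u - \<Psi> u = (LINT v|lborel. \<Psi> (u - e *\<^sub>R v) * gauss v) - (LINT v|lborel. \<Psi> u * gauss (v :: 'a))"
      by (simp add: mollify_def integral_gauss)
    also have "\<dots> = (LINT v|lborel. \<Psi> (u - e *\<^sub>R v) * gauss v - \<Psi> u * gauss v)"
      by (rule Bochner_Integration.integral_diff[OF i1 i2, symmetric])
    also have "norm \<dots> \<le> (LINT v|lborel. (e * C / (1 + norm u) ^ N) * W v)"
    proof (rule Bochner_Integration.integral_norm_bound_integral)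
      show "integrable lborel (\<lambda>v. \<Psi> (u - e *\<^sub>R v) * gauss v - \<Psi> u * gauss v)" using i1 i2 by simp
      show "integrable lborel (\<lambda>v. (e * C / (1 + norm u) ^ N) * W v)" using W by simp
      fix v :: 'a
      have "norm (\<Psi> (u - e *\<^sub>R v) - \<Psi> u) \<le> (e * C / (1 + norm u) ^ N) * (1 + norm v) ^ Suc N"
        using C(2)[OF e, of u v] u by (simp add: pos_le_divide_eq mult.commute)
      then have "norm (\<Psi> (u - e *\<^sub>R v) - \<Psi> u) * norm (gauss v) \<le> (e * C / (1 + norm u) ^ N) * (1 + norm v) ^ Suc N * norm (gauss v)"
        by (intro mult_right_mono) auto
      then show "norm (\<Psi> (u - e *\<^sub>R v) * gauss v - \<Psi> u * gauss v) \<le> (e * C / (1 + norm u) ^ N) * W v"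
        unfolding W_def left_diff_distrib[symmetric] norm_mult by (simp only: mult.assoc)
    qed
    also have "\<dots> = ((C * (LINT v|lborel. W v)) * e) / (1 + norm u) ^ N" by simp
    finally show ?thesis using u by (simp add: pos_le_divide_eq mult.commute norm_minus_commute)
  qed
  then show ?thesis by blast
qed

text \<open>Mollification commutes with derivatives, so it converges to the identity in every Schwartz norm.\<close>

lemma functional_mollify_limit:
  fixes \<Phi> :: "'a::euclidean_space \<Rightarrow> complex"
  assumes T: "schwartz_functional T" and \<Phi>: "\<Phi> \<in> schwartz"
    and zero: "\<And>e. 0 < e \<Longrightarrow> T (mollify e \<Phi>) = 0"
  shows "T \<Phi> = 0"
proof -
  obtain C N where C: "0 \<le> C" "\<And>\<phi>. \<phi> \<in> schwartz \<Longrightarrow> norm (T \<phi>) \<le> C * schwartz_norm N \<phi>"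
    using functional_bound[OF T] by metis
  let ?V = "{vs :: 'a list. set vs \<subseteq> Basis \<and> length vs \<le> N}"
  have "\<forall>vs\<in>?V. \<exists>K. \<forall>e u. 0 < e \<longrightarrow> e \<le> 1 \<longrightarrow>
      (1 + norm u) ^ N * norm (iter_partial vs \<Phi> u - mollify e (iter_partial vs \<Phi>) u) \<le> K * e"
    by (intro ballI mollify_approx schwartz_iter[OF \<Phi>]) simp
  from bchoice[OF this] obtain K where K: "\<forall>vs\<in>?V. \<forall>e u. 0 < e \<longrightarrow> e \<le> 1 \<longrightarrow>
      (1 + norm u) ^ N * norm (iter_partial vs \<Phi> u - mollify e (iter_partial vs \<Phi>) u) \<le> K vs * e"
    by (rule exE)
  have "norm (T \<Phi>) \<le> (C * (\<Sum>vs\<in>?V. K vs)) * e" if e: "0 < e" "e \<le> 1" for e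
  proof -
    have "T \<Phi> = T (\<lambda>u. \<Phi> u - mollify e \<Phi> u)"
      by (simp add: functional_diff[OF T \<Phi> schwartz_mollify[OF \<Phi>]] zero[OF e(1)])
    then have "norm (T \<Phi>) \<le> C * schwartz_norm N (\<lambda>u. \<Phi> u - mollify e \<Phi> u)"
      using C(2)[OF schwartz_diff[OF \<Phi> schwartz_mollify[OF \<Phi>]]] by metis
    also have "\<dots> \<le> C * (\<Sum>vs\<in>?V. K vs * e)"
    proof (intro mult_left_mono C schwartz_norm_le)
      fix vs :: "'a list" and u assume vs: "set vs \<subseteq> Basis" "length vs \<le> N"
      then show "(1 + norm u) ^ N * norm (iter_partial vs (\<lambda>u. \<Phi> u - mollify e \<Phi> u) u) \<le> K vs * e"
        using K[rule_format, of vs e u] e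
        by (simp add: iter_partial_diff[OF \<Phi> schwartz_mollify[OF \<Phi>]] iter_partial_mollify[OF \<Phi>])
    qed
    finally show ?thesis by (simp add: sum_distrib_right mult.assoc)
  qed
  then show ?thesis by (rule le_all_scale_imp_zero)
qed

lemma gauss_tensor: "gauss = tensor gauss gauss"
  by (simp add: fun_eq_iff tensor_def gauss_def inner_prod_def distrib_left flip: of_real_mult exp_add)

text \<open>Tensor products span a dense subspace of the Schwartz space of a product. A mollified function is
an integral, over the centres \<open>z\<close>, of multiples of translates of a narrow Gaussian; on a product space
these translates are themselves tensor products, so \<open>T\<close> annihilates the integral. Letting the width
tend to zero recovers the function.\<close>

theorem functional_eq_0_if_vanishes_on_tensors:
  fixes T :: "('a::euclidean_space \<times> 'b::euclidean_space \<Rightarrow> complex) \<Rightarrow> complex"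
  assumes T: "schwartz_functional T"
    and zero: "\<And>f g. f \<in> schwartz \<Longrightarrow> g \<in> schwartz \<Longrightarrow> T (tensor f g) = 0"
    and \<Phi>: "\<Phi> \<in> schwartz"
  shows "T \<Phi> = 0"
proof (rule functional_mollify_limit[OF T \<Phi>])
  fix e :: real assume e: "0 < e"
  note [measurable] = schwartz_measurable[OF schwartz_gauss] schwartz_measurable[OF \<Phi>]
  let ?n = "DIM('a \<times> 'b)"
  define H where "H = (\<lambda>(u, z). \<Phi> z * gauss ((1 / e) *\<^sub>R (u - z)))"
  have "(\<lambda>p. tensor gauss \<Phi> ((\<lambda>(u, z). ((1 / e) *\<^sub>R (u - z), z)) p)) \<in> schwartz"
    by (rule schwartz_linear[where L' = "\<lambda>(v, z). (e *\<^sub>R v + z, z)", OF _ _ _ schwartz_tensor[OF schwartz_gauss \<Phi>]])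
      (use e in \<open>auto simp: linear_iff algebra_simps\<close>)
  then have H: "H \<in> schwartz" by (simp add: H_def tensor_def case_prod_unfold mult.commute)
  have "T (\<lambda>u. H (u, z)) = 0" for z
  proof -
    let ?g = "\<lambda>c x. gauss ((1 / e) *\<^sub>R (x - c))"
    have g: "?g c \<in> schwartz" for c :: "'c::euclidean_space"
    proof -
      have "(\<lambda>x. gauss ((- (1 / e) *\<^sub>R c) + (1 / e) *\<^sub>R x)) \<in> schwartz"
        by (rule schwartz_affine[where L' = "\<lambda>x. e *\<^sub>R x", OF _ _ _ schwartz_gauss])
          (use e in \<open>auto simp: linear_iff algebra_simps\<close>)
      then show ?thesis by (simp add: algebra_simps)
    qed
    have "(\<lambda>u. H (u, z)) = (\<lambda>u. \<Phi> z * tensor (?g (fst z)) (?g (snd z)) u)"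
      by (simp add: H_def fun_eq_iff gauss_tensor) (simp add: tensor_def case_prod_unfold)
    then show ?thesis
      by (simp add: functional_scale[OF T schwartz_tensor[OF g g]] zero[OF g g])
  qed
  from functional_marginal_eq_0[OF T H this] have "T (marginal H) = 0" .
  moreover have "mollify e \<Phi> = (\<lambda>u. of_real (inverse (e ^ ?n)) * marginal H u)"
  proof
    fix u
    have "marginal H u = of_real (\<bar>- e\<bar> ^ ?n) * (LINT v|lborel. \<Phi> (u + (- e) *\<^sub>R v) * gauss ((1 / e) *\<^sub>R (u - (u + (- e) *\<^sub>R v))))"
      unfolding marginal_def H_def case_prod_conv by (rule integral_scale) (use e in auto)
    \<comment> \<open>Substituting \<open>z = u - e *\<^sub>R v\<close> in the marginal produces the mollification up to the Jacobian.\<close>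
    also have "(\<lambda>v. \<Phi> (u + (- e) *\<^sub>R v) * gauss ((1 / e) *\<^sub>R (u - (u + (- e) *\<^sub>R v)))) = (\<lambda>v. \<Phi> (u - e *\<^sub>R v) * gauss v)"
      using e by simp
    finally show "mollify e \<Phi> u = of_real (inverse (e ^ ?n)) * marginal H u"
      using e by (simp add: mollify_def)
  qed
  ultimately show "T (mollify e \<Phi>) = 0"
    using functional_scale[OF T schwartz_marginal[OF H]] by simp
qed

section \<open>Bounded functions as tempered distributions\<close>

lemma dist_of_fun_apply: "\<phi> \<in> schwartz \<Longrightarrow> dist_of_fun F \<phi> = (LINT x|lborel. F x * \<phi> x)"
  by (simp add: dist_of_fun_def)

lemma integrable_bounded_mult:
  fixes F :: "'a::euclidean_space \<Rightarrow> complex"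
  assumes [measurable]: "F \<in> borel_measurable borel" and B: "\<And>x. norm (F x) \<le> B" and \<phi>: "\<phi> \<in> schwartz"
  shows "integrable lborel (\<lambda>x. F x * \<phi> x)"
proof (rule Bochner_Integration.integrable_bound[OF integrable_mult_right[OF schwartz_integrable[OF \<phi>], of "of_real B"]])
  note [measurable] = schwartz_measurable[OF \<phi>]
  show "(\<lambda>x. F x * \<phi> x) \<in> borel_measurable lborel" by measurable
  have "0 \<le> B" using order_trans[OF norm_ge_zero B] .
  then show "AE x in lborel. norm (F x * \<phi> x) \<le> norm (complex_of_real B * \<phi> x)"
    by (intro AE_I2) (auto simp: norm_mult intro!: mult_right_mono B)
qed

lemma dist_of_fun_tempered:
  fixes F :: "'a::euclidean_space \<Rightarrow> complex"
  assumes m: "F \<in> borel_measurable borel" and B: "\<And>x. norm (F x) \<le> B"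
  shows "dist_of_fun F \<in> tempered"
proof -
  note int = integrable_bounded_mult[OF m B]
  have B0: "0 \<le> B" using order_trans[OF norm_ge_zero B] .
  let ?c = "LINT x|lborel. decay (x :: 'a)"
  have "norm (dist_of_fun F \<phi>) \<le> (B * ?c) * schwartz_norm (2 * DIM('a)) \<phi>" if \<phi>: "\<phi> \<in> schwartz" for \<phi>
  proof -
    let ?q = "schwartz_norm (2 * DIM('a)) \<phi>"
    have "norm (LINT x|lborel. F x * \<phi> x) \<le> (LINT x|lborel. B * ?q * decay (x :: 'a))"
    proof (rule Bochner_Integration.integral_norm_bound_integral[OF int[OF \<phi>] integrable_mult_right[OF decay_integrable]])
      fix x :: 'a
      have "(1 + norm x) ^ (2 * DIM('a)) * norm (\<phi> x) \<le> ?q"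
        using schwartz_norm_ge[OF \<phi>, of "[]"] by simp
      then have "norm (\<phi> x) \<le> ?q * decay x" by (simp add: decay_def field_simps add_pos_nonneg)
      then have "norm (F x) * norm (\<phi> x) \<le> B * (?q * decay x)"
        using B B0 by (intro mult_mono) auto
      then show "norm (F x * \<phi> x) \<le> B * ?q * decay x" by (simp add: norm_mult mult.assoc)
    qed
    then show ?thesis by (simp add: dist_of_fun_apply[OF \<phi>] mult_ac)
  qed
  then show ?thesis
    unfolding tempered_def
    using int by (auto simp: dist_of_fun_def schwartz_add schwartz_scale distrib_left mult.left_commute)
qed

section \<open>The Fourier transform on a product space\<close>

text \<open>Fubini: transform in the first variable, which gives \<open>Q\<close>, and then in the second.\<close>

lemma fourier_prod:
  fixes \<psi> :: "'a::euclidean_space \<times> 'b::euclidean_space \<Rightarrow> complex"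
  assumes \<psi>: "\<psi> \<in> schwartz"
  defines "Q \<equiv> \<lambda>(\<xi>, \<omega>). fourier (\<lambda>x. \<psi> (x, \<omega>)) \<xi>"
  shows "Q \<in> schwartz" and "fourier \<psi> = partial_fourier Q"
proof -
  have "Q = (\<lambda>(\<xi>, \<omega>). partial_fourier (\<lambda>(\<omega>, x). \<psi> (x, \<omega>)) (\<omega>, \<xi>))"
    by (simp add: Q_def partial_fourier_def)
  then show "Q \<in> schwartz"
    using schwartz_swap[OF schwartz_partial_fourier[OF schwartz_swap[OF \<psi>]]] by simp
  show "fourier \<psi> = partial_fourier Q"
  proof
    fix p :: "'a \<times> 'b" obtain \<xi> \<eta> where p: "p = (\<xi>, \<eta>)" by fastforce
    have "fourier \<psi> p = (LINT \<omega>|lborel. LINT x|lborel. cis (- 2 * pi * (p \<bullet> (x, \<omega>))) * \<psi> (x, \<omega>))"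
      unfolding fourier_def by (rule lborel_integral_prod(2)[OF fourier_integrable[OF \<psi>]])
    also have "\<dots> = (LINT \<omega>|lborel. cis (- 2 * pi * (\<eta> \<bullet> \<omega>)) * Q (\<xi>, \<omega>))"
    proof (intro Bochner_Integration.integral_cong refl)
      fix \<omega>
      have "cis (- 2 * pi * (p \<bullet> (x, \<omega>))) * \<psi> (x, \<omega>) =
          cis (- 2 * pi * (\<eta> \<bullet> \<omega>)) * (cis (- 2 * pi * (\<xi> \<bullet> x)) * \<psi> (x, \<omega>))" for x
      proof -
        have "cis (- 2 * pi * (p \<bullet> (x, \<omega>))) = cis (- 2 * pi * (\<eta> \<bullet> \<omega>)) * cis (- 2 * pi * (\<xi> \<bullet> x))"
          by (simp add: p cis_mult algebra_simps)
        then show ?thesis by (simp only: mult.assoc)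
      qed
      then show "(LINT x|lborel. cis (- 2 * pi * (p \<bullet> (x, \<omega>))) * \<psi> (x, \<omega>)) = cis (- 2 * pi * (\<eta> \<bullet> \<omega>)) * Q (\<xi>, \<omega>)"
        by (simp only: Q_def fourier_def case_prod_conv Bochner_Integration.integral_mult_right_zero)
    qed
    finally show "fourier \<psi> p = partial_fourier Q p"
      by (simp add: p partial_fourier_def fourier_def)
  qed
qed

section \<open>The Cohen kernel\<close>

definition cohen_kernel :: "real^'n^'n \<Rightarrow> (real^'n) \<times> (real^'n) \<Rightarrow> complex" where
  "cohen_kernel M = (\<lambda>(x, \<omega>). complex_of_real (1 / \<bar>det M\<bar>)
     * cis (2 * pi * (x \<bullet> (transpose (matrix_inv M) *v \<omega>))))"

lemma inner_transpose_matrix: "x \<bullet> (transpose A *v y) = (A *v x) \<bullet> y" for A :: "real^'n^'m"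
proof -
  have "x \<bullet> (transpose A *v y) = (y v* A) \<bullet> x" by (simp add: inner_commute)
  also have "\<dots> = y \<bullet> (A *v x)" by (rule dot_lmul_matrix)
  finally show ?thesis by (simp add: inner_commute)
qed

lemma cohen_kernel_apply:
  "cohen_kernel M (x, \<omega>) = complex_of_real (1 / \<bar>det M\<bar>) * cis (2 * pi * ((matrix_inv M *v x) \<bullet> \<omega>))"
  unfolding cohen_kernel_def case_prod_conv inner_transpose_matrix ..

lemma matrix_vector_neg: "A *v (- x) = - (A *v x)" for A :: "real^'n^'m"
  by (rule linear_neg[OF matrix_vector_mul_linear])

lemma continuous_matrix_vector [continuous_intros]:
  "continuous_on S f \<Longrightarrow> continuous_on S (\<lambda>x. (A :: real^'n^'m) *v f x)"
  by (rule continuous_on_compose2[OF matrix_vector_mult_linear_continuous_on]) auto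

lemma cohen_kernel_measurable: "cohen_kernel M \<in> borel_measurable borel"
  unfolding cohen_kernel_def case_prod_unfold
  by (intro borel_measurable_continuous_onI continuous_intros)

lemma cohen_kernel_bound: "norm (cohen_kernel M p) \<le> 1 / \<bar>det M\<bar>"
  by (cases p) (simp add: cohen_kernel_def norm_mult norm_divide)

lemma cohen_kernel_tempered: "dist_of_fun (cohen_kernel M) \<in> tempered"
  by (rule dist_of_fun_tempered[OF cohen_kernel_measurable cohen_kernel_bound])

lemma cohen_chirp_measurable: "cohen_chirp M \<in> borel_measurable borel"
  unfolding cohen_chirp_def case_prod_unfold
  by (intro borel_measurable_continuous_onI continuous_intros)

lemma cohen_chirp_bound: "norm (cohen_chirp M p) \<le> 1"
  by (cases p) (simp add: cohen_chirp_def)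

text \<open>The substitution \<open>x = - M y\<close> is the one under which both integrals below become the expected ones.\<close>

lemma integral_neg_matrix:
  fixes M :: "real^'n^'n" and g :: "real^'n \<Rightarrow> complex"
  assumes M: "det M \<noteq> 0" and g[measurable]: "g \<in> borel_measurable borel"
  shows "(LINT x|lborel. g x) = of_real \<bar>det M\<bar> * (LINT y|lborel. g (- (M *v y)))"
proof -
  have [measurable]: "(\<lambda>x. M *v x) \<in> borel_measurable borel"
    by (intro borel_measurable_continuous_onI continuous_intros)
  have "(LINT x|lborel. g (M *v x)) =
      of_real (\<bar>- 1\<bar> ^ DIM(real^'n)) * (LINT y|lborel. g (M *v (0 + (- 1) *\<^sub>R y)))"
    by (rule integral_scale) auto
  then show ?thesis
    using integral_matrix[OF M g] by (simp add: matrix_vector_neg)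
qed

lemma matrix_inv_left_vector: "invertible M \<Longrightarrow> matrix_inv M *v (M *v y) = y" for M :: "real^'n^'n"
proof -
  assume "invertible M"
  then have "matrix_inv M ** M = mat 1"
    unfolding matrix_inv_def invertible_def by (rule someI_ex[THEN conjunct2])
  then show "matrix_inv M *v (M *v y) = y" by (simp add: matrix_vector_mul_assoc)
qed

text \<open>Against a test function, write the full Fourier transform as a partial transform of \<open>Q\<close>. The chirp is,
for fixed \<open>\<xi>\<close>, the character in \<open>\<eta>\<close> of frequency \<open>M \<xi>\<close>, so the integral over \<open>\<eta>\<close> collapses to the value
\<open>Q (\<xi>, M \<xi>)\<close>. What remains is a convergent iterated integral, which the substitution \<open>x = - M \<xi>\<close>
identifies with the pairing against the kernel and which contributes the factor \<open>1 / \<bar>det M\<bar>\<close>.\<close>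

theorem symplectic_fourier_chirp:
  fixes M :: "real^'n^'n"
  assumes M: "invertible M"
  shows "symplectic_fourier_dist (dist_of_fun (cohen_chirp M)) = dist_of_fun (cohen_kernel M)"
proof
  fix \<phi> :: "(real^'n) \<times> (real^'n) \<Rightarrow> complex"
  show "symplectic_fourier_dist (dist_of_fun (cohen_chirp M)) \<phi> = dist_of_fun (cohen_kernel M) \<phi>"
  proof (cases "\<phi> \<in> schwartz")
    case False
    then show ?thesis by (simp add: symplectic_fourier_dist_def dist_of_fun_def)
  next
    case \<phi>: True
    have det: "det M \<noteq> 0" using M by (simp add: invertible_det_nz)
    define \<psi> where "\<psi> = (\<lambda>(x, \<omega>). \<phi> (- \<omega>, x))"
    have \<psi>: "\<psi> \<in> schwartz"
      using schwartz_linear[of "\<lambda>(x, \<omega>). (- \<omega>, x)" "\<lambda>(a, b). (b, - a)" \<phi>] \<phi>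
      by (simp add: \<psi>_def case_prod_unfold linear_iff)
    define Q where "Q = (\<lambda>(\<xi>, \<omega>). fourier (\<lambda>x. \<psi> (x, \<omega>)) \<xi>)"
    have Q: "Q \<in> schwartz" "fourier \<psi> = partial_fourier Q"
      using fourier_prod[OF \<psi>] unfolding Q_def by auto
    have P: "fourier \<psi> \<in> schwartz" by (rule schwartz_fourier[OF \<psi>])
    have "symplectic_fourier_dist (dist_of_fun (cohen_chirp M)) \<phi> = (LINT p|lborel. cohen_chirp M p * fourier \<psi> p)"
      using \<phi> \<psi> P unfolding \<psi>_def[symmetric]
      by (simp add: symplectic_fourier_dist_def fourier_dist_def dist_of_fun_apply \<psi>_def[symmetric])
    also have "\<dots> = (LINT \<xi>|lborel. LINT \<eta>|lborel. cohen_chirp M (\<xi>, \<eta>) * fourier \<psi> (\<xi>, \<eta>))"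
      by (rule lborel_integral_prod(1)[OF integrable_bounded_mult[OF cohen_chirp_measurable cohen_chirp_bound P]])
    also have "\<dots> = (LINT \<xi>|lborel. Q (\<xi>, M *v \<xi>))"
    proof (intro Bochner_Integration.integral_cong refl)
      fix \<xi>
      \<comment> \<open>Fourier inversion in the second variable.\<close>
      have "(LINT \<eta>|lborel. cohen_chirp M (\<xi>, \<eta>) * fourier \<psi> (\<xi>, \<eta>)) =
          partial_fourier (partial_fourier Q) (\<xi>, - (M *v \<xi>))"
        by (simp add: Q(2) cohen_chirp_def partial_fourier_def fourier_def inner_commute)
      then show "(LINT \<eta>|lborel. cohen_chirp M (\<xi>, \<eta>) * fourier \<psi> (\<xi>, \<eta>)) = Q (\<xi>, M *v \<xi>)"
        by (simp add: partial_fourier_twice[OF Q(1)])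
    qed
    finally have lhs: "symplectic_fourier_dist (dist_of_fun (cohen_chirp M)) \<phi> = (LINT \<xi>|lborel. Q (\<xi>, M *v \<xi>))" .
    define g where "g x = complex_of_real (1 / \<bar>det M\<bar>) * partial_fourier \<phi> (x, - (matrix_inv M *v x))" for x
    have g: "g \<in> borel_measurable borel"
      unfolding g_def[abs_def]
      by (intro borel_measurable_continuous_onI continuous_intros
          continuous_on_compose2[OF schwartz_continuous[OF schwartz_partial_fourier[OF \<phi>], of UNIV]]) auto
    have "dist_of_fun (cohen_kernel M) \<phi> = (LINT x|lborel. LINT \<omega>|lborel. cohen_kernel M (x, \<omega>) * \<phi> (x, \<omega>))"
      unfolding dist_of_fun_apply[OF \<phi>]
      by (rule lborel_integral_prod(1)[OF integrable_bounded_mult[OF cohen_kernel_measurable cohen_kernel_bound \<phi>]])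
    also have "\<dots> = (LINT x|lborel. g x)"
      by (simp add: cohen_kernel_apply g_def partial_fourier_def fourier_def mult.assoc)
    also have "\<dots> = of_real \<bar>det M\<bar> * (LINT \<xi>|lborel. g (- (M *v \<xi>)))"
      by (rule integral_neg_matrix[OF det g])
    also have "\<dots> = (LINT \<xi>|lborel. of_real \<bar>det M\<bar> * g (- (M *v \<xi>)))"
      by simp
    also have "\<dots> = (LINT \<xi>|lborel. Q (\<xi>, M *v \<xi>))"
    proof (intro Bochner_Integration.integral_cong refl)
      fix \<xi>
      have "of_real \<bar>det M\<bar> * g (- (M *v \<xi>)) = partial_fourier \<phi> (- (M *v \<xi>), \<xi>)"
        using det by (simp add: g_def matrix_vector_neg matrix_inv_left_vector[OF M] flip: of_real_mult)
      then show "of_real \<bar>det M\<bar> * g (- (M *v \<xi>)) = Q (\<xi>, M *v \<xi>)"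
        by (simp add: Q_def \<psi>_def partial_fourier_def)
    qed
    finally show ?thesis using lhs by simp
  qed
qed

section \<open>The Wigner distribution as a partial Fourier transform\<close>

definition wigner_map :: "(real^'n) \<times> (real^'n) \<Rightarrow> (real^'n) \<times> (real^'n)" where
  "wigner_map = (\<lambda>(x, y). (x + (1/2) *\<^sub>R y, x - (1/2) *\<^sub>R y))"

text \<open>The pullback along \<open>wigner_map\<close> must be invertible on the Schwartz space, both to keep \<open>wigner f g\<close>
there and to reach every test function in the uniqueness proof.\<close>

definition wigner_map_inv :: "(real^'n) \<times> (real^'n) \<Rightarrow> (real^'n) \<times> (real^'n)" where
  "wigner_map_inv = (\<lambda>(a, b). ((1/2) *\<^sub>R (a + b), a - b))"

lemma wigner_map_linear: "linear wigner_map" "linear wigner_map_inv"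
  by (auto simp: wigner_map_def wigner_map_inv_def linear_iff algebra_simps)

lemma wigner_map_inverse: "wigner_map_inv (wigner_map p) = p" "wigner_map (wigner_map_inv p) = p"
  by (cases p; simp add: wigner_map_def wigner_map_inv_def algebra_simps flip: scaleR_add_left)+

lemma wigner_partial_fourier:
  "wigner f g = partial_fourier (\<lambda>p. tensor f (\<lambda>x. cnj (g x)) (wigner_map p))"
  by (simp add: fun_eq_iff wigner_def partial_fourier_def fourier_def tensor_def wigner_map_def mult.assoc)

lemma schwartz_wigner_pullback:
  "\<Phi> \<in> schwartz \<Longrightarrow> (\<lambda>p. \<Phi> (wigner_map p)) \<in> schwartz"
  by (rule schwartz_linear[OF wigner_map_linear wigner_map_inverse(1)])

text \<open>Again one integration collapses: for fixed \<open>x'\<close> the kernel is a character in \<open>\<omega>'\<close>, and integrating the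
partial transform \<open>wigner f g\<close> against it evaluates the untransformed product of \<open>f\<close> and \<open>cnj \<circ> g\<close> at
\<open>- M\<^sup>-\<^sup>1 x'\<close>. The substitution \<open>x' = - M y\<close> turns the remaining integral into the distribution of
Wigner type.\<close>

theorem cohen_kernel_convolution:
  fixes M :: "real^'n^'n"
  assumes M: "invertible M" and f: "f \<in> schwartz" and g: "g \<in> schwartz"
  shows "wigner_type (cohen_matrix M) f g z = convolution_dist (wigner f g) (dist_of_fun (cohen_kernel M)) z"
proof -
  obtain x \<omega> where z: "z = (x, \<omega>)" by fastforce
  have det: "det M \<noteq> 0" using M by (simp add: invertible_det_nz)
  define \<Psi> where "\<Psi> = (\<lambda>p. tensor f (\<lambda>x. cnj (g x)) (wigner_map p))"
  have \<Psi>: "\<Psi> \<in> schwartz"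
    unfolding \<Psi>_def by (intro schwartz_wigner_pullback schwartz_tensor schwartz_cnj f g)
  have W: "wigner f g = partial_fourier \<Psi>" unfolding \<Psi>_def by (rule wigner_partial_fourier)
  have WS: "partial_fourier \<Psi> \<in> schwartz" by (rule schwartz_partial_fourier[OF \<Psi>])
  define h where "h x' = complex_of_real (1 / \<bar>det M\<bar>) * (cis (2 * pi * ((matrix_inv M *v x') \<bullet> \<omega>))
      * \<Psi> (x - x', - (matrix_inv M *v x')))" for x'
  have h: "h \<in> borel_measurable borel"
    unfolding h_def[abs_def]
    by (intro borel_measurable_continuous_onI continuous_intros
        continuous_on_compose2[OF schwartz_continuous[OF \<Psi>, of UNIV]]) auto
  have "convolution_dist (wigner f g) (dist_of_fun (cohen_kernel M)) z =
      (LINT u|lborel. cohen_kernel M u * partial_fourier \<Psi> (z - u))"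
    by (simp add: convolution_dist_def W dist_of_fun_apply[OF schwartz_reflect[OF WS]])
  also have "\<dots> = (LINT x'|lborel. LINT \<omega>'|lborel. cohen_kernel M (x', \<omega>') * partial_fourier \<Psi> (z - (x', \<omega>')))"
    by (rule lborel_integral_prod(1)[OF integrable_bounded_mult[OF cohen_kernel_measurable cohen_kernel_bound schwartz_reflect[OF WS]]])
  also have "\<dots> = (LINT x'|lborel. h x')"
  proof (intro Bochner_Integration.integral_cong refl)
    fix x'
    define v where "v = matrix_inv M *v x'"
    define k where "k \<omega>' = cis (2 * pi * (v \<bullet> \<omega>')) * partial_fourier \<Psi> (x - x', \<omega> - \<omega>')" for \<omega>'
    have k: "k \<in> borel_measurable borel"
      unfolding k_def[abs_def]
      by (intro borel_measurable_continuous_onI continuous_intros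
        continuous_on_compose2[OF schwartz_continuous[OF WS, of UNIV]]) auto
    have "(LINT \<omega>'|lborel. cohen_kernel M (x', \<omega>') * partial_fourier \<Psi> (z - (x', \<omega>'))) =
        complex_of_real (1 / \<bar>det M\<bar>) * (LINT \<omega>'|lborel. k \<omega>')"
      by (simp add: cohen_kernel_apply v_def k_def z mult.assoc)
    \<comment> \<open>Substitute \<open>w = \<omega> - \<omega>'\<close>, so that the transform is evaluated at the integration variable.\<close>
    also have "(LINT \<omega>'|lborel. k \<omega>') = of_real (\<bar>- 1\<bar> ^ DIM(real^'n)) * (LINT w|lborel. k (\<omega> + (- 1) *\<^sub>R w))"
      by (rule integral_scale[OF k]) simp
    also have "\<dots> = (LINT w|lborel. cis (2 * pi * (v \<bullet> \<omega>)) * (cis (- 2 * pi * (v \<bullet> w)) * partial_fourier \<Psi> (x - x', w)))"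
    proof -
      have "k (\<omega> - w) = cis (2 * pi * (v \<bullet> \<omega>)) * (cis (- 2 * pi * (v \<bullet> w)) * partial_fourier \<Psi> (x - x', w))" for w
      proof -
        have "cis (2 * pi * (v \<bullet> (\<omega> - w))) = cis (2 * pi * (v \<bullet> \<omega>)) * cis (- 2 * pi * (v \<bullet> w))"
          by (simp add: cis_mult inner_diff_right algebra_simps)
        then show ?thesis by (simp add: k_def mult.assoc)
      qed
      then show ?thesis by simp
    qed
    also have "\<dots> = cis (2 * pi * (v \<bullet> \<omega>)) * partial_fourier (partial_fourier \<Psi>) (x - x', v)"
      by (simp add: partial_fourier_def[of "partial_fourier \<Psi>"] fourier_def)
    finally show "(LINT \<omega>'|lborel. cohen_kernel M (x', \<omega>') * partial_fourier \<Psi> (z - (x', \<omega>'))) = h x'"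
      by (simp add: partial_fourier_twice[OF \<Psi>] h_def v_def)
  qed
  also have "\<dots> = of_real \<bar>det M\<bar> * (LINT y|lborel. h (- (M *v y)))"
    by (rule integral_neg_matrix[OF det h])
  also have "\<dots> = (LINT y|lborel. of_real \<bar>det M\<bar> * h (- (M *v y)))" by simp
  also have "\<dots> = wigner_type (cohen_matrix M) f g z"
    unfolding z wigner_type_cohen_matrix
  proof (intro Bochner_Integration.integral_cong refl)
    fix y
    have "of_real \<bar>det M\<bar> * h (- (M *v y)) = cis (2 * pi * ((- y) \<bullet> \<omega>)) * \<Psi> (x + M *v y, y)"
      using det by (simp add: h_def matrix_vector_neg matrix_inv_left_vector[OF M])
    then show "of_real \<bar>det M\<bar> * h (- (M *v y)) = cis (- 2 * pi * (\<omega> \<bullet> y)) * f (x + (M + (1 / 2) *\<^sub>R mat 1) *v y)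
        * cnj (g (x + (M - (1 / 2) *\<^sub>R mat 1) *v y))"
      by (simp add: \<Psi>_def tensor_def wigner_map_def matrix_vector_mult_add_rdistrib matrix_vector_mult_diff_rdistrib
          scaleR_matrix_vector_assoc[symmetric] inner_commute mult.assoc add.assoc add_diff_eq)
  qed
  finally show ?thesis by simp
qed

section \<open>Uniqueness of the kernel\<close>

text \<open>Already the value of the convolution at \<open>0\<close> determines the kernel. It pairs \<open>S\<close> with the reflected
\<open>wigner f g\<close>, which is the image of \<open>tensor f (cnj \<circ> g)\<close> under a continuous linear operator \<open>A\<close> of the
Schwartz space. So \<open>S - T\<close> pulls back along \<open>A\<close> to a functional that annihilates all tensor products,
hence to zero, and \<open>A\<close> is onto.\<close>

lemma cohen_kernel_unique:
  fixes S T :: "((real^'n) \<times> (real^'n) \<Rightarrow> complex) \<Rightarrow> complex"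
  assumes S: "S \<in> tempered" and T: "T \<in> tempered"
    and eq: "\<And>f g. f \<in> schwartz \<Longrightarrow> g \<in> schwartz \<Longrightarrow>
      convolution_dist (wigner f g) S 0 = convolution_dist (wigner f g) T 0"
  shows "S = T"
proof
  define A where "A \<Phi> = (\<lambda>u. partial_fourier (\<lambda>p. \<Phi> (wigner_map p)) (- u))" for \<Phi> :: "(real^'n) \<times> (real^'n) \<Rightarrow> complex"
  have A: "cont_op A"
    unfolding A_def[abs_def]
    by (intro cont_op_comp[of "\<lambda>f u. f (- u)" "\<lambda>\<Phi>. partial_fourier (\<lambda>p. \<Phi> (wigner_map p))"]
        cont_op_comp[OF cont_op_partial_fourier] cont_op_linear[OF wigner_map_linear wigner_map_inverse(1)]
        cont_op_linear[where L' = uminus]) (auto simp: linear_iff)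
  have DF: "schwartz_functional (\<lambda>\<phi>. S \<phi> - T \<phi>)"
    using S T by (intro functional_minus) (auto simp: tempered_iff)
  have DA: "schwartz_functional (\<lambda>\<Phi>. S (A \<Phi>) - T (A \<Phi>))"
  proof (rule functional_comp[OF DF A])
    show "A (\<lambda>x. \<phi> x + \<psi> x) = (\<lambda>x. A \<phi> x + A \<psi> x)" if "\<phi> \<in> schwartz" "\<psi> \<in> schwartz" for \<phi> \<psi>
    proof
      fix u :: "(real^'n) \<times> (real^'n)"
      obtain x \<omega> where u: "- u = (x, \<omega>)" by fastforce
      show "A (\<lambda>x. \<phi> x + \<psi> x) u = A \<phi> u + A \<psi> u"
        using fourier_integrable[OF schwartz_section2[OF schwartz_wigner_pullback[OF that(1)]], of \<omega> x]
          fourier_integrable[OF schwartz_section2[OF schwartz_wigner_pullback[OF that(2)]], of \<omega> x]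
        by (simp add: A_def u partial_fourier_def fourier_def distrib_left)
    qed
    show "A (\<lambda>x. c * \<phi> x) = (\<lambda>x. c * A \<phi> x)" for c \<phi>
      by (simp add: fun_eq_iff A_def partial_fourier_def fourier_scale case_prod_unfold)
  qed
  have tens: "S (A (tensor f g)) - T (A (tensor f g)) = 0" if "f \<in> schwartz" "g \<in> schwartz" for f g
    using eq[OF that(1) schwartz_cnj[OF that(2)]]
    by (simp add: convolution_dist_def wigner_partial_fourier A_def)
  fix \<phi>
  show "S \<phi> = T \<phi>"
  proof (cases "\<phi> \<in> schwartz")
    case False
    then show ?thesis using S T by (simp add: tempered_iff extensional_def)
  next
    case \<phi>: True
    \<comment> \<open>A preimage of \<open>\<phi>\<close> under \<open>A\<close>: undo the reflection, the partial transform and the pullback in turn.\<close>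
    define \<phi>' where "\<phi>' = (\<lambda>p. \<phi> (- p))"
    define \<Psi> where "\<Psi> = (\<lambda>(x, y). partial_fourier \<phi>' (x, - y))"
    define \<Phi> where "\<Phi> = (\<lambda>q. \<Psi> (wigner_map_inv q))"
    have \<phi>': "\<phi>' \<in> schwartz" unfolding \<phi>'_def by (rule schwartz_minus[OF \<phi>])
    have P: "partial_fourier \<phi>' \<in> schwartz" by (rule schwartz_partial_fourier[OF \<phi>'])
    have \<Psi>: "\<Psi> \<in> schwartz"
      using schwartz_linear[of "\<lambda>(x, y). (x, - y)" "\<lambda>(x, y). (x, - y)", OF _ _ _ P]
      by (simp add: \<Psi>_def case_prod_unfold linear_iff)
    have \<Phi>: "\<Phi> \<in> schwartz"
      unfolding \<Phi>_def by (rule schwartz_linear[OF wigner_map_linear(2,1) wigner_map_inverse(2) \<Psi>])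
    have "partial_fourier \<Psi> (x, \<omega>) = \<phi>' (x, \<omega>)" for x \<omega>
    proof -
      have "partial_fourier \<Psi> (x, \<omega>) = partial_fourier (partial_fourier \<phi>') (x, - \<omega>)"
        using fourier_minus[OF schwartz_measurable[OF schwartz_section2[OF P]], of x \<omega>]
        unfolding partial_fourier_def[of \<Psi>] partial_fourier_def[of "partial_fourier \<phi>'"]
        by (simp add: \<Psi>_def)
      then show ?thesis by (simp add: partial_fourier_twice[OF \<phi>'])
    qed
    then have inv: "partial_fourier \<Psi> p = \<phi> (- p)" for p
      by (cases p) (simp add: \<phi>'_def)
    have "A \<Phi> = \<phi>"
      unfolding A_def \<Phi>_def wigner_map_inverse inv by simp
    moreover have "S (A \<Phi>) - T (A \<Phi>) = 0"
      by (rule functional_eq_0_if_vanishes_on_tensors[OF DA tens \<Phi>])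
    ultimately show ?thesis by simp
  qed
qed

text \<open>If \<open>(x, y)\<close> is in the kernel, subtracting the two block rows leaves \<open>y = 0\<close>, and then \<open>x = 0\<close>.\<close>

lemma cohen_matrix_invertible: "invertible (cohen_matrix M)" for M :: "real^'n^'n"
proof -
  have "v = 0" if v: "cohen_matrix M *v v = 0" for v
  proof -
    define x y where "x = (\<chi> i. v $ Inl i)" and "y = (\<chi> i. v $ Inr i)"
    have split: "(\<Sum>c\<in>UNIV. F c) = (\<Sum>i\<in>UNIV. F (Inl i)) + (\<Sum>i\<in>UNIV. F (Inr i))" for F :: "'n + 'n \<Rightarrow> real"
      unfolding UNIV_Plus_UNIV[symmetric] by (subst sum.Plus) auto
    have "x + (M + (1/2) *\<^sub>R mat 1) *v y = 0"
    proof (subst vec_eq_iff, rule allI)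
      fix i show "(x + (M + (1/2) *\<^sub>R mat 1) *v y) $ i = 0 $ i"
        using arg_cong[OF v, of "\<lambda>w. w $ Inl i"]
        by (simp add: matrix_vector_mult_def split cohen_matrix_def x_def y_def mat_def if_distrib[of "\<lambda>c. c * _"] cong: if_cong)
    qed
    moreover have "x + (M - (1/2) *\<^sub>R mat 1) *v y = 0"
    proof (subst vec_eq_iff, rule allI)
      fix i show "(x + (M - (1/2) *\<^sub>R mat 1) *v y) $ i = 0 $ i"
        using arg_cong[OF v, of "\<lambda>w. w $ Inr i"]
        by (simp add: matrix_vector_mult_def split cohen_matrix_def x_def y_def mat_def if_distrib[of "\<lambda>c. c * _"] cong: if_cong)
    qed
    moreover have "(M + (1/2) *\<^sub>R mat 1) *v y = M *v y + (1/2) *\<^sub>R y"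
      "(M - (1/2) *\<^sub>R mat 1) *v y = M *v y - (1/2) *\<^sub>R y"
      by (simp_all add: matrix_vector_mult_add_rdistrib matrix_vector_mult_diff_rdistrib
          scaleR_matrix_vector_assoc[symmetric])
    ultimately have *: "x + (M *v y + (1/2) *\<^sub>R y) = 0" "x + (M *v y - (1/2) *\<^sub>R y) = 0"
      by simp_all
    have "y = (x + (M *v y + (1/2) *\<^sub>R y)) - (x + (M *v y - (1/2) *\<^sub>R y))"
      by (simp flip: scaleR_add_left)
    then have y: "y = 0" unfolding * by simp
    then have x: "x = 0" using *(1) by simp
    show "v = 0"
    proof (subst vec_eq_iff, rule allI)
      fix c show "v $ c = 0 $ c"
        using x y by (cases c) (auto simp: x_def y_def vec_eq_iff)
    qed
  qed
  then have "\<exists>B. B ** cohen_matrix M = mat 1"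
    unfolding matrix_left_invertible_ker by blast
  then show ?thesis unfolding invertible_left_inverse .
qed

theorem theorem4p9:
  fixes M :: "real^'n^'n"
  assumes "invertible M"
  shows "invertible (cohen_matrix M) \<and>
    (\<forall>\<theta>. is_cohen_kernel (cohen_matrix M) \<theta> \<longleftrightarrow>
         \<theta> = symplectic_fourier_dist (dist_of_fun (cohen_chirp M))) \<and>
    symplectic_fourier_dist (dist_of_fun (cohen_chirp M)) =
      dist_of_fun (\<lambda>(x, \<omega>). complex_of_real (1 / \<bar>det M\<bar>)
        * cis (2 * pi * (x \<bullet> (transpose (matrix_inv M) *v \<omega>))))"
proof (intro conjI allI iffI)
  let ?S = "symplectic_fourier_dist (dist_of_fun (cohen_chirp M))"
  have S: "?S = dist_of_fun (cohen_kernel M)" by (rule symplectic_fourier_chirp[OF assms])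
  show "invertible (cohen_matrix M)" by (rule cohen_matrix_invertible)
  show "?S = dist_of_fun (\<lambda>(x, \<omega>). complex_of_real (1 / \<bar>det M\<bar>)
        * cis (2 * pi * (x \<bullet> (transpose (matrix_inv M) *v \<omega>))))"
    using S unfolding cohen_kernel_def .
  fix \<theta>
  show "is_cohen_kernel (cohen_matrix M) \<theta>" if "\<theta> = ?S"
    unfolding that S is_cohen_kernel_def
    using cohen_kernel_tempered cohen_kernel_convolution[OF assms] by blast
  show "\<theta> = ?S" if \<theta>: "is_cohen_kernel (cohen_matrix M) \<theta>"
  proof (rule cohen_kernel_unique)
    show "\<theta> \<in> tempered" using \<theta> unfolding is_cohen_kernel_def by blast
    show "?S \<in> tempered" unfolding S by (rule cohen_kernel_tempered)
    show "convolution_dist (wigner f g) \<theta> 0 = convolution_dist (wigner f g) ?S 0"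
      if "f \<in> schwartz" "g \<in> schwartz" for f g
      using \<theta> that cohen_kernel_convolution[OF assms that, of 0] unfolding S is_cohen_kernel_def by metis
  qed
qed

end
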